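(* Let $m\ge0$ and let $V=(V_{ij})_{i,j=1}^2$ be a $2\times 2$ matrix-valued function on $\mathbb{R}$ (not assumed Hermitian) with $V_{ij}\in L^p(\mathbb{R})$ for $i,j=1,2$ and some $p\in(1,\infty)$, and set $$\|V\|_p:=\left(\int_{\mathbb{R}}\|V(x)\|^p\,dx\right)^{1/p}.$$ Let $H$ be the Dirac operator with potential $V$ (described in the context). Let $z\in\rho(H_0)=\mathbb{C}\setminus\big((-\infty,-m]\cup[m,\infty)\big)$ and $$\eta(|\Phi(z)|):=\frac1{\sqrt2}\sqrt{1+\frac{|z|^2+m^2}{|z^2-m^2|}} .$$ If $$\eta(|\Phi(z)|)\left(\frac{2(p-1)}{p}\right)^{(p-1)/p}\left(\operatorname{Im}\sqrt{z^2-m^2}\right)^{-(p-1)/p}\|V\|_p<1,$$ then $z\notin\sigma(H)$.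
   Context: Units are chosen so that $\hbar=c=1$. The Hilbert space is $\mathcal{H}=L^2(\mathbb{R})\otimes\mathbb{C}^2=L^2(\mathbb{R};\mathbb{C}^2)$. The free Dirac operator is the selfadjoint operator $H_0=-i\frac{d}{dx}\sigma_1+m\sigma_3$ with domain $H^1(\mathbb{R};\mathbb{C}^2)$, where $\sigma_1=\begin{pmatrix}0&1\\1&0\end{pmatrix}$, $\sigma_3=\begin{pmatrix}1&0\\0&-1\end{pmatrix}$; $R_0(z)=(H_0-z)^{-1}$. $\|V(x)\|$ is the operator norm of the matrix $V(x)$ on $\mathbb{C}^2$ with Euclidean norm; $V$ is identified with the closed maximal multiplication operator in $\mathcal{H}$. Definition of $H$: let $V=U|V|$ be the polar decomposition and $A:=|V|^{1/2}$, $B:=U|V|^{1/2}$, so $V=BA$. For $z\in\rho(H_0)$, $AR_0(z)$ is bounded and $R_0(z)B$, $AR_0(z)B$ have bounded closures; put $Q(z):=\overline{AR_0(z)B}$. Then $H$ is the closed densely defined extension of $H_0+V$ with $\rho(H)\cap\rho(H_0)=\{z\in\rho(H_0): -1\in\rho(Q(z))\}\neq\emptyset$ and, for $z$ in this set, $(H-z)^{-1}=R_0(z)-\overline{R_0(z)B}\,(I+Q(z))^{-1}AR_0(z)$. If $V$ is bounded, or if $p\ge2$, then $H=H_0+V$ on the domain of $H_0$. The branch of $\sqrt{z^2-m^2}$, $z\in\rho(H_0)$, is chosen such that $\operatorname{Im}\sqrt{z^2-m^2}>0$. The symbol $\eta(|\Phi(z)|)$ equals $\eta(s)=\sqrt{\frac12+\frac14(s+s^{-1})}$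 evaluated at $s=|\Phi(z)|$, $\Phi(z)=\frac{z+m}{z-m}$. *)

theory Defs
  imports "HOL-Analysis.Analysis"
begin

section \<open>The Hilbert space of square-integrable spinors on the real line\<close>

definition square_integrable :: "(real \<Rightarrow> complex ^ 2) \<Rightarrow> bool" where
  "square_integrable f \<longleftrightarrow>
     f \<in> borel_measurable lborel \<and> integrable lborel (\<lambda>x. (norm (f x))\<^sup>2)"

lemma square_integrable_inner:
  assumes "square_integrable f" "square_integrable g"
  shows "integrable lborel (\<lambda>x. inner (f x) (g x))"
proof (rule Bochner_Integration.integrable_bound)
  show "integrable lborel (\<lambda>x. (norm (f x))\<^sup>2 + (norm (g x))\<^sup>2)"
    using assms by (auto simp: square_integrable_def)
  show "(\<lambda>x. inner (f x) (g x)) \<in> borel_measurable lborel"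
    using assms by (auto simp: square_integrable_def)
  have "\<bar>inner (f x) (g x)\<bar> \<le> (norm (f x))\<^sup>2 + (norm (g x))\<^sup>2" for x
  proof -
    have "\<bar>inner (f x) (g x)\<bar> \<le> norm (f x) * norm (g x)"
      by (rule Cauchy_Schwarz_ineq2)
    also have "\<dots> \<le> 2 * (norm (f x) * norm (g x))"
      by simp
    also have "\<dots> \<le> (norm (f x))\<^sup>2 + (norm (g x))\<^sup>2"
      using sum_squares_bound[of "norm (f x)" "norm (g x)"] by (simp add: mult.assoc)
    finally show ?thesis .
  qed
  then show "AE x in lborel. norm (inner (f x) (g x)) \<le> norm ((norm (f x))\<^sup>2 + (norm (g x))\<^sup>2)"
    by simp
qed

lemma square_integrable_add:
  assumes "square_integrable f" "square_integrable g"
  shows "square_integrable (\<lambda>x. f x + g x)"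
proof -
  have "integrable lborel (\<lambda>x. (norm (f x))\<^sup>2 + (norm (g x))\<^sup>2 + 2 * inner (f x) (g x))"
    using assms square_integrable_inner[OF assms] by (auto simp: square_integrable_def)
  moreover have "(\<lambda>x. (norm (f x))\<^sup>2 + (norm (g x))\<^sup>2 + 2 * inner (f x) (g x))
      = (\<lambda>x. (norm (f x + g x))\<^sup>2)"
    by (simp add: power2_norm_eq_inner inner_add inner_commute fun_eq_iff)
  ultimately show ?thesis
    using assms by (auto simp: square_integrable_def)
qed

lemma square_integrable_scaleR:
  "square_integrable f \<Longrightarrow> square_integrable (\<lambda>x. r *\<^sub>R f x)"
  by (auto simp: square_integrable_def power_mult_distrib)

lemma norm_cvector_smult: "norm (c *s (v :: complex ^ 2)) = cmod c * norm v"
  by (simp add: norm_vec_def norm_mult L2_set_right_distrib)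

lemma borel_measurable_cvector_smult:
  assumes "f \<in> borel_measurable M"
  shows "(\<lambda>x. c *s (f x :: complex ^ 2)) \<in> borel_measurable M"
proof -
  have "linear (\<lambda>v :: complex ^ 2. c *s v)"
    by (rule linearI) (simp_all add: vector_add_ldistrib vec_eq_iff)
  then have "continuous_on UNIV (\<lambda>v :: complex ^ 2. c *s v)"
    by (simp add: linear_continuous_on linear_linear)
  then show ?thesis
    using assms borel_measurable_continuous_on by blast
qed

lemma square_integrable_smult:
  assumes "square_integrable f" shows "square_integrable (\<lambda>x. c *s f x)"
  using assms
  by (auto simp: square_integrable_def norm_cvector_smult power_mult_distrib
      intro: borel_measurable_cvector_smult)

definition L2_rel :: "(real \<Rightarrow> complex ^ 2) \<Rightarrow> (real \<Rightarrow> complex ^ 2) \<Rightarrow> bool" where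
  "L2_rel f g \<longleftrightarrow> square_integrable f \<and> square_integrable g \<and> (AE x in lborel. f x = g x)"

text \<open>
  Borel representatives suffice: every Lebesgue-measurable function agrees almost everywhere
  with a Borel function, so these are the usual classes of Lebesgue square-integrable functions.
\<close>

quotient_type L2 = "real \<Rightarrow> complex ^ 2" / partial: L2_rel
proof (rule part_equivpI)
  show "\<exists>f. L2_rel f f"
    by (rule exI[of _ "\<lambda>_. 0"]) (simp add: L2_rel_def square_integrable_def)
  show "symp L2_rel"
    by (auto simp: symp_def L2_rel_def)
  show "transp L2_rel"
    by (rule transpI) (auto simp: L2_rel_def)
qed

instantiation L2 :: real_inner
begin

lift_definition zero_L2 :: L2 is "\<lambda>_. 0"
  by (simp add: L2_rel_def square_integrable_def)

lift_definition plus_L2 :: "L2 \<Rightarrow> L2 \<Rightarrow> L2" is "\<lambda>f g x. f x + g x"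
  by (auto simp: L2_rel_def intro: square_integrable_add)

lift_definition scaleR_L2 :: "real \<Rightarrow> L2 \<Rightarrow> L2" is "\<lambda>r f x. r *\<^sub>R f x"
  by (auto simp: L2_rel_def intro: square_integrable_scaleR)

definition uminus_L2 :: "L2 \<Rightarrow> L2" where "uminus_L2 f = (-1) *\<^sub>R f"

definition minus_L2 :: "L2 \<Rightarrow> L2 \<Rightarrow> L2" where "minus_L2 f g = f + - (g :: L2)"

text \<open>The class \<open>real_inner\<close> asks for the real part of the Hermitian inner product.\<close>

lift_definition inner_L2 :: "L2 \<Rightarrow> L2 \<Rightarrow> real" is "\<lambda>f g. LINT x|lborel. inner (f x) (g x)"
proof -
  fix f f' g g' assume "L2_rel f f'" "L2_rel g g'"
  then show "(LINT x|lborel. inner (f x) (g x)) = (LINT x|lborel. inner (f' x) (g' x))"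
    by (intro integral_cong_AE) (auto simp: L2_rel_def square_integrable_def)
qed

definition norm_L2 :: "L2 \<Rightarrow> real" where "norm_L2 f = sqrt (inner f f)"

definition sgn_L2 :: "L2 \<Rightarrow> L2" where "sgn_L2 f = inverse (norm f) *\<^sub>R f"

definition dist_L2 :: "L2 \<Rightarrow> L2 \<Rightarrow> real" where "dist_L2 f g = norm (f - g)"

definition uniformity_L2 :: "(L2 \<times> L2) filter" where
  "uniformity_L2 = (INF e\<in>{0<..}. principal {(f, g). dist f g < e})"

definition open_L2 :: "L2 set \<Rightarrow> bool" where
  "open_L2 U \<longleftrightarrow> (\<forall>f\<in>U. eventually (\<lambda>(f', g). f' = f \<longrightarrow> g \<in> U) uniformity)"

instance
proof
  fix f g h :: L2 and r s :: real
  show "f + g + h = f + (g + h)"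
    by transfer (simp add: L2_rel_def square_integrable_add add.assoc)
  show "f + g = g + f"
    by transfer (simp add: L2_rel_def square_integrable_add add.commute)
  show "0 + f = f"
    by transfer (simp add: L2_rel_def)
  show "- f + f = 0"
    unfolding uminus_L2_def
    by transfer (simp add: L2_rel_def square_integrable_def)
  show "f - g = f + - g"
    by (simp add: minus_L2_def)
  show "r *\<^sub>R (f + g) = r *\<^sub>R f + r *\<^sub>R g"
    by transfer (simp add: L2_rel_def square_integrable_add square_integrable_scaleR scaleR_add_right)
  show "(r + s) *\<^sub>R f = r *\<^sub>R f + s *\<^sub>R f"
    by transfer (simp add: L2_rel_def square_integrable_add square_integrable_scaleR scaleR_add_left)
  show "r *\<^sub>R s *\<^sub>R f = (r * s) *\<^sub>R f"
    by transfer (simp add: L2_rel_def square_integrable_scaleR)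
  show "1 *\<^sub>R f = f"
    by transfer (simp add: L2_rel_def)
  show "dist f g = norm (f - g)"
    by (simp add: dist_L2_def)
  show "sgn f = inverse (norm f) *\<^sub>R f"
    by (simp add: sgn_L2_def)
  show "uniformity = (INF e\<in>{0<..}. principal {(f :: L2, g). dist f g < e})"
    by (simp add: uniformity_L2_def)
  show "open U \<longleftrightarrow> (\<forall>f\<in>U. eventually (\<lambda>(f', g). f' = f \<longrightarrow> g \<in> U) uniformity)" for U :: "L2 set"
    by (simp add: open_L2_def)
  show "inner f g = inner g f"
    by transfer (simp add: inner_commute)
  show "inner (f + g) h = inner f h + inner g h"
    by transfer (simp add: L2_rel_def inner_add_left square_integrable_inner)
  show "inner (r *\<^sub>R f) g = r * inner f g"
    by transfer simp
  show "0 \<le> inner f f"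
    by transfer (simp add: integral_nonneg_AE)
  show "inner f f = 0 \<longleftrightarrow> f = 0"
  proof transfer
    fix f assume "L2_rel f f"
    then have f: "square_integrable f" by (simp add: L2_rel_def)
    have "(LINT x|lborel. inner (f x) (f x)) = 0 \<longleftrightarrow> (AE x in lborel. inner (f x) (f x) = 0)"
      using square_integrable_inner[OF f f] by (intro integral_nonneg_eq_0_iff_AE) auto
    then show "(LINT x|lborel. inner (f x) (f x)) = 0 \<longleftrightarrow> L2_rel f (\<lambda>_. 0)"
      using f by (simp add: L2_rel_def square_integrable_def)
  qed
  show "norm f = sqrt (inner f f)"
    by (simp add: norm_L2_def)
qed

end

lift_definition scaleC_L2 :: "complex \<Rightarrow> L2 \<Rightarrow> L2" (infixr "*\<^sub>C" 75) is "\<lambda>c f x. c *s f x"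
  by (auto simp: L2_rel_def intro: square_integrable_smult)

section \<open>Unbounded operators\<close>

text \<open>
  An operator is represented by its graph; its domain is \<open>Domain T\<close>, \<open>T \<subseteq> T'\<close> says that
  \<open>T'\<close> extends \<open>T\<close>, \<open>closure T\<close> is the closure of the graph, and \<open>T\<inverse>\<close> is the inverse.
\<close>

type_synonym L2_op = "(L2 \<times> L2) set"

definition linear_op :: "L2_op \<Rightarrow> bool" where
  "linear_op T \<longleftrightarrow> single_valued T \<and> (0, 0) \<in> T \<and>
     (\<forall>(f, g)\<in>T. \<forall>(f', g')\<in>T. (f + f', g + g') \<in> T) \<and>
     (\<forall>(f, g)\<in>T. \<forall>c. (c *\<^sub>C f, c *\<^sub>C g) \<in> T)"

definition densely_defined :: "L2_op \<Rightarrow> bool" where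
  "densely_defined T \<longleftrightarrow> closure (Domain T) = UNIV"

definition op_add :: "L2_op \<Rightarrow> L2_op \<Rightarrow> L2_op" where
  "op_add S T = {(f, g + h) | f g h. (f, g) \<in> S \<and> (f, h) \<in> T}"

definition op_diff :: "L2_op \<Rightarrow> L2_op \<Rightarrow> L2_op" where
  "op_diff S T = {(f, g - h) | f g h. (f, g) \<in> S \<and> (f, h) \<in> T}"

text \<open>\<open>op_comp S T\<close> applies \<open>T\<close> first, whereas \<open>(O)\<close> composes from left to right.\<close>

definition op_comp :: "L2_op \<Rightarrow> L2_op \<Rightarrow> L2_op" where
  "op_comp S T = T O S"

definition op_shift :: "L2_op \<Rightarrow> complex \<Rightarrow> L2_op" where
  "op_shift T z = {(f, g - z *\<^sub>C f) | f g. (f, g) \<in> T}"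

definition resolvent :: "L2_op \<Rightarrow> complex \<Rightarrow> L2_op" where
  "resolvent T z = (op_shift T z)\<inverse>"

text \<open>
  The resolvent of \<open>T\<close> at \<open>z\<close> is required to be (the graph of) an everywhere defined bounded
  operator; complex linearity of it is inherited from \<open>T\<close>.
\<close>

definition resolvent_set :: "L2_op \<Rightarrow> complex set" where
  "resolvent_set T = {z. \<exists>R. bounded_linear R \<and> resolvent T z = {(g, R g) | g. True}}"

definition op_spectrum :: "L2_op \<Rightarrow> complex set" where
  "op_spectrum T = - resolvent_set T"

text \<open>The maximal multiplication operator: \<open>f\<close> is in its domain iff \<open>M f\<close> is square-integrable.\<close>

definition mult_op :: "(real \<Rightarrow> complex ^ 2 ^ 2) \<Rightarrow> L2_op" where
  "mult_op M = {(f, g). AE x in lborel. rep_L2 g x = M x *v rep_L2 f x}"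

section \<open>The free Dirac operator\<close>

definition test_function :: "(real \<Rightarrow> real) \<Rightarrow> bool" where
  "test_function \<phi> \<longleftrightarrow>
     (\<forall>n x. (deriv ^^ n) \<phi> differentiable (at x)) \<and> bounded {x. \<phi> x \<noteq> 0}"

definition weak_derivative :: "L2 \<Rightarrow> L2 \<Rightarrow> bool" where
  "weak_derivative f f' \<longleftrightarrow> (\<forall>\<phi>. test_function \<phi> \<longrightarrow>
     (LINT x|lborel. deriv \<phi> x *\<^sub>R rep_L2 f x) = - (LINT x|lborel. \<phi> x *\<^sub>R rep_L2 f' x))"

definition sigma1 :: "complex ^ 2 ^ 2" where
  "sigma1 = vector [vector [0, 1], vector [1, 0]]"

definition sigma3 :: "complex ^ 2 ^ 2" where
  "sigma3 = vector [vector [1, 0], vector [0, - 1]]"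

text \<open>
  The domain consists of those \<open>f\<close> in \<open>L\<^sup>2\<close> that have a weak derivative \<open>f'\<close> in \<open>L\<^sup>2\<close>,
  i.e. it is the Sobolev space \<open>H\<^sup>1\<close>.
\<close>

definition free_dirac :: "real \<Rightarrow> L2_op" where
  "free_dirac m = {(f, g). \<exists>f'. weak_derivative f f' \<and>
     (AE x in lborel. rep_L2 g x =
        (- \<i>) *s (sigma1 *v rep_L2 f' x) + complex_of_real m *s (sigma3 *v rep_L2 f x))}"

section \<open>The Dirac operator with potential\<close>

definition matrix_adjoint :: "complex ^ 2 ^ 2 \<Rightarrow> complex ^ 2 ^ 2" where
  "matrix_adjoint M = (\<chi> i j. cnj (M $ j $ i))"

definition matrix_psd :: "complex ^ 2 ^ 2 \<Rightarrow> bool" where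
  "matrix_psd M \<longleftrightarrow> (\<forall>v. (\<Sum>i\<in>UNIV. cnj (v $ i) * (M *v v) $ i) \<in> \<real>\<^sub>\<ge>\<^sub>0)"

definition matrix_sqrt :: "complex ^ 2 ^ 2 \<Rightarrow> complex ^ 2 ^ 2" where
  "matrix_sqrt P = (THE S. matrix_psd S \<and> S ** S = P)"

definition matrix_abs :: "complex ^ 2 ^ 2 \<Rightarrow> complex ^ 2 ^ 2" where
  "matrix_abs M = matrix_sqrt (matrix_adjoint M ** M)"

text \<open>
  The partial isometry in the polar decomposition; it is determined by \<open>M = U |M|\<close> and by
  vanishing on the kernel of \<open>|M|\<close>.
\<close>

definition matrix_phase :: "complex ^ 2 ^ 2 \<Rightarrow> complex ^ 2 ^ 2" where
  "matrix_phase M =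
     (THE U. M = U ** matrix_abs M \<and> (\<forall>v. matrix_abs M *v v = 0 \<longrightarrow> U *v v = 0))"

definition A_op :: "(real \<Rightarrow> complex ^ 2 ^ 2) \<Rightarrow> L2_op" where
  "A_op V = mult_op (\<lambda>x. matrix_sqrt (matrix_abs (V x)))"

definition B_op :: "(real \<Rightarrow> complex ^ 2 ^ 2) \<Rightarrow> L2_op" where
  "B_op V = mult_op (\<lambda>x. matrix_phase (V x) ** matrix_sqrt (matrix_abs (V x)))"

definition Q_op :: "real \<Rightarrow> (real \<Rightarrow> complex ^ 2 ^ 2) \<Rightarrow> complex \<Rightarrow> L2_op" where
  "Q_op m V z =
     closure (op_comp (A_op V) (op_comp (resolvent (free_dirac m) z) (B_op V)))"

text \<open>
  \<open>(I + Q(z))\<^sup>-\<^sup>1\<close> is the resolvent of \<open>Q(z)\<close> at \<open>-1\<close>.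
\<close>

definition dirac_operator :: "real \<Rightarrow> (real \<Rightarrow> complex ^ 2 ^ 2) \<Rightarrow> L2_op \<Rightarrow> bool" where
  "dirac_operator m V H \<longleftrightarrow>
     linear_op H \<and> closed H \<and> densely_defined H \<and>
     op_add (free_dirac m) (mult_op V) \<subseteq> H \<and>
     resolvent_set H \<inter> resolvent_set (free_dirac m) =
       {z \<in> resolvent_set (free_dirac m). - 1 \<in> resolvent_set (Q_op m V z)} \<and>
     resolvent_set H \<inter> resolvent_set (free_dirac m) \<noteq> {} \<and>
     (\<forall>z \<in> resolvent_set H \<inter> resolvent_set (free_dirac m).
        resolvent H z =
          op_diff (resolvent (free_dirac m) z)
            (op_comp (closure (op_comp (resolvent (free_dirac m) z) (B_op V)))
              (op_comp (resolvent (Q_op m V z) (- 1))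
                (op_comp (A_op V) (resolvent (free_dirac m) z)))))"

lemma resolvent_mem_iff: "(g, f) \<in> resolvent T z \<longleftrightarrow> (f, g + z *\<^sub>C f) \<in> T"
  by (force simp: resolvent_def op_shift_def algebra_simps)

text \<open>The conditions determine the operator, which is therefore \<^emph>\<open>the\<close> Dirac operator.\<close>

lemma dirac_operator_unique:
  assumes "dirac_operator m V H" "dirac_operator m V H'"
  shows "H = H'"
proof -
  have same: "resolvent_set H \<inter> resolvent_set (free_dirac m) =
      resolvent_set H' \<inter> resolvent_set (free_dirac m)"
    using assms unfolding dirac_operator_def by argo
  have "resolvent_set H \<inter> resolvent_set (free_dirac m) \<noteq> {}"
    using assms(1) unfolding dirac_operator_def by argo
  then obtain z where z: "z \<in> resolvent_set H \<inter> resolvent_set (free_dirac m)"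
    "z \<in> resolvent_set H' \<inter> resolvent_set (free_dirac m)"
    unfolding same by blast
  have "resolvent H z = resolvent H' z"
    using assms z unfolding dirac_operator_def by simp
  then have "(f, (g - z *\<^sub>C f) + z *\<^sub>C f) \<in> H \<longleftrightarrow> (f, (g - z *\<^sub>C f) + z *\<^sub>C f) \<in> H'" for f g
    unfolding resolvent_mem_iff[symmetric] by simp
  then show ?thesis by auto
qed

section \<open>Quantities in the eigenvalue bound\<close>

definition Lp_fun :: "real \<Rightarrow> (real \<Rightarrow> complex) \<Rightarrow> bool" where
  "Lp_fun p f \<longleftrightarrow>
     f \<in> borel_measurable lebesgue \<and> integrable lebesgue (\<lambda>x. cmod (f x) powr p)"

text \<open>\<open>onorm\<close> is taken with respect to the Euclidean norm of \<^typ>\<open>complex ^ 2\<close>.\<close>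

definition potential_norm :: "real \<Rightarrow> (real \<Rightarrow> complex ^ 2 ^ 2) \<Rightarrow> real" where
  "potential_norm p V = (LINT x|lebesgue. onorm (\<lambda>v. V x *v v) powr p) powr (1 / p)"

definition sqrt_upper :: "real \<Rightarrow> complex \<Rightarrow> complex" where
  "sqrt_upper m z = (THE w. w\<^sup>2 = z\<^sup>2 - (complex_of_real m)\<^sup>2 \<and> Im w > 0)"

definition eta :: "real \<Rightarrow> real" where
  "eta s = sqrt (1 / 2 + 1 / 4 * (s + inverse s))"

definition Phi :: "real \<Rightarrow> complex \<Rightarrow> complex" where
  "Phi m z = (z + complex_of_real m) / (z - complex_of_real m)"

lemma eta_Phi:
  assumes "z \<noteq> complex_of_real m" "z \<noteq> - complex_of_real m"
  shows "eta (cmod (Phi m z)) =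
    1 / sqrt 2 * sqrt (1 + ((cmod z)\<^sup>2 + m\<^sup>2) / cmod (z\<^sup>2 - (complex_of_real m)\<^sup>2))"
proof -
  define a where "a = cmod (z + complex_of_real m)"
  define b where "b = cmod (z - complex_of_real m)"
  have pos: "a > 0" "b > 0"
    using assms by (auto simp: a_def b_def add_eq_0_iff2)
  have ab: "cmod (z\<^sup>2 - (complex_of_real m)\<^sup>2) = a * b"
    by (simp add: a_def b_def flip: norm_mult) (simp add: power2_eq_square algebra_simps)
  have sq: "a\<^sup>2 + b\<^sup>2 = 2 * ((cmod z)\<^sup>2 + m\<^sup>2)"
    unfolding a_def b_def cmod_power2 by (simp add: power2_eq_square algebra_simps)
  have "1 / 2 + 1 / 4 * (a / b + inverse (a / b)) = 1 / 2 + 1 / 4 * ((a\<^sup>2 + b\<^sup>2) / (a * b))"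
    using pos by (simp add: field_simps power2_eq_square)
  also have "\<dots> = 1 / 2 * (1 + ((cmod z)\<^sup>2 + m\<^sup>2) / (a * b))"
    unfolding sq using pos by (simp add: field_simps)
  finally have "eta (a / b) = sqrt (1 / 2 * (1 + ((cmod z)\<^sup>2 + m\<^sup>2) / (a * b)))"
    unfolding eta_def by (rule arg_cong)
  also have "\<dots> = 1 / sqrt 2 * sqrt (1 + ((cmod z)\<^sup>2 + m\<^sup>2) / (a * b))"
    by (simp only: real_sqrt_mult real_sqrt_divide real_sqrt_one)
  finally show ?thesis
    unfolding Phi_def norm_divide ab a_def[symmetric] b_def[symmetric] .
qed

end

theory Submission
  imports Defs
begin

text \<open>
  The resolvent of the free operator is convolution with the matrix kernel
  \<open>\<i> / (2k) exp (\<i>k\<bar>x\<bar>) ((z + m, k sgn x), (k sgn x, z - m))\<close> with \<open>k\<^sup>2 = z\<^sup>2 - m\<^sup>2\<close> and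
  \<open>Im k > 0\<close>; the matrix has rank one for \<open>x \<noteq> 0\<close>, so its operator norm is its Frobenius norm, and
  the kernel is bounded by \<open>\<eta> exp (- Im k \<bar>x\<bar>)\<close>. Since \<open>A\<close> and \<open>B\<close> are pointwise bounded by the
  square root of \<open>\<parallel>V(x)\<parallel>\<close>, Schur's test bounds \<open>Q(z)\<close> by \<open>\<eta>\<close> times the supremum of the convolution of
  \<open>\<parallel>V\<parallel>\<close> with \<open>exp (- Im k \<bar>x\<bar>)\<close>, which Hoelder's inequality estimates by the remaining factors in
  the hypothesis. So \<open>Q(z)\<close> is a strict contraction and \<open>I + Q(z)\<close> is invertible.

  The existence of \<open>k\<close> is part of the claim: if \<open>z\<^sup>2 - m\<^sup>2 \<ge> 0\<close>, then plane waves show that \<open>z\<close> is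
  not in the resolvent set of the free operator.
\<close>

section \<open>The space of square-integrable spinors\<close>

text \<open>The obstacle is that the operators are given as graphs, closures and definite
  descriptions. \<open>B F\<close> need not be square-integrable, so the composition inside
  \<open>Q_op\<close> may be defined on a part of the space only. But \<open>A\<close> times the
  convolution of the kernel with \<open>B F\<close> makes sense for every \<open>F\<close>, and
  cutting \<open>F\<close> down to the sets where the norm of \<open>V\<close> is at most
  \<open>n\<close> shows that the closure is the graph of this everywhere defined operator.

  The matrix square root and the phase are replaced by closed formulas in the entries. These give
  existence and uniqueness, hence a meaning to the descriptions, and also measurability in
  \<open>x\<close>.

  For the free operator, convolution provides a solution of \<open>(H\<^sub>0 - z) u = h\<close>;
  its uniqueness is contained in \<open>z\<close> lying in the resolvent set.

  The factor \<open>2 (p - 1) / p\<close> in the hypothesis is \<open>2 / q\<close> for the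
  conjugate exponent \<open>q\<close>; it comes from the integral of
  \<open>exp (- q \<kappa> \<bar>x\<bar>)\<close> with \<open>\<kappa> = Im k\<close>.\<close>

lemma rep_L2_square_integrable: "square_integrable (rep_L2 f)"
  using Quotient_rep_reflp[OF Quotient_L2, of f] by (simp add: L2_rel_def)

lemma rep_L2_measurable [measurable]: "rep_L2 f \<in> borel_measurable lborel"
  using rep_L2_square_integrable[of f] by (simp add: square_integrable_def)

lemma AE_rep_abs_L2:
  assumes "square_integrable f"
  shows "AE x in lborel. rep_L2 (abs_L2 f) x = f x"
proof -
  have "L2_rel (rep_L2 (abs_L2 f)) f"
    by (rule Quotient_rep_abs[OF Quotient_L2]) (simp add: assms L2_rel_def)
  then show ?thesis by (simp add: L2_rel_def)
qed

lemma L2_eq_iff: "f = g \<longleftrightarrow> (AE x in lborel. rep_L2 f x = rep_L2 g x)"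
  using Quotient_rel_rep[OF Quotient_L2, of f g]
  by (simp add: L2_rel_def rep_L2_square_integrable)

lemma abs_rep_L2: "abs_L2 (rep_L2 f) = f"
  by (rule Quotient_abs_rep[OF Quotient_L2])

lemma L2_rel_rep [simp]: "L2_rel (rep_L2 f) (rep_L2 f)"
  by (rule Quotient_rep_reflp[OF Quotient_L2])

lemma AE_rep_L2_zero: "AE x in lborel. rep_L2 0 x = 0"
  unfolding zero_L2.abs_eq
  by (rule AE_rep_abs_L2) (simp add: square_integrable_def)

lemma AE_rep_L2_add: "AE x in lborel. rep_L2 (f + g) x = rep_L2 f x + rep_L2 g x"
  using AE_rep_abs_L2[OF square_integrable_add[OF rep_L2_square_integrable rep_L2_square_integrable], of f g]
    plus_L2.abs_eq[OF L2_rel_rep L2_rel_rep, of f g]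
  by (simp add: abs_rep_L2)

lemma AE_rep_L2_scaleR: "AE x in lborel. rep_L2 (r *\<^sub>R f) x = r *\<^sub>R rep_L2 f x"
  using AE_rep_abs_L2[OF square_integrable_scaleR[OF rep_L2_square_integrable], of r f]
    scaleR_L2.abs_eq[OF L2_rel_rep, of r f]
  by (simp add: abs_rep_L2)

lemma AE_rep_L2_scaleC: "AE x in lborel. rep_L2 (c *\<^sub>C f) x = c *s rep_L2 f x"
  using AE_rep_abs_L2[OF square_integrable_smult[OF rep_L2_square_integrable], of c f]
    scaleC_L2.abs_eq[OF L2_rel_rep, of c f]
  by (simp add: abs_rep_L2)

lemma AE_rep_L2_diff: "AE x in lborel. rep_L2 (f - g) x = rep_L2 f x - rep_L2 g x"
  using AE_rep_L2_add[of "f - g" g] by eventually_elim simp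

lemma norm_L2_power2: "(norm f)\<^sup>2 = (LINT x|lborel. (norm (rep_L2 f x))\<^sup>2)" for f :: L2
proof -
  have "(norm f)\<^sup>2 = inner f f" by (simp add: power2_norm_eq_inner)
  also have "\<dots> = (LINT x|lborel. inner (rep_L2 f x) (rep_L2 f x))"
    using inner_L2.abs_eq[OF L2_rel_rep L2_rel_rep, of f f] by (simp add: abs_rep_L2)
  finally show ?thesis by (simp add: power2_norm_eq_inner)
qed

lemma nn_integral_rep_L2:
  "(\<integral>\<^sup>+x. ennreal ((norm (rep_L2 f x))\<^sup>2) \<partial>lborel) = ennreal ((norm f)\<^sup>2)"
  unfolding norm_L2_power2
  using rep_L2_square_integrable[of f]
  by (intro nn_integral_eq_integral) (auto simp: square_integrable_def)

text \<open>Membership in the space and the norm bound come from a single nonnegative integral. The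
  Schur estimate can thus construct the value of an operator and bound it at once.\<close>

lemma L2_ex_rep:
  assumes [measurable]: "f \<in> borel_measurable lborel"
    and le: "(\<integral>\<^sup>+x. ennreal ((norm (f x))\<^sup>2) \<partial>lborel) \<le> ennreal (c\<^sup>2)" and "0 \<le> c"
  obtains F where "AE x in lborel. rep_L2 F x = f x" "norm F \<le> c"
proof
  have "integrable lborel (\<lambda>x. (norm (f x))\<^sup>2)"
    using le by (intro integrableI_bounded) (auto simp: top_unique le_less_trans)
  then have "square_integrable f" by (simp add: square_integrable_def)
  from AE_rep_abs_L2[OF this] show ae: "AE x in lborel. rep_L2 (abs_L2 f) x = f x" .
  have "ennreal ((norm (abs_L2 f))\<^sup>2) = (\<integral>\<^sup>+x. ennreal ((norm (f x))\<^sup>2) \<partial>lborel)"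
    unfolding nn_integral_rep_L2[symmetric]
    by (rule nn_integral_cong_AE) (use ae in eventually_elim, simp)
  also note le
  finally have "(norm (abs_L2 f))\<^sup>2 \<le> c\<^sup>2" by (subst (asm) ennreal_le_iff) auto
  then show "norm (abs_L2 f) \<le> c" using \<open>0 \<le> c\<close> by (rule power2_le_imp_le)
qed

lemma scaleC_L2_uminus_one: "(- 1) *\<^sub>C f = - f"
  unfolding L2_eq_iff
  using AE_rep_L2_scaleC[of "-1" f] AE_rep_L2_scaleR[of "-1" f]
  by eventually_elim (simp add: vec_eq_iff)

section \<open>Completeness, and inversion of \<open>I + Q\<close> for a strict contraction
  \<open>Q\<close>\<close>

lemma lborel_inverse_1_plus_x2:
  "(\<integral>\<^sup>+x. ennreal (1 / (1 + x\<^sup>2)) \<partial>lborel) < \<infinity>"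
proof -
  have half: "(\<integral>\<^sup>+x. ennreal (1 / (1 + x\<^sup>2)) * indicator {0..} x \<partial>lborel) = ennreal (pi / 2 - arctan 0)"
    by (rule nn_integral_FTC_atLeast)
       (auto intro!: derivative_eq_intros tendsto_arctan_at_top simp: field_simps power2_eq_square add_nonneg_eq_0_iff)
  have "(\<integral>\<^sup>+x. ennreal (1 / (1 + x\<^sup>2)) * indicator {..0} x \<partial>lborel)
      = (\<integral>\<^sup>+x. ennreal (1 / (1 + x\<^sup>2)) * indicator {0..} x \<partial>lborel)"
    by (subst nn_integral_real_affine[where c="-1" and t=0])
       (auto simp: indicator_def intro!: nn_integral_cong)
  with half have half': "(\<integral>\<^sup>+x. ennreal (1 / (1 + x\<^sup>2)) * indicator {..0} x \<partial>lborel) = ennreal (pi / 2)"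
    by simp
  have "(\<integral>\<^sup>+x. ennreal (1 / (1 + x\<^sup>2)) \<partial>lborel)
     \<le> (\<integral>\<^sup>+x. ennreal (1 / (1 + x\<^sup>2)) * indicator {..0} x + ennreal (1 / (1 + x\<^sup>2)) * indicator {0..} x \<partial>lborel)"
    by (rule nn_integral_mono) (auto simp: indicator_def)
  also have "\<dots> = ennreal (pi / 2) + ennreal (pi / 2)"
    using half half' by (subst nn_integral_add) auto
  also have "\<dots> < \<infinity>" by simp
  finally show ?thesis .
qed

text \<open>Serves twice: its integrand is the square of the weight in the completeness proof and,
  rescaled, the cutoff of the approximate eigenfunctions.\<close>

lemma integrable_inverse_1_plus_x2: "integrable lborel (\<lambda>x::real. 1 / (1 + x\<^sup>2))"
  by (rule integrableI_nonneg) (use lborel_inverse_1_plus_x2 in auto)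

text \<open>
  Weighting with a square-integrable function turns convergence in \<open>L\<^sup>2\<close> into convergence in
  \<open>L\<^sup>1\<close>, for which the library provides almost everywhere convergent subsequences.
\<close>

lemma complete_L2: "complete (UNIV :: L2 set)"
proof (rule completeI)
  fix X :: "nat \<Rightarrow> L2" assume X: "Cauchy X"
  define w where "w = (\<lambda>x::real. sqrt (1 / (1 + x\<^sup>2)))"
  have w_meas[measurable]: "w \<in> borel_measurable borel" by (simp add: w_def)
  have w_pos: "w x > 0" for x by (simp add: w_def add_pos_nonneg)
  have w2: "(w x)\<^sup>2 = 1 / (1 + x\<^sup>2)" for x by (simp add: w_def)
  have w2_int: "integrable lborel (\<lambda>x. (w x)\<^sup>2)" unfolding w2 by (rule integrable_inverse_1_plus_x2)
  define W where "W = (LINT x|lborel. (w x)\<^sup>2)"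
  have W0: "W \<ge> 0" by (simp add: W_def)
  \<comment> \<open>Cauchy--Schwarz against \<open>w\<close>, whose square is integrable, bounds the
    weighted integral of \<open>norm f\<close> by the norm in the space.\<close>
  have prod_int: "integrable lborel (\<lambda>x. w x * norm (rep_L2 f x))"
    and prod_le: "(LINT x|lborel. w x * norm (rep_L2 f x)) \<le> sqrt W * norm f" for f
  proof -
    have nn: "(\<integral>\<^sup>+x. ennreal (w x * norm (rep_L2 f x)) \<partial>lborel)\<^sup>2 \<le> ennreal W * ennreal ((norm f)\<^sup>2)"
    proof -
      have "(\<integral>\<^sup>+x. ennreal (w x) * ennreal (norm (rep_L2 f x)) \<partial>lborel)\<^sup>2
        \<le> (\<integral>\<^sup>+x. (ennreal (w x))\<^sup>2 \<partial>lborel) * (\<integral>\<^sup>+x. (ennreal (norm (rep_L2 f x)))\<^sup>2 \<partial>lborel)"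
        by (rule Cauchy_Schwarz_nn_integral) measurable
      also have "(\<integral>\<^sup>+x. (ennreal (w x))\<^sup>2 \<partial>lborel) = ennreal W"
        unfolding W_def using w2_int w_pos
        by (simp add: ennreal_power less_imp_le nn_integral_eq_integral)
      also have "(\<integral>\<^sup>+x. (ennreal (norm (rep_L2 f x)))\<^sup>2 \<partial>lborel) = ennreal ((norm f)\<^sup>2)"
        using nn_integral_rep_L2[of f] by (simp add: ennreal_power)
      finally show ?thesis using w_pos by (simp add: ennreal_mult less_imp_le)
    qed
    have "(\<integral>\<^sup>+x. ennreal (w x * norm (rep_L2 f x)) \<partial>lborel)\<^sup>2 < \<infinity>"
      using nn by (rule le_less_trans) (simp add: ennreal_mult_less_top)
    then have "(\<integral>\<^sup>+x. ennreal (w x * norm (rep_L2 f x)) \<partial>lborel) < \<infinity>"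
      by (simp add: power_less_top_ennreal)
    then show int: "integrable lborel (\<lambda>x. w x * norm (rep_L2 f x))"
      using w_pos by (intro integrableI_nonneg) (auto simp: less_imp_le)
    let ?I = "LINT x|lborel. w x * norm (rep_L2 f x)"
    have I0: "?I \<ge> 0" using w_pos by (intro integral_nonneg_AE) (auto simp: less_imp_le)
    have "(\<integral>\<^sup>+x. ennreal (w x * norm (rep_L2 f x)) \<partial>lborel) = ennreal ?I"
      using int w_pos by (intro nn_integral_eq_integral) (auto simp: less_imp_le)
    with nn I0 W0 have "?I\<^sup>2 \<le> W * (norm f)\<^sup>2"
      by (simp add: ennreal_power flip: ennreal_mult)
    also have "\<dots> = (sqrt W * norm f)\<^sup>2" using W0 by (simp add: power_mult_distrib)
    finally show "?I \<le> sqrt W * norm f"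
      by (rule power2_le_imp_le) (use W0 in auto)
  qed
  define s where "s = (\<lambda>n x. w x *\<^sub>R rep_L2 (X n) x)"
  have s_int: "integrable lborel (s n)" for n
  proof -
    have "integrable lborel (\<lambda>x. norm (s n x))"
      using prod_int[of "X n"] w_pos by (simp add: s_def less_imp_le)
    then show ?thesis by (subst (asm) integrable_norm_iff) (auto simp: s_def)
  qed
  have s_cauchy: "\<exists>N. \<forall>i\<ge>N. \<forall>j\<ge>N. (LINT x|lborel. norm (s i x - s j x)) < e" if "e > 0" for e
  proof -
    \<comment> \<open>The summand 1 keeps the denominator positive, as only \<open>W \<ge> 0\<close>
      has been recorded.\<close>
    have d: "e / (sqrt W + 1) > 0" using W0 that by (simp add: add_nonneg_pos)
    then obtain N where N: "\<And>i j. i \<ge> N \<Longrightarrow> j \<ge> N \<Longrightarrow> norm (X i - X j) < e / (sqrt W + 1)"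
      using X by (metis Cauchy_iff)
    have "(LINT x|lborel. norm (s i x - s j x)) < e" if "i \<ge> N" "j \<ge> N" for i j
    proof -
      have "(LINT x|lborel. norm (s i x - s j x)) = (LINT x|lborel. w x * norm (rep_L2 (X i - X j) x))"
        unfolding s_def
        by (rule integral_cong_AE, measurable)
          (use AE_rep_L2_diff[of "X i" "X j"] in eventually_elim,
            simp add: w_pos less_imp_le flip: scaleR_diff_right)
      also have "\<dots> \<le> sqrt W * norm (X i - X j)" by (rule prod_le)
      also have "\<dots> \<le> (sqrt W + 1) * norm (X i - X j)" by (simp add: distrib_right)
      also have "\<dots> < e"
        using N[OF that] W0 by (simp add: pos_less_divide_eq mult.commute add_nonneg_pos)
      finally show ?thesis .
    qed
    then show ?thesis by blast
  qed
  obtain r where r: "strict_mono r" "AE x in lborel. Cauchy (\<lambda>i. s (r i) x)"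
    using cauchy_L1_AE_cauchy_subseq[OF s_int s_cauchy] by metis
  have rep_conv: "AE x in lborel. convergent (\<lambda>i. rep_L2 (X (r i)) x)"
    using r(2)
  proof eventually_elim
    case (elim x)
    then have "convergent (\<lambda>i. s (r i) x)" by (simp add: Cauchy_convergent_iff)
    then obtain l where "(\<lambda>i. s (r i) x) \<longlonglongrightarrow> l" by (auto simp: convergent_def)
    then have "(\<lambda>i. (1 / w x) *\<^sub>R s (r i) x) \<longlonglongrightarrow> (1 / w x) *\<^sub>R l" by (intro tendsto_intros)
    moreover have "(1 / w x) *\<^sub>R s (r i) x = rep_L2 (X (r i)) x" for i
      using w_pos[of x] by (simp add: s_def)
    ultimately show ?case by (auto simp: convergent_def)
  qed
  define l where "l = (\<lambda>x. lim (\<lambda>i. rep_L2 (X (r i)) x))"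
  have l_meas[measurable]: "l \<in> borel_measurable lborel"
    unfolding l_def by (rule borel_measurable_lim_metric) measurable
  have l_lim: "AE x in lborel. (\<lambda>i. rep_L2 (X (r i)) x) \<longlonglongrightarrow> l x"
    using rep_conv by eventually_elim (simp add: l_def convergent_LIMSEQ_iff)
  \<comment> \<open>Pointwise convergence is known along a subsequence. Fatou's lemma turns the
    Cauchy estimate into a bound on the distance of the pointwise limit from any term of the whole
    sequence, because \<open>r i \<ge> i\<close>.\<close>
  have fatou: "(\<integral>\<^sup>+x. ennreal ((norm (l x - rep_L2 (X n) x))\<^sup>2) \<partial>lborel) \<le> ennreal (e\<^sup>2)"
    if "e \<ge> 0" and N: "\<And>i. i \<ge> n \<Longrightarrow> norm (X i - X n) \<le> e" for n e
  proof -
    have "(\<integral>\<^sup>+x. ennreal ((norm (l x - rep_L2 (X n) x))\<^sup>2) \<partial>lborel)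
       = (\<integral>\<^sup>+x. liminf (\<lambda>i. ennreal ((norm (rep_L2 (X (r i)) x - rep_L2 (X n) x))\<^sup>2)) \<partial>lborel)"
      by (rule nn_integral_cong_AE, use l_lim in eventually_elim)
        (rule lim_imp_Liminf[symmetric], auto intro!: tendsto_intros)
    also have "\<dots> \<le> liminf (\<lambda>i. \<integral>\<^sup>+x. ennreal ((norm (rep_L2 (X (r i)) x - rep_L2 (X n) x))\<^sup>2) \<partial>lborel)"
      by (rule nn_integral_liminf) measurable
    also have "\<dots> = liminf (\<lambda>i. ennreal ((norm (X (r i) - X n))\<^sup>2))"
    proof (rule arg_cong[where f = liminf], rule ext)
      fix i
      show "(\<integral>\<^sup>+x. ennreal ((norm (rep_L2 (X (r i)) x - rep_L2 (X n) x))\<^sup>2) \<partial>lborel)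
         = ennreal ((norm (X (r i) - X n))\<^sup>2)"
        unfolding nn_integral_rep_L2[symmetric]
        by (rule nn_integral_cong_AE, use AE_rep_L2_diff[of "X (r i)" "X n"] in eventually_elim) simp
    qed
    also have "\<dots> \<le> liminf (\<lambda>i::nat. ennreal (e\<^sup>2))"
    proof (rule Liminf_mono)
      show "\<forall>\<^sub>F i in sequentially. ennreal ((norm (X (r i) - X n))\<^sup>2) \<le> ennreal (e\<^sup>2)"
        using eventually_ge_at_top[of n]
      proof eventually_elim
        case (elim i)
        then have "r i \<ge> n" using seq_suble[OF r(1), of i] by simp
        then show ?case using N by (intro ennreal_leI power_mono) auto
      qed
    qed
    finally show ?thesis by (simp add: Liminf_const)
  qed
  \<comment> \<open>The bound with \<open>e = 1\<close> makes the difference of \<open>l\<close> and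
    the representative of \<open>X N\<close> square-integrable; adding \<open>X N\<close> back
    places \<open>l\<close> itself in the space.\<close>
  obtain N where N: "\<And>i j. i \<ge> N \<Longrightarrow> j \<ge> N \<Longrightarrow> norm (X i - X j) < 1"
    using X by (metis Cauchy_iff zero_less_one)
  have "(\<integral>\<^sup>+x. ennreal ((norm (l x - rep_L2 (X N) x))\<^sup>2) \<partial>lborel) \<le> ennreal (1\<^sup>2)"
    by (rule fatou) (use N less_imp_le in auto)
  then obtain G where G: "AE x in lborel. rep_L2 G x = l x - rep_L2 (X N) x"
    by (rule L2_ex_rep[rotated]) auto
  define L where "L = G + X N"
  have L: "AE x in lborel. rep_L2 L x = l x"
    unfolding L_def using AE_rep_L2_add[of G "X N"] G by eventually_elim simp
  have "X \<longlonglongrightarrow> L"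
  proof (rule LIMSEQ_I)
    fix e :: real assume "e > 0"
    then obtain M where M: "\<And>i j. i \<ge> M \<Longrightarrow> j \<ge> M \<Longrightarrow> norm (X i - X j) < e / 2"
      using X by (metis Cauchy_iff half_gt_zero)
    have "norm (X n - L) < e" if "n \<ge> M" for n
    proof -
      have "ennreal ((norm (L - X n))\<^sup>2) = (\<integral>\<^sup>+x. ennreal ((norm (l x - rep_L2 (X n) x))\<^sup>2) \<partial>lborel)"
        unfolding nn_integral_rep_L2[symmetric]
        by (rule nn_integral_cong_AE, use L AE_rep_L2_diff[of L "X n"] in eventually_elim) simp
      also have "\<dots> \<le> ennreal ((e / 2)\<^sup>2)"
        by (rule fatou) (use M that \<open>e > 0\<close> in \<open>auto simp: less_imp_le\<close>)
      finally have "(norm (L - X n))\<^sup>2 \<le> (e / 2)\<^sup>2" by (simp add: ennreal_le_iff)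
      then have "norm (L - X n) \<le> e / 2" by (rule power2_le_imp_le) (use \<open>e > 0\<close> in simp)
      then show ?thesis using \<open>e > 0\<close> by (simp add: norm_minus_commute)
    qed
    then show "\<exists>M. \<forall>n\<ge>M. norm (X n - L) < e" by blast
  qed
  then show "\<exists>l\<in>UNIV. X \<longlonglongrightarrow> l" by blast
qed

text \<open>Solving \<open>f + Q f = g\<close> is a fixed-point problem for the contraction
  \<open>\<lambda>f. g - Q f\<close>, so Banach's theorem on the complete space yields the inverse.
  The triangle inequality bounds it by \<open>1 / (1 - q)\<close>.\<close>

lemma minus_one_in_resolvent_set:
  assumes lin: "bounded_linear Q" and le: "\<And>f. norm (Q f) \<le> q * norm f" and q: "0 \<le> q" "q < 1"
  shows "- 1 \<in> resolvent_set {(f, Q f) | f. True}"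
proof -
  interpret Q: bounded_linear Q by (rule lin)
  have "\<exists>!f. g - Q f = f" for g
  proof -
    have "dist (g - Q f) (g - Q f') \<le> q * dist f f'" for f f'
      using le[of "f' - f"] by (simp add: dist_norm norm_minus_commute flip: Q.diff)
    then show ?thesis
      using Banach_fix[OF complete_L2 _ q, of "\<lambda>f. g - Q f"] by auto
  qed
  then obtain R where R: "g - Q f = f \<longleftrightarrow> f = R g" for f g
    by metis
  have R': "R g + Q (R g) = g" for g
    using R[of g "R g"] by (metis diff_add_cancel)
  have R_eqI: "R g = f" if "f + Q f = g" for f g
    using R[of g f] that by (metis add_diff_cancel_right')
  have "bounded_linear R"
  proof (rule bounded_linear_intro)
    show "R (f + g) = R f + R g" for f g
      by (rule R_eqI) (metis R' Q.add add.assoc add.left_commute)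
    show "R (r *\<^sub>R f) = r *\<^sub>R R f" for r f
      by (rule R_eqI) (metis R' Q.scaleR scaleR_add_right)
    show "norm (R g) \<le> norm g * (1 / (1 - q))" for g
    proof -
      have "norm (R g) \<le> norm (R g + Q (R g)) + norm (Q (R g))"
        by (metis add_diff_cancel_right' norm_triangle_ineq4)
      also have "\<dots> \<le> norm g + q * norm (R g)" using R' le by simp
      finally have "norm (R g) * (1 - q) \<le> norm g" by (simp add: algebra_simps)
      then show ?thesis using q by (simp add: pos_le_divide_eq)
    qed
  qed
  moreover have "resolvent {(f, Q f) | f. True} (- 1) = {(g, R g) | g. True}"
  proof -
    have "(g, f) \<in> resolvent {(f, Q f) | f. True} (- 1) \<longleftrightarrow> f = R g" for f g
      unfolding resolvent_mem_iff scaleC_L2_uminus_one R[symmetric]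
      by (auto simp: diff_eq_eq add.commute)
    then show ?thesis by auto
  qed
  ultimately show ?thesis unfolding resolvent_set_def by blast
qed

section \<open>Polar decomposition of two-by-two matrices\<close>

text \<open>Coordinates that split a matrix identity into four scalar identities within reach of
  \<open>algebra\<close>.\<close>

definition mat22 :: "complex \<Rightarrow> complex \<Rightarrow> complex \<Rightarrow> complex \<Rightarrow> complex ^ 2 ^ 2" where
  "mat22 a b c d = vector [vector [a, b], vector [c, d]]"

lemma mat22_nth [simp]:
  "mat22 a b c d $ 1 $ 1 = a" "mat22 a b c d $ 1 $ 2 = b"
  "mat22 a b c d $ 2 $ 1 = c" "mat22 a b c d $ 2 $ 2 = d"
  by (simp_all add: mat22_def)

lemma mat22_eta: "mat22 (M $ 1 $ 1) (M $ 1 $ 2) (M $ 2 $ 1) (M $ 2 $ 2) = M"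
  by (simp add: vec_eq_iff forall_2)

lemma mat22_cases: obtains a b c d where "M = mat22 a b c d"
  using mat22_eta[of M] by metis

lemma mat22_eq_iff: "mat22 a b c d = mat22 a' b' c' d' \<longleftrightarrow> a = a' \<and> b = b' \<and> c = c' \<and> d = d'"
  by (simp add: vec_eq_iff forall_2)

lemma mat22_mult:
  "mat22 a b c d ** mat22 a' b' c' d' =
     mat22 (a * a' + b * c') (a * b' + b * d') (c * a' + d * c') (c * b' + d * d')"
  by (simp add: vec_eq_iff forall_2 matrix_matrix_mult_def sum_2)

lemma mat22_vec: "mat22 a b c d *v v = vector [a * v $ 1 + b * v $ 2, c * v $ 1 + d * v $ 2]"
  by (simp add: vec_eq_iff forall_2 matrix_vector_mult_def sum_2)

lemma mat22_adjoint: "matrix_adjoint (mat22 a b c d) = mat22 (cnj a) (cnj c) (cnj b) (cnj d)"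
  by (simp add: vec_eq_iff forall_2 matrix_adjoint_def)

lemma norm_cvec2: "(norm (v :: complex ^ 2))\<^sup>2 = (cmod (v $ 1))\<^sup>2 + (cmod (v $ 2))\<^sup>2"
  by (simp add: norm_vec_def L2_set_def sum_2)

text \<open>A quadratic form that is real on all complex vectors is Hermitian, which the test
  vectors with entries 0, 1 and \<i> detect. The last inequality says that the determinant is
  nonnegative.\<close>

lemma mat22_psd_iff:
  "matrix_psd (mat22 a b c d) \<longleftrightarrow>
     Im a = 0 \<and> Im d = 0 \<and> 0 \<le> Re a \<and> 0 \<le> Re d \<and> c = cnj b \<and> (cmod b)\<^sup>2 \<le> Re a * Re d"
proof -
  have psd: "matrix_psd (mat22 a b c d) \<longleftrightarrow>
      (\<forall>x y. cnj x * (a * x + b * y) + cnj y * (c * x + d * y) \<in> \<real>\<^sub>\<ge>\<^sub>0)" (is "_ \<longleftrightarrow> (\<forall>x y. ?q x y)")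
  proof
    assume "matrix_psd (mat22 a b c d)"
    then have "?q x y" for x y
      using matrix_psd_def[THEN iffD1, rule_format, of "mat22 a b c d" "vector [x, y]"]
      by (simp add: mat22_vec sum_2)
    then show "\<forall>x y. ?q x y" by blast
  qed (simp add: matrix_psd_def mat22_vec sum_2)
  show ?thesis
  proof
    assume "matrix_psd (mat22 a b c d)"
    then have q: "?q x y" for x y using psd by blast
    have a: "Im a = 0" "Re a \<ge> 0" and d: "Im d = 0" "Re d \<ge> 0"
      using q[of 1 0] q[of 0 1] by (simp_all add: complex_nonneg_Reals_iff)
    have "Im (b + c) = 0" using q[of 1 1] a d by (simp add: complex_nonneg_Reals_iff)
    moreover have "Re b = Re c" using q[of 1 \<i>] a d by (simp add: complex_nonneg_Reals_iff)
    ultimately have c: "c = cnj b" by (simp add: complex_eq_iff)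
    have ad: "a = of_real (Re a)" "d = of_real (Re d)" using a d by (simp_all add: complex_eq_iff)
    \<comment> \<open>The vectors \<open>(b, - a)\<close> and \<open>(- d, cnj b)\<close> are chosen
      so that one row of the product vanishes and the form becomes a diagonal entry times the
      determinant. If both diagonal entries are zero this says nothing, and \<open>q3\<close> forces
      \<open>b = 0\<close>.\<close>
    have q1: "0 \<le> Re a * (Re a * Re d - (cmod b)\<^sup>2)"
      using q[of b "- a"] a d unfolding cmod_power2 c
      by (simp add: complex_nonneg_Reals_iff algebra_simps power2_eq_square)
    have q2: "0 \<le> Re d * (Re a * Re d - (cmod b)\<^sup>2)"
      using q[of "- d" "cnj b"] a d unfolding cmod_power2 c
      by (simp add: complex_nonneg_Reals_iff algebra_simps power2_eq_square)
    have q3: "2 * (cmod b)\<^sup>2 \<le> Re a + (cmod b)\<^sup>2 * Re d"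
      using q[of 1 "- cnj b"] a d unfolding cmod_power2 c
      by (simp add: complex_nonneg_Reals_iff algebra_simps power2_eq_square)
    have "(cmod b)\<^sup>2 \<le> Re a * Re d"
    proof (cases "Re a > 0 \<or> Re d > 0")
      case True
      then show ?thesis using q1 q2 by (auto simp: zero_le_mult_iff)
    next
      case False
      then have "Re a = 0" "Re d = 0" using a d by auto
      then show ?thesis using q3 by simp
    qed
    with a d c show "Im a = 0 \<and> Im d = 0 \<and> 0 \<le> Re a \<and> 0 \<le> Re d \<and> c = cnj b \<and> (cmod b)\<^sup>2 \<le> Re a * Re d"
      by blast
  next
    assume *: "Im a = 0 \<and> Im d = 0 \<and> 0 \<le> Re a \<and> 0 \<le> Re d \<and> c = cnj b \<and> (cmod b)\<^sup>2 \<le> Re a * Re d"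
    then have c: "c = cnj b" by blast
    have "?q x y" for x y
    proof -
      \<comment> \<open>The mixed terms are absorbed by the diagonal: \<open>cmod b\<close> is at
        most \<open>sqrt (Re a * Re d)\<close>, followed by the inequality of arithmetic and
        geometric means.\<close>
      have "cmod (cnj x * b * y) \<le> sqrt (Re a * Re d) * (cmod x * cmod y)"
        using mult_right_mono[OF real_le_rsqrt, of "cmod b" "Re a * Re d" "cmod x * cmod y"] *
        by (simp add: norm_mult ac_simps)
      also have "\<dots> = (sqrt (Re a) * cmod x) * (sqrt (Re d) * cmod y)"
        by (simp add: real_sqrt_mult)
      also have "2 * \<dots> \<le> (sqrt (Re a) * cmod x)\<^sup>2 + (sqrt (Re d) * cmod y)\<^sup>2"
        using sum_squares_bound[of "sqrt (Re a) * cmod x" "sqrt (Re d) * cmod y"] by (simp add: mult.assoc)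
      finally have "2 * cmod (cnj x * b * y) \<le> Re a * (cmod x)\<^sup>2 + Re d * (cmod y)\<^sup>2"
        using * by (simp add: power_mult_distrib)
      moreover have "- Re (cnj x * b * y) \<le> cmod (cnj x * b * y)"
        using abs_Re_le_cmod[of "cnj x * b * y"] by linarith
      moreover have "Re (cnj x * (a * x + b * y) + cnj y * (c * x + d * y))
          = Re a * (cmod x)\<^sup>2 + Re d * (cmod y)\<^sup>2 + 2 * Re (cnj x * b * y)"
        using * unfolding cmod_power2 c by (simp add: algebra_simps power2_eq_square)
      moreover have "Im (cnj x * (a * x + b * y) + cnj y * (c * x + d * y)) = 0"
        using * unfolding c by (simp add: algebra_simps)
      ultimately show ?thesis by (simp add: complex_nonneg_Reals_iff)
    qed
    then show "matrix_psd (mat22 a b c d)" using psd by blast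
  qed
qed

text \<open>By Cayley--Hamilton, a positive semidefinite \<open>S\<close> satisfies
  \<open>tr S \<cdot> S = S\<^sup>2 + det S\<close>, where \<open>det S\<close> and \<open>tr S\<close> are determined by \<open>S\<^sup>2\<close>.\<close>

definition psd_sqrt :: "complex ^ 2 ^ 2 \<Rightarrow> complex ^ 2 ^ 2" where
  "psd_sqrt P = (let r = sqrt (Re (P $ 1 $ 1) * Re (P $ 2 $ 2) - (cmod (P $ 1 $ 2))\<^sup>2);
       t = sqrt (Re (P $ 1 $ 1) + Re (P $ 2 $ 2) + 2 * r)
     in mat22 ((P $ 1 $ 1 + r) / t) (P $ 1 $ 2 / t) (P $ 2 $ 1 / t) ((P $ 2 $ 2 + r) / t))"

lemma psd_sqrt:
  assumes "matrix_psd P"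
  shows "matrix_psd (psd_sqrt P)" and "psd_sqrt P ** psd_sqrt P = P"
    and "matrix_psd S \<Longrightarrow> S ** S = P \<Longrightarrow> S = psd_sqrt P"
proof -
  obtain a b c d where P: "P = mat22 a b c d" by (rule mat22_cases)
  define x y where "x = Re a" and "y = Re d"
  have xy: "a = of_real x" "d = of_real y" "c = cnj b" "0 \<le> x" "0 \<le> y" "(cmod b)\<^sup>2 \<le> x * y"
    using assms unfolding P mat22_psd_iff x_def y_def by (auto simp: complex_eq_iff)
  define r where "r = sqrt (x * y - (cmod b)\<^sup>2)"
  define t where "t = sqrt (x + y + 2 * r)"
  have r: "r \<ge> 0" "r\<^sup>2 = x * y - (cmod b)\<^sup>2" using xy by (simp_all add: r_def)
  have t: "t \<ge> 0" "t\<^sup>2 = x + y + 2 * r" using xy r by (simp_all add: t_def)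
  have S: "psd_sqrt P = mat22 (of_real ((x + r) / t)) (b / t) (cnj b / t) (of_real ((y + r) / t))"
    by (simp add: psd_sqrt_def P Let_def xy flip: r_def t_def)
  \<comment> \<open>If the trace of the root vanishes then \<open>P = 0\<close>, and division by
    zero in \<open>psd_sqrt\<close> returns the correct root 0.\<close>
  have t0: "x = 0 \<and> y = 0 \<and> b = 0 \<and> r = 0" if "t = 0"
  proof -
    have "x + y + 2 * r = 0" using t that by simp
    then have "x = 0 \<and> y = 0 \<and> r = 0" using xy r by linarith
    then show ?thesis using r by simp
  qed
  show "matrix_psd (psd_sqrt P)"
  proof (cases "t = 0")
    case True
    then show ?thesis using t0 by (simp add: S mat22_psd_iff)
  next
    case False
    have "x * y \<le> (x + r) * (y + r)"
      using xy r by (intro mult_mono) auto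
    with xy have "(cmod b)\<^sup>2 \<le> (x + r) * (y + r)" by simp
    then show ?thesis
      using False t xy r
      by (simp add: S mat22_psd_iff norm_divide power_divide divide_right_mono flip: power2_eq_square)
  qed
  have bb: "b * cnj b = of_real ((cmod b)\<^sup>2)" using complex_norm_square[of b] by simp
  have rc: "(of_real r)\<^sup>2 = of_real x * of_real y - b * cnj b"
    unfolding bb using r(2) by (metis of_real_diff of_real_mult of_real_power)
  have tc: "(of_real t)\<^sup>2 = (of_real x + of_real y + 2 * of_real r :: complex)"
    using t(2) by (metis of_real_add of_real_mult of_real_power of_real_numeral)
  show "psd_sqrt P ** psd_sqrt P = P"
  proof (cases "t = 0")
    case True
    have "psd_sqrt P = mat22 0 0 0 0" using t0[OF True] unfolding S by simp
    moreover have "P = mat22 0 0 0 0" using t0[OF True] xy by (simp add: P)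
    ultimately show ?thesis by (simp add: mat22_mult)
  next
    case False
    have tt: "complex_of_real t \<noteq> 0" using False by simp
    have e1: "(of_real x + of_real r)\<^sup>2 + b * cnj b = of_real x * (of_real t)\<^sup>2"
      using rc tc by algebra
    have e2: "(of_real y + of_real r)\<^sup>2 + b * cnj b = of_real y * (of_real t)\<^sup>2"
      using rc tc by algebra
    have e3: "(of_real x + of_real r) * b + b * (of_real y + of_real r) = b * (of_real t)\<^sup>2"
      using tc by algebra
    have e4: "cnj b * (of_real x + of_real r) + (of_real y + of_real r) * cnj b = cnj b * (of_real t)\<^sup>2"
      using tc by algebra
    show ?thesis
      unfolding S unfolding P mat22_mult mat22_eq_iff xy
      using tt e1 e2 e3 e4
      by (simp add: power2_eq_square mult.commute flip: add_divide_distrib)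
         (simp add: field_simps power2_eq_square)
  qed
  show "S = psd_sqrt P" if "matrix_psd S" "S ** S = P"
  proof -
    obtain s u v w where S': "S = mat22 s u v w" by (rule mat22_cases)
    define \<sigma> \<omega> where "\<sigma> = Re s" and "\<omega> = Re w"
    have sw: "s = of_real \<sigma>" "w = of_real \<omega>" "v = cnj u" "0 \<le> \<sigma>" "0 \<le> \<omega>" "(cmod u)\<^sup>2 \<le> \<sigma> * \<omega>"
      using that(1) unfolding S' mat22_psd_iff \<sigma>_def \<omega>_def by (auto simp: complex_eq_iff)
    have uu: "u * cnj u = of_real ((cmod u)\<^sup>2)" using complex_norm_square[of u] by simp
    have eqs: "of_real \<sigma> * of_real \<sigma> + u * cnj u = of_real x" "of_real \<sigma> * u + u * of_real \<omega> = b"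
       "cnj u * u + of_real \<omega> * of_real \<omega> = of_real y"
      using that(2) unfolding S' P mat22_mult mat22_eq_iff by (simp_all add: sw xy)
    have x: "x = \<sigma>\<^sup>2 + (cmod u)\<^sup>2"
      using eqs(1) unfolding uu by (simp add: power2_eq_square flip: of_real_mult of_real_add of_real_power)
    have y: "y = \<omega>\<^sup>2 + (cmod u)\<^sup>2"
      using eqs(3) unfolding mult.commute[of "cnj u"] uu
      by (simp add: power2_eq_square flip: of_real_mult of_real_add of_real_power)
    have b: "b = of_real (\<sigma> + \<omega>) * u" using eqs(2) by (simp add: algebra_simps)
    have "cmod b = (\<sigma> + \<omega>) * cmod u" using sw unfolding b norm_mult norm_of_real by simp
    then have "x * y - (cmod b)\<^sup>2 = (\<sigma> * \<omega> - (cmod u)\<^sup>2)\<^sup>2"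
      unfolding x y by (simp add: algebra_simps power2_eq_square)
    \<comment> \<open>\<open>r\<close> is the determinant of \<open>S\<close>, nonnegative by
      positivity of \<open>S\<close>, and below \<open>t\<close> turns out to be its trace. With
      these values the Cayley--Hamilton formula returns \<open>S\<close>.\<close>
    then have rr: "r = \<sigma> * \<omega> - (cmod u)\<^sup>2" using sw by (simp add: r_def)
    have "x + y + 2 * r = (\<sigma> + \<omega>)\<^sup>2"
      unfolding x y rr by (simp add: algebra_simps power2_eq_square)
    then have tt: "t = \<sigma> + \<omega>" using sw by (simp add: t_def)
    show ?thesis
    proof (cases "t = 0")
      case True
      then have "\<sigma> = 0" "\<omega> = 0" using tt sw by auto
      then have "u = 0" using sw by simp
      then show ?thesis using \<open>\<sigma> = 0\<close> \<open>\<omega> = 0\<close> t0[OF True] by (simp add: S S' sw)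
    next
      case False
      have "(x + r) / t = \<sigma>" "(y + r) / t = \<omega>"
        using False unfolding x y rr tt by (simp_all add: field_simps power2_eq_square)
      moreover have "b / of_real t = u" using False unfolding b tt by (simp del: of_real_add)
      moreover have "cnj b / of_real t = cnj u" using \<open>b / of_real t = u\<close> by (metis complex_cnj_divide complex_cnj_complex_of_real)
      ultimately show ?thesis unfolding S S' sw by simp
    qed
  qed
qed

text \<open>Existence and uniqueness of the positive semidefinite root give the definite description
  its meaning.\<close>

lemma matrix_sqrt_eq_psd_sqrt: "matrix_psd P \<Longrightarrow> matrix_sqrt P = psd_sqrt P"
  unfolding matrix_sqrt_def by (rule the_equality) (auto simp: psd_sqrt)


definition psd_abs :: "complex ^ 2 ^ 2 \<Rightarrow> complex ^ 2 ^ 2" where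
  "psd_abs M = psd_sqrt (matrix_adjoint M ** M)"

text \<open>
  With \<open>t = tr |M|\<close>, Cayley--Hamilton gives \<open>|M| + |det M| |M|\<^sup>-\<^sup>1 = t\<close>; multiplying by the phase
  from the left yields \<open>t U = M + sgn (det M) (adj M)\<^sup>*\<close>, which is correct for singular \<open>M\<close> as well
  (for \<open>M = 0\<close> because \<open>x / 0 = 0\<close>).
\<close>

definition polar_phase :: "complex ^ 2 ^ 2 \<Rightarrow> complex ^ 2 ^ 2" where
  "polar_phase M =
     (let a = M $ 1 $ 1; b = M $ 1 $ 2; c = M $ 2 $ 1; d = M $ 2 $ 2; D = a * d - b * c;
       t = sqrt ((cmod a)\<^sup>2 + (cmod b)\<^sup>2 + (cmod c)\<^sup>2 + (cmod d)\<^sup>2 + 2 * cmod D)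
     in mat22 ((a + sgn D * cnj d) / t) ((b - sgn D * cnj c) / t)
          ((c - sgn D * cnj b) / t) ((d + sgn D * cnj a) / t))"

lemma inner_cvec2: "inner v w = inner (v $ 1) (w $ 1) + inner (v $ 2) ((w :: complex ^ 2) $ 2)"
  by (simp add: inner_vec_def sum_2)

lemma bounded_linear_matrix_vector_mult: "bounded_linear ((*v) (M :: complex ^ 2 ^ 2))"
proof -
  have "linear ((*v) M)"
    by (rule linearI) (simp_all add: vec_eq_iff matrix_vector_mult_def distrib_left sum.distrib scaleR_sum_right)
  then show ?thesis by (simp add: linear_linear)
qed

text \<open>\<open>inner\<close> is the real part of the Hermitian product, so the conjugate
  transpose is also the adjoint with respect to \<open>inner\<close>.\<close>

lemma inner_matrix_adjoint: "inner (M *v v) w = inner v (matrix_adjoint M *v (w :: complex ^ 2))"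
proof -
  obtain a b c d where M: "M = mat22 a b c d" by (rule mat22_cases)
  show ?thesis
    by (simp add: M mat22_adjoint mat22_vec inner_cvec2 inner_complex_def algebra_simps)
qed

lemma psd_adjoint: "matrix_psd P \<Longrightarrow> matrix_adjoint P = P"
  by (cases P rule: mat22_cases) (auto simp: mat22_psd_iff mat22_adjoint mat22_eq_iff complex_eq_iff)

lemma norm_mat22_vec_le:
  "(norm (mat22 a b c d *v v))\<^sup>2 \<le>
     ((cmod a)\<^sup>2 + (cmod b)\<^sup>2 + (cmod c)\<^sup>2 + (cmod d)\<^sup>2) * (norm v)\<^sup>2"
proof -
  have row: "(cmod (a * x + b * y))\<^sup>2 \<le> ((cmod a)\<^sup>2 + (cmod b)\<^sup>2) * ((cmod x)\<^sup>2 + (cmod y)\<^sup>2)" for a b x y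
  proof -
    have "cmod (a * x + b * y) \<le> cmod a * cmod x + cmod b * cmod y"
      by (metis norm_mult norm_triangle_ineq)
    then have "(cmod (a * x + b * y))\<^sup>2 \<le> (cmod a * cmod x + cmod b * cmod y)\<^sup>2"
      by (rule power_mono) simp
    \<comment> \<open>The added square is the remainder term in Lagrange's identity, which proves
      Cauchy--Schwarz for one row.\<close>
    also have "\<dots> \<le> (cmod a * cmod x + cmod b * cmod y)\<^sup>2 + (cmod a * cmod y - cmod b * cmod x)\<^sup>2"
      by simp
    also have "\<dots> = ((cmod a)\<^sup>2 + (cmod b)\<^sup>2) * ((cmod x)\<^sup>2 + (cmod y)\<^sup>2)"
      by (simp add: power2_eq_square algebra_simps)
    finally show ?thesis .
  qed
  show ?thesis
    using add_mono[OF row[of a "v $ 1" b "v $ 2"] row[of c "v $ 1" d "v $ 2"]]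
    by (simp add: norm_cvec2 mat22_vec distrib_right)
qed

lemma matrix_adjoint_mult_psd: "matrix_psd (matrix_adjoint M ** M)"
proof -
  have "(\<Sum>i\<in>UNIV. cnj (v $ i) * (matrix_adjoint M ** M *v v) $ i)
      = of_real ((norm (M *v v))\<^sup>2)" for v
  proof -
    obtain a b c d where M: "M = mat22 a b c d" by (rule mat22_cases)
    show ?thesis
      unfolding norm_cvec2 M mat22_adjoint mat22_mult mat22_vec sum_2 of_real_add complex_norm_square
      by (simp add: algebra_simps)
  qed
  then show ?thesis by (simp add: matrix_psd_def)
qed

lemma matrix_abs_eq_psd_abs: "matrix_abs M = psd_abs M"
  unfolding matrix_abs_def psd_abs_def
  by (rule matrix_sqrt_eq_psd_sqrt) (rule matrix_adjoint_mult_psd)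

lemma psd_abs_psd: "matrix_psd (psd_abs M)"
  unfolding psd_abs_def by (rule psd_sqrt(1)) (rule matrix_adjoint_mult_psd)

text \<open>\<open>psd_abs M\<close> is self-adjoint with square
  \<open>matrix_adjoint M ** M\<close>, so both squared norms are the same quadratic form. Hence
  \<open>M\<close> and its absolute value share kernel and operator norm.\<close>

lemma norm_psd_abs_vec: "norm (psd_abs M *v v) = norm (M *v v)"
proof -
  have "psd_abs M ** psd_abs M = matrix_adjoint M ** M"
    unfolding psd_abs_def by (rule psd_sqrt(2)) (rule matrix_adjoint_mult_psd)
  then have "psd_abs M *v (psd_abs M *v v) = matrix_adjoint M *v (M *v v)"
    by (simp add: matrix_vector_mul_assoc)
  then have "inner v (psd_abs M *v (psd_abs M *v v)) = inner v (matrix_adjoint M *v (M *v v))"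
    by simp
  then have "inner (psd_abs M *v v) (psd_abs M *v v) = inner (M *v v) (M *v v)"
    using psd_adjoint[OF psd_abs_psd[of M]] by (simp add: inner_matrix_adjoint)
  then show ?thesis by (simp add: norm_eq_sqrt_inner)
qed

text \<open>For \<open>P = matrix_adjoint M ** M\<close> the determinant is the square of
  \<open>cmod D\<close> and the trace is the sum of the squared moduli of the entries. This
  identifies the quantities \<open>r\<close> and \<open>t\<close> of
  \<open>psd_sqrt\<close>.\<close>

lemma psd_abs_mat22:
  fixes a b c d :: complex
  defines "D \<equiv> a * d - b * c"
  defines "t \<equiv> sqrt ((cmod a)\<^sup>2 + (cmod b)\<^sup>2 + (cmod c)\<^sup>2 + (cmod d)\<^sup>2 + 2 * cmod D)"
  shows "psd_abs (mat22 a b c d) =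
    mat22 ((cnj a * a + cnj c * c + cmod D) / t) ((cnj a * b + cnj c * d) / t)
      ((cnj b * a + cnj d * c) / t) ((cnj b * b + cnj d * d + cmod D) / t)"
proof -
  let ?x = "(cmod a)\<^sup>2 + (cmod c)\<^sup>2" and ?y = "(cmod b)\<^sup>2 + (cmod d)\<^sup>2"
  have "?x * ?y - (cmod (cnj a * b + cnj c * d))\<^sup>2 = (cmod D)\<^sup>2"
    unfolding D_def cmod_power2 by (simp add: algebra_simps power2_eq_square)
  then have r: "sqrt (?x * ?y - (cmod (cnj a * b + cnj c * d))\<^sup>2) = cmod D" by simp
  have re: "Re (cnj a * a + cnj c * c) = ?x" "Re (cnj b * b + cnj d * d) = ?y"
    unfolding cmod_power2 by (simp_all add: power2_eq_square)
  show ?thesis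
    unfolding psd_abs_def mat22_adjoint mat22_mult psd_sqrt_def Let_def mat22_nth re r
    by (simp add: t_def add_ac)
qed

text \<open>The cases differ in the reason. For \<open>D \<noteq> 0\<close> the matrix
  \<open>psd_abs M\<close> is invertible, so everything is decided on its range. For
  \<open>D = 0\<close> the term with \<open>sgn D\<close> disappears and the phase is
  \<open>M\<close> divided by \<open>t\<close>.\<close>

lemma polar_phase:
  shows polar_phase_mult: "polar_phase M ** psd_abs M = M"
    and polar_phase_kernel: "psd_abs M *v v = 0 \<Longrightarrow> polar_phase M *v v = 0"
    and polar_phase_unique: "M = U ** psd_abs M \<Longrightarrow> (\<And>v. psd_abs M *v v = 0 \<Longrightarrow> U *v v = 0) \<Longrightarrow>
      U = polar_phase M"
    and norm_polar_phase_le: "norm (polar_phase M *v v) \<le> norm v"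
proof -
  obtain a b c d where M: "M = mat22 a b c d" by (rule mat22_cases)
  define D where "D = a * d - b * c"
  define T where "T = (cmod a)\<^sup>2 + (cmod b)\<^sup>2 + (cmod c)\<^sup>2 + (cmod d)\<^sup>2"
  define t where "t = sqrt (T + 2 * cmod D)"
  have T0: "T \<ge> 0" by (simp add: T_def)
  have t: "t \<ge> 0" "t\<^sup>2 = T + 2 * cmod D" using T0 by (simp_all add: t_def)
  have P: "psd_abs M = mat22 ((cnj a * a + cnj c * c + cmod D) / t) ((cnj a * b + cnj c * d) / t)
      ((cnj b * a + cnj d * c) / t) ((cnj b * b + cnj d * d + cmod D) / t)"
    unfolding M psd_abs_mat22 by (simp add: t_def T_def D_def)
  have U: "polar_phase M = mat22 ((a + sgn D * cnj d) / t) ((b - sgn D * cnj c) / t)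
          ((c - sgn D * cnj b) / t) ((d + sgn D * cnj a) / t)"
    by (simp add: M polar_phase_def Let_def t_def T_def D_def)
  have t0: "a = 0 \<and> b = 0 \<and> c = 0 \<and> d = 0" if "t = 0"
  proof -
    have "T + 2 * cmod D = 0" using t that by simp
    then have "T = 0" using T0 by (smt (verit) norm_ge_zero)
    then show ?thesis unfolding T_def by (simp add: add_nonneg_eq_0_iff)
  qed
  have tc: "(of_real t)\<^sup>2 = a * cnj a + b * cnj b + c * cnj c + d * cnj d + 2 * of_real (cmod D)"
  proof -
    have "(complex_of_real t)\<^sup>2 = of_real (T + 2 * cmod D)" using t(2) by (metis of_real_power)
    then show ?thesis unfolding T_def of_real_add complex_norm_square by simp
  qed
  have s1: "sgn D * of_real (cmod D) = D" by (simp add: sgn_eq)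
  have s2: "sgn D * cnj D = of_real (cmod D)"
    using complex_norm_square[of D] by (cases "D = 0") (simp_all add: sgn_eq power2_eq_square divide_eq_eq)
  have cD: "cnj D = cnj a * cnj d - cnj b * cnj c" by (simp add: D_def)
  show mult: "polar_phase M ** psd_abs M = M"
  proof (cases "t = 0")
    case True
    then show ?thesis using t0 unfolding U P by (simp add: M mat22_mult)
  next
    case False
    then have tt: "complex_of_real t \<noteq> 0" by simp
    define s where "s = sgn D"
    define q where "q = complex_of_real (cmod D)"
    \<comment> \<open>\<open>algebra\<close> sees an entry and its conjugate as independent
      unknowns; these are the relations tying \<open>D\<close>, its sign, its modulus and
      \<open>t\<close> to them.\<close>
    note e = s1[folded s_def q_def] s2[folded s_def q_def, unfolded cD] tc[folded q_def] D_def
    have "(a + s * cnj d) * (cnj a * a + cnj c * c + q) + (b - s * cnj c) * (cnj b * a + cnj d * c) = a * (of_real t)\<^sup>2"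
         "(a + s * cnj d) * (cnj a * b + cnj c * d) + (b - s * cnj c) * (cnj b * b + cnj d * d + q) = b * (of_real t)\<^sup>2"
         "(c - s * cnj b) * (cnj a * a + cnj c * c + q) + (d + s * cnj a) * (cnj b * a + cnj d * c) = c * (of_real t)\<^sup>2"
         "(c - s * cnj b) * (cnj a * b + cnj c * d) + (d + s * cnj a) * (cnj b * b + cnj d * d + q) = d * (of_real t)\<^sup>2"
      using e by algebra+
    then show ?thesis
      unfolding U P unfolding M mat22_mult mat22_eq_iff s_def[symmetric] q_def[symmetric]
      using tt by (simp add: power2_eq_square flip: add_divide_distrib)
  qed
  have det0: "polar_phase M *v w = (1 / of_real t) *s (M *v w)" if "D = 0" for w
    unfolding U unfolding M mat22_vec using that by (simp add: vec_eq_iff forall_2 add_divide_distrib)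
  text \<open>Cayley--Hamilton for \<open>psd_abs M\<close>, whose trace is \<open>t\<close>.\<close>
  define P2 where "P2 w = of_real t *s w - psd_abs M *v w" for w
  have CH: "psd_abs M *v P2 w = of_real (cmod D) *s w" for w
  proof (cases "t = 0")
    case True
    then show ?thesis unfolding P2_def P using t0 by (simp add: mat22_vec vec_eq_iff forall_2 D_def)
  next
    case False
    then have tt: "complex_of_real t \<noteq> 0" by simp
    define q where "q = complex_of_real (cmod D)"
    have q2: "q * q = (a * d - b * c) * (cnj a * cnj d - cnj b * cnj c)"
      using complex_norm_square[of D] unfolding q_def D_def by (simp add: power2_eq_square)
    define \<alpha> \<beta> \<gamma> \<delta> where "\<alpha> = (cnj a * a + cnj c * c + q) / t" and "\<beta> = (cnj a * b + cnj c * d) / t"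
      and "\<gamma> = (cnj b * a + cnj d * c) / t" and "\<delta> = (cnj b * b + cnj d * d + q) / t"
    note defs = this
    have tr: "of_real t = \<alpha> + \<delta>"
    proof -
      have "of_real t * of_real t = (cnj a * a + cnj c * c + q) + (cnj b * b + cnj d * d + q)"
        using tc unfolding q_def[symmetric] by algebra
      then show ?thesis using tt unfolding defs by (simp add: eq_divide_eq flip: add_divide_distrib)
    qed
    have "(cnj a * a + cnj c * c + q) * (cnj b * b + cnj d * d + q)
        - (cnj a * b + cnj c * d) * (cnj b * a + cnj d * c) = q * (of_real t)\<^sup>2"
      using q2 tc unfolding q_def[symmetric] by algebra
    then have det: "\<alpha> * \<delta> - \<beta> * \<gamma> = q"
      using tt unfolding defs by (simp add: power2_eq_square divide_eq_eq flip: diff_divide_distrib)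
    have P': "psd_abs M = mat22 \<alpha> \<beta> \<gamma> \<delta>" unfolding P defs q_def ..
    show ?thesis
      unfolding P2_def P' q_def[symmetric] det[symmetric] mat22_vec tr
      by (simp add: vec_eq_iff forall_2 algebra_simps)
  qed
  have inv: "\<exists>v. w = psd_abs M *v v" if "D \<noteq> 0" for w
  proof
    have "psd_abs M *v ((1 / of_real (cmod D)) *s P2 w) = (1 / of_real (cmod D)) *s (psd_abs M *v P2 w)"
      by (simp add: vector_scalar_commute)
    then show "w = psd_abs M *v ((1 / of_real (cmod D)) *s P2 w)"
      using that by (simp add: CH)
  qed
  show ker: "polar_phase M *v v = 0" if "psd_abs M *v v = 0" for v
  proof (cases "D = 0")
    case True
    have "norm (M *v v) = 0" using norm_psd_abs_vec[of M v] that by simp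
    then show ?thesis using det0[OF True] by simp
  next
    case False
    have "psd_abs M *v P2 v = P2 (psd_abs M *v v)"
      by (simp add: P2_def matrix_vector_mult_diff_distrib vector_scalar_commute)
    also have "\<dots> = 0" using that by (simp add: P2_def)
    finally have "v = 0" using False by (simp add: CH)
    then show ?thesis by simp
  qed
  show "norm (polar_phase M *v v) \<le> norm v" for v
  proof (cases "D = 0")
    case True
    \<comment> \<open>For \<open>D = 0\<close> the square of \<open>t\<close> is the squared
      Frobenius norm of \<open>M\<close>, so \<open>M\<close> divided by \<open>t\<close> does not
      increase norms.\<close>
    have "(norm (M *v v))\<^sup>2 \<le> t\<^sup>2 * (norm v)\<^sup>2"
      using norm_mat22_vec_le[of a b c d v] t True by (simp add: M T_def)
    then have "norm (M *v v) \<le> t * norm v"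
      using t by (metis power2_le_imp_le power_mult_distrib mult_nonneg_nonneg norm_ge_zero)
    then show ?thesis
      unfolding det0[OF True] norm_cvector_smult using t
      by (cases "t = 0") (simp_all add: norm_divide pos_divide_le_eq mult.commute)
  next
    case False
    then obtain w where w: "v = psd_abs M *v w" using inv by blast
    have "polar_phase M *v v = M *v w" by (simp add: w matrix_vector_mul_assoc mult)
    then show ?thesis by (simp add: w norm_psd_abs_vec)
  qed
  show "U' = polar_phase M" if U': "M = U' ** psd_abs M" "\<And>v. psd_abs M *v v = 0 \<Longrightarrow> U' *v v = 0" for U'
  proof -
    have on_range: "U' *v (psd_abs M *v w) = polar_phase M *v (psd_abs M *v w)" for w
      using U'(1) mult by (metis matrix_vector_mul_assoc)
    have "U' *v w = polar_phase M *v w" for w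
    proof (cases "D = 0")
      case True
      \<comment> \<open>With zero determinant, Cayley--Hamilton puts \<open>P2 w\<close> into the
        kernel. So \<open>t w\<close> is the sum of \<open>psd_abs M *v w\<close> in the range and
        \<open>P2 w\<close> in the kernel, and both candidates agree on each summand.\<close>
      have "psd_abs M *v P2 w = 0" using CH[of w] True by simp
      then have "U' *v P2 w = polar_phase M *v P2 w" using U'(2) ker by metis
      then have "of_real t *s (U' *v w) = of_real t *s (polar_phase M *v w)"
        using on_range[of w] by (simp add: P2_def matrix_vector_mult_diff_distrib vector_scalar_commute)
      show ?thesis
      proof (cases "t = 0")
        case True
        then have "psd_abs M *v w = 0" by (simp add: P mat22_vec vec_eq_iff forall_2)
        then show ?thesis using U'(2) ker by metis
      next
        case False
        then show ?thesis using \<open>of_real t *s _ = _\<close> by (simp add: vec_eq_iff)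
      qed
    next
      case False
      then show ?thesis using inv on_range by metis
    qed
    then show ?thesis by (simp add: matrix_eq)
  qed
qed

lemma matrix_phase_eq_polar_phase: "matrix_phase M = polar_phase M"
  unfolding matrix_phase_def matrix_abs_eq_psd_abs
  by (rule the_equality) (auto simp: polar_phase_mult polar_phase_kernel intro: polar_phase_unique)

text \<open>The squared norm equals the quadratic form of \<open>psd_abs M\<close>, which
  Cauchy--Schwarz bounds by the operator norm of \<open>M\<close>. Each of \<open>A\<close> and
  \<open>B\<close> thus carries half of the potential, so that one weight serves on both sides of
  the kernel.\<close>

lemma norm_sqrt_abs_vec_le:
  "norm (matrix_sqrt (matrix_abs M) *v v) \<le> sqrt (onorm ((*v) M)) * norm v"
proof -
  let ?S = "psd_sqrt (psd_abs M)"
  have "(norm (?S *v v))\<^sup>2 = inner v (psd_abs M *v v)"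
    using psd_adjoint[OF psd_sqrt(1)[OF psd_abs_psd[of M]]] psd_sqrt(2)[OF psd_abs_psd[of M]]
    by (simp add: power2_norm_eq_inner inner_matrix_adjoint matrix_vector_mul_assoc)
  also have "\<dots> \<le> norm v * norm (psd_abs M *v v)" by (rule norm_cauchy_schwarz)
  also have "\<dots> \<le> norm v * (onorm ((*v) M) * norm v)"
    unfolding norm_psd_abs_vec
    by (intro mult_left_mono onorm bounded_linear_matrix_vector_mult) simp
  also have "\<dots> = (sqrt (onorm ((*v) M)) * norm v)\<^sup>2"
    by (simp add: power_mult_distrib onorm_pos_le bounded_linear_matrix_vector_mult power2_eq_square)
  finally show ?thesis
    unfolding matrix_abs_eq_psd_abs matrix_sqrt_eq_psd_sqrt[OF psd_abs_psd]
    by (rule power2_le_imp_le) (simp add: onorm_pos_le bounded_linear_matrix_vector_mult)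
qed

lemma norm_phase_sqrt_abs_vec_le:
  "norm ((matrix_phase M ** matrix_sqrt (matrix_abs M)) *v v) \<le> sqrt (onorm ((*v) M)) * norm v"
  using order_trans[OF norm_polar_phase_le norm_sqrt_abs_vec_le, of M M v]
  by (simp add: matrix_phase_eq_polar_phase matrix_vector_mul_assoc)


section \<open>Measurability of the matrix-valued functions\<close>

lemma borel_measurable_vec_iff:
  "f \<in> borel_measurable M \<longleftrightarrow> (\<forall>i. (\<lambda>x. f x $ i) \<in> borel_measurable M)"
  for f :: "'a \<Rightarrow> 'b :: euclidean_space ^ 'n"
proof
  assume f: "f \<in> borel_measurable M"
  show "\<forall>i. (\<lambda>x. f x $ i) \<in> borel_measurable M"
  proof
    fix i
    have "continuous_on UNIV (\<lambda>v :: 'b ^ 'n. v $ i)" by (intro continuous_intros)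
    from borel_measurable_continuous_on[OF this f] show "(\<lambda>x. f x $ i) \<in> borel_measurable M" .
  qed
next
  assume "\<forall>i. (\<lambda>x. f x $ i) \<in> borel_measurable M"
  then show "f \<in> borel_measurable M"
    unfolding borel_measurable_euclidean_space[of f] by (auto simp: Basis_vec_def inner_axis intro!: borel_measurable_inner)
qed

lemma borel_measurable_vec_nth [measurable (raw)]:
  "f \<in> borel_measurable M \<Longrightarrow> (\<lambda>x. f x $ i) \<in> borel_measurable M"
  for f :: "'a \<Rightarrow> 'b :: euclidean_space ^ 'n"
  using borel_measurable_vec_iff by blast

lemma borel_measurable_complex_of_real [measurable (raw)]:
  "f \<in> borel_measurable M \<Longrightarrow> (\<lambda>x. complex_of_real (f x)) \<in> borel_measurable M"
  using measurable_compose borel_measurable_of_real by blast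

lemma borel_measurable_cnj [measurable (raw)]:
  "f \<in> borel_measurable M \<Longrightarrow> (\<lambda>x. cnj (f x)) \<in> borel_measurable M"
  using borel_measurable_continuous_on[of cnj] by (auto intro: continuous_intros)

lemma borel_measurable_mat22 [measurable (raw)]:
  assumes "a \<in> borel_measurable M" "b \<in> borel_measurable M" "c \<in> borel_measurable M" "d \<in> borel_measurable M"
  shows "(\<lambda>x. mat22 (a x) (b x) (c x) (d x)) \<in> borel_measurable M"
  unfolding borel_measurable_vec_iff[where f = "\<lambda>x. mat22 (a x) (b x) (c x) (d x)"]
    borel_measurable_vec_iff[where f = "\<lambda>x. mat22 (a x) (b x) (c x) (d x) $ i" for i] forall_2
  using assms by simp

lemma borel_measurable_matrix_vector_mult [measurable (raw)]:
  fixes A :: "'a \<Rightarrow> complex ^ 2 ^ 2"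
  assumes "A \<in> borel_measurable M" "v \<in> borel_measurable M"
  shows "(\<lambda>x. A x *v v x) \<in> borel_measurable M"
  unfolding borel_measurable_vec_iff[where f = "\<lambda>x. A x *v v x"]
  using assms by (simp add: matrix_vector_mult_def)

lemma borel_measurable_matrix_mult [measurable (raw)]:
  fixes A B :: "'a \<Rightarrow> complex ^ 2 ^ 2"
  assumes "A \<in> borel_measurable M" "B \<in> borel_measurable M"
  shows "(\<lambda>x. A x ** B x) \<in> borel_measurable M"
  unfolding borel_measurable_vec_iff[where f = "\<lambda>x. A x ** B x"]
    borel_measurable_vec_iff[where f = "\<lambda>x. (A x ** B x) $ i" for i]
  using assms by (simp add: matrix_matrix_mult_def)

text \<open>Measurability is read off the closed formula in the entries; a definite description has
  no structure from which to derive it.\<close>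

lemma borel_measurable_psd_sqrt [measurable (raw)]:
  assumes [measurable]: "V \<in> borel_measurable M"
  shows "(\<lambda>x. psd_sqrt (V x)) \<in> borel_measurable M"
  unfolding psd_sqrt_def Let_def by measurable

lemma borel_measurable_sqrt_abs [measurable (raw)]:
  assumes [measurable]: "V \<in> borel_measurable M"
  shows "(\<lambda>x. matrix_sqrt (matrix_abs (V x))) \<in> borel_measurable M"
proof -
  have "(\<lambda>x. matrix_adjoint (V x)) = (\<lambda>x. mat22 (cnj (V x $ 1 $ 1)) (cnj (V x $ 2 $ 1)) (cnj (V x $ 1 $ 2)) (cnj (V x $ 2 $ 2)))"
    by (simp add: fun_eq_iff vec_eq_iff forall_2 matrix_adjoint_def)
  then have [measurable]: "(\<lambda>x. matrix_adjoint (V x)) \<in> borel_measurable M" by simp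
  show ?thesis
    unfolding matrix_abs_eq_psd_abs matrix_sqrt_eq_psd_sqrt[OF psd_abs_psd]
    unfolding psd_abs_def by measurable
qed

lemma borel_measurable_phase [measurable (raw)]:
  assumes [measurable]: "V \<in> borel_measurable M"
  shows "(\<lambda>x. matrix_phase (V x)) \<in> borel_measurable M"
  unfolding matrix_phase_eq_polar_phase polar_phase_def Let_def sgn_eq by measurable

lemma onorm_matrix_le_norm: "onorm ((*v) (M :: complex ^ 2 ^ 2)) \<le> norm M"
proof (rule onorm_le)
  fix v
  obtain a b c d where M: "M = mat22 a b c d" by (rule mat22_cases)
  have "(norm M)\<^sup>2 = (cmod a)\<^sup>2 + (cmod b)\<^sup>2 + (cmod c)\<^sup>2 + (cmod d)\<^sup>2"
    by (simp add: M norm_vec_def[of "mat22 a b c d"] L2_set_def sum_2 norm_cvec2)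
  then have "(norm (M *v v))\<^sup>2 \<le> (norm M * norm v)\<^sup>2"
    using norm_mat22_vec_le[of a b c d v] by (simp add: M power_mult_distrib)
  then show "norm (M *v v) \<le> norm M * norm v" by (rule power2_le_imp_le) simp
qed

text \<open>The reverse triangle inequality makes the operator norm 1-Lipschitz in the Frobenius
  norm. Continuity then yields measurability of the norm of \<open>V x\<close> in
  \<open>x\<close>.\<close>

lemma continuous_on_onorm_matrix: "continuous_on S (\<lambda>M :: complex ^ 2 ^ 2. onorm ((*v) M))"
proof (rule lipschitz_on_continuous_on)
  have le: "onorm ((*v) M) - onorm ((*v) N) \<le> norm (M - N)" for M N :: "complex ^ 2 ^ 2"
  proof -
    have "onorm (\<lambda>v. N *v v + (M - N) *v v) \<le> onorm ((*v) N) + onorm ((*v) (M - N))"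
      by (rule onorm_triangle) (rule bounded_linear_matrix_vector_mult)+
    then show ?thesis
      using onorm_matrix_le_norm[of "M - N"] by (simp add: matrix_vector_mult_diff_rdistrib)
  qed
  show "1-lipschitz_on S (\<lambda>M :: complex ^ 2 ^ 2. onorm ((*v) M))"
    using le by (intro lipschitz_onI) (auto simp: dist_norm abs_le_iff, metis norm_minus_commute)
qed

lemma borel_measurable_onorm_matrix [measurable (raw)]:
  "V \<in> borel_measurable M \<Longrightarrow> (\<lambda>x. onorm ((*v) (V x :: complex ^ 2 ^ 2))) \<in> borel_measurable M"
  using borel_measurable_continuous_on[OF continuous_on_onorm_matrix] .

section \<open>The kernel of the free resolvent\<close>

lemma nn_integral_exp_abs:
  assumes "c > 0"
  shows "(\<integral>\<^sup>+t. ennreal (exp (- c * \<bar>t\<bar>)) \<partial>lborel) = ennreal (2 / c)"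
proof -
  have half: "(\<integral>\<^sup>+t. ennreal (exp (- c * t)) * indicator {0..} t \<partial>lborel) = ennreal (1 / c)"
  proof -
    have "((\<lambda>t. - exp (- c * t) / c) \<longlongrightarrow> - 0 / c) at_top"
      using assms
      by (intro tendsto_intros filterlim_compose[OF exp_at_bot])
        (auto simp: filterlim_uminus_at_bot
          intro!: filterlim_tendsto_pos_mult_at_top[OF tendsto_const _ filterlim_ident])
    moreover have "((\<lambda>t. - exp (- c * t) / c) has_real_derivative exp (- c * t)) (at t)" for t
      using assms by (auto intro!: derivative_eq_intros)
    ultimately have "(\<integral>\<^sup>+t. ennreal (exp (- c * t)) * indicator {0..} t \<partial>lborel)
        = ennreal (- 0 / c - (- exp (- c * 0) / c))"
      by (intro nn_integral_FTC_atLeast) auto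
    then show ?thesis by simp
  qed
  have "(\<integral>\<^sup>+t. ennreal (exp (- c * (- t))) * indicator {..0} t \<partial>lborel)
      = (\<integral>\<^sup>+t. ennreal (exp (- c * t)) * indicator {0..} t \<partial>lborel)"
    by (subst nn_integral_real_affine[where c="-1" and t=0])
       (auto simp: indicator_def intro!: nn_integral_cong)
  with half have half': "(\<integral>\<^sup>+t. ennreal (exp (- c * (- t))) * indicator {..0} t \<partial>lborel) = ennreal (1 / c)"
    by simp
  have "(\<integral>\<^sup>+t. ennreal (exp (- c * \<bar>t\<bar>)) \<partial>lborel)
     = (\<integral>\<^sup>+t. ennreal (exp (- c * (- t))) * indicator {..0} t + ennreal (exp (- c * t)) * indicator {0..} t \<partial>lborel)"
  proof (rule nn_integral_cong_AE)
    show "AE t in lborel. ennreal (exp (- c * \<bar>t\<bar>)) =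
        ennreal (exp (- c * (- t))) * indicator {..0} t + ennreal (exp (- c * t)) * indicator {0..} t"
      using AE_lborel_singleton[of 0] by eventually_elim (auto simp: indicator_def)
  qed
  also have "\<dots> = ennreal (1 / c) + ennreal (1 / c)"
    using half half' by (subst nn_integral_add) auto
  also have "\<dots> = ennreal (2 / c)" using assms by (simp flip: ennreal_plus)
  finally show ?thesis .
qed

lemma nn_integral_lborel_reflect:
  fixes f :: "real \<Rightarrow> ennreal"
  assumes [measurable]: "f \<in> borel_measurable borel"
  shows "(\<integral>\<^sup>+y. f (x - y) \<partial>lborel) = (\<integral>\<^sup>+t. f t \<partial>lborel)"
  by (subst nn_integral_real_affine[where c="-1" and t=x and f=f]) auto

text \<open>Young's inequality is applied to functions divided by their norms. Working with numbers
  strictly above \<open>a\<close> and \<open>b\<close> and letting them decrease avoids dividing by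
  a vanishing norm.\<close>

lemma Hoelder_nn_integral:
  fixes f g :: "'a \<Rightarrow> real"
  assumes p: "1 < p" "1 < q" "1 / p + 1 / q = 1"
    and [measurable]: "f \<in> borel_measurable M" "g \<in> borel_measurable M"
    and nn: "\<And>x. 0 \<le> f x" "\<And>x. 0 \<le> g x" and a: "0 \<le> a" "0 \<le> b"
    and f: "(\<integral>\<^sup>+x. ennreal (f x powr p) \<partial>M) \<le> ennreal a"
    and g: "(\<integral>\<^sup>+x. ennreal (g x powr q) \<partial>M) \<le> ennreal b"
  shows "(\<integral>\<^sup>+x. ennreal (f x * g x) \<partial>M) \<le> ennreal (a powr (1 / p) * b powr (1 / q))"
proof -
  have eps: "(\<integral>\<^sup>+x. ennreal (f x * g x) \<partial>M) \<le> ennreal (\<alpha> powr (1 / p) * \<beta> powr (1 / q))"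
    if \<alpha>: "\<alpha> > a" and \<beta>: "\<beta> > b" for \<alpha> \<beta>
  proof -
    define s t where "s = \<alpha> powr (1 / p)" and "t = \<beta> powr (1 / q)"
    have st: "s > 0" "t > 0" using a \<alpha> \<beta> by (simp_all add: s_def t_def)
    have sp: "s powr p = \<alpha>" "t powr q = \<beta>"
      using p a \<alpha> \<beta> by (simp_all add: s_def t_def powr_powr)
    have young: "f x * g x \<le> s * t * (f x powr p / (p * \<alpha>) + g x powr q / (q * \<beta>))" for x
    proof -
      have "(f x / s) * (g x / t) \<le> (f x / s) powr p / p + (g x / t) powr q / q"
        using p nn st by (intro Youngs_inequality) auto
      also have "\<dots> = f x powr p / (p * \<alpha>) + g x powr q / (q * \<beta>)"
        using nn st by (simp add: powr_divide sp mult.commute)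
      finally show ?thesis using st by (simp add: pos_divide_le_eq mult.commute)
    qed
    have "(\<integral>\<^sup>+x. ennreal (f x * g x) \<partial>M) \<le>
        (\<integral>\<^sup>+x. ennreal (s * t / (p * \<alpha>)) * ennreal (f x powr p) + ennreal (s * t / (q * \<beta>)) * ennreal (g x powr q) \<partial>M)"
      using young st p a \<alpha> \<beta>
      by (intro nn_integral_mono) (simp add: algebra_simps flip: ennreal_mult ennreal_plus)
    also have "\<dots> = ennreal (s * t / (p * \<alpha>)) * (\<integral>\<^sup>+x. ennreal (f x powr p) \<partial>M)
        + ennreal (s * t / (q * \<beta>)) * (\<integral>\<^sup>+x. ennreal (g x powr q) \<partial>M)"
      by (simp add: nn_integral_add nn_integral_cmult)
    also have "\<dots> \<le> ennreal (s * t / (p * \<alpha>)) * ennreal \<alpha> + ennreal (s * t / (q * \<beta>)) * ennreal \<beta>"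
      using f g \<alpha> \<beta> a by (intro add_mono mult_left_mono order_trans[OF f] order_trans[OF g] ennreal_leI) auto
    also have "\<dots> = ennreal (s * t / p + s * t / q)"
      using st p a \<alpha> \<beta> by (simp flip: ennreal_mult ennreal_plus)
    also have "s * t / p + s * t / q = s * t"
      using p(3) by (metis distrib_left mult.right_neutral times_divide_eq_right mult_1_right)
    finally show ?thesis by (simp add: s_def t_def)
  qed
  \<comment> \<open>The exponents are positive, so \<open>powr\<close> is continuous from the right
    even at 0, which covers \<open>a = 0\<close> and \<open>b = 0\<close>.\<close>
  have lim: "((\<lambda>e. ennreal ((a + e) powr (1 / p) * (b + e) powr (1 / q)))
      \<longlongrightarrow> ennreal ((a + 0) powr (1 / p) * (b + 0) powr (1 / q))) (at_right 0)"
    using p a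
    by (intro tendsto_ennrealI tendsto_mult tendsto_powr' tendsto_intros tendsto_ident_at)
       (auto simp: eventually_at_filter)
  show ?thesis
    using tendsto_lowerbound[OF lim, of "\<integral>\<^sup>+x. ennreal (f x * g x) \<partial>M"] eps
    by (simp add: eventually_at_right_less eventually_at_filter)
qed

section \<open>Test functions and linear maps on spinors\<close>

lemma test_functionE:
  assumes "test_function \<phi>"
  obtains N where "0 < N" "\<And>x. N \<le> \<bar>x\<bar> \<Longrightarrow> \<phi> x = 0" "\<And>x. N \<le> \<bar>x\<bar> \<Longrightarrow> deriv \<phi> x = 0"
    "\<And>x. (\<phi> has_real_derivative deriv \<phi> x) (at x)" "continuous_on UNIV \<phi>" "continuous_on UNIV (deriv \<phi>)"
proof -
  have "\<phi> differentiable (at x)" "deriv \<phi> differentiable (at x)" for x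
    using assms[unfolded test_function_def, THEN conjunct1, rule_format, of 0 x]
      assms[unfolded test_function_def, THEN conjunct1, rule_format, of 1 x] by simp_all
  then have D: "(\<phi> has_real_derivative deriv \<phi> x) (at x)" and cont: "continuous_on UNIV \<phi>" "continuous_on UNIV (deriv \<phi>)" for x
    by (simp_all add: DERIV_deriv_iff_real_differentiable continuous_on_eq_continuous_at differentiable_imp_continuous_within)
  obtain B where B: "\<And>x. \<phi> x \<noteq> 0 \<Longrightarrow> \<bar>x\<bar> \<le> B" "B > 0"
    using assms unfolding test_function_def bounded_pos by auto
  have "deriv \<phi> x = 0" if "\<bar>x\<bar> > B" for x
  proof -
    have "eventually (\<lambda>y. \<bar>y\<bar> > B) (nhds x)"
      using that by (intro order_tendstoD[where f = abs]) (auto intro!: tendsto_intros filterlim_ident)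
    then have "eventually (\<lambda>y. \<phi> y = 0) (nhds x)" by eventually_elim (use B in force)
    then have "deriv \<phi> x = deriv (\<lambda>_. 0) x" by (intro deriv_cong_ev) auto
    then show ?thesis by simp
  qed
  moreover have "\<phi> x = 0" if "\<bar>x\<bar> > B" for x using B that by force
  \<comment> \<open>The argument for the derivative needs \<open>\<phi>\<close> to vanish in a
    neighbourhood and so gives the strict region \<open>\<bar>x\<bar> > B\<close>; the radius
    \<open>B + 1\<close> restores a non-strict bound.\<close>
  ultimately show ?thesis using that[of "B + 1"] B D cont by force
qed

lemma integrable_compact_support:
  fixes f :: "real \<Rightarrow> 'b :: euclidean_space"
  assumes "continuous_on UNIV f" "\<And>x. N \<le> \<bar>x\<bar> \<Longrightarrow> f x = 0"
  shows "integrable lborel f"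
proof -
  have "integrable lborel (\<lambda>x. indicator {-N..N} x *\<^sub>R f x)"
    using assms by (intro borel_integrable_compact) (auto intro: continuous_on_subset)
  also have "(\<lambda>x. indicator {-N..N} x *\<^sub>R f x) = f"
    using assms(2) by (force simp: indicator_def fun_eq_iff abs_le_iff)
  finally show ?thesis .
qed


lemma bounded_linear_cvector_smult: "bounded_linear (\<lambda>v :: complex ^ 2. c *s v)"
  by (rule bounded_linear_intro[where K = "cmod c"])
    (simp_all add: vec_eq_iff distrib_left norm_cvector_smult)

lemma bounded_linear_cvector_smult_left: "bounded_linear (\<lambda>c. c *s (v :: complex ^ 2))"
  by (rule bounded_linear_intro[where K = "norm v"])
    (simp_all add: vec_eq_iff distrib_right norm_cvector_smult)

lemma square_integrable_bounded_linear:
  fixes T :: "complex ^ 2 \<Rightarrow> complex ^ 2"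
  assumes T: "bounded_linear T" and f: "square_integrable f"
  shows "square_integrable (\<lambda>x. T (f x))"
proof -
  have [measurable]: "f \<in> borel_measurable lborel" using f by (simp add: square_integrable_def)
  have meas: "(\<lambda>x. T (f x)) \<in> borel_measurable lborel"
    by (rule borel_measurable_continuous_on[OF linear_continuous_on[OF T]]) measurable
  obtain K where K: "\<And>v. norm (T v) \<le> norm v * K" "K \<ge> 0"
    using bounded_linear.nonneg_bounded[OF T] by blast
  have "integrable lborel (\<lambda>x. (norm (T (f x)))\<^sup>2)"
  proof (rule Bochner_Integration.integrable_bound)
    show "integrable lborel (\<lambda>x. K\<^sup>2 * (norm (f x))\<^sup>2)"
      using f by (simp add: square_integrable_def)
    show "AE x in lborel. norm ((norm (T (f x)))\<^sup>2) \<le> norm (K\<^sup>2 * (norm (f x))\<^sup>2)"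
      using K by (auto simp: power_mult_distrib[symmetric] mult.commute intro!: power_mono)
  qed (use meas in measurable)
  with meas show ?thesis by (simp add: square_integrable_def)
qed

lemma sigma_mat22: "sigma1 = mat22 0 1 1 0" "sigma3 = mat22 1 0 0 (- 1)"
  by (simp_all add: sigma1_def sigma3_def mat22_def)

lemma borel_measurable_cvector_smult' [measurable (raw)]:
  assumes "c \<in> borel_measurable M" "f \<in> borel_measurable M"
  shows "(\<lambda>x. c x *s (f x :: complex ^ 2)) \<in> borel_measurable M"
  using assms unfolding borel_measurable_vec_iff[where f = "\<lambda>x. c x *s f x"]
  by (auto intro!: borel_measurable_times borel_measurable_vec_nth)

text \<open>Keeping the root \<open>k\<close> abstract separates the kernel estimates from the
  question whether \<open>sqrt_upper m z\<close> denotes a root in the upper half-plane.\<close>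

locale free_resolvent_kernel =
  fixes m :: real and z k :: complex
  assumes k_sq: "k\<^sup>2 = z\<^sup>2 - (complex_of_real m)\<^sup>2" and Im_k: "Im k > 0"
begin

definition eta_z :: real where
  "eta_z = 1 / sqrt 2 * sqrt (1 + ((cmod z)\<^sup>2 + m\<^sup>2) / cmod (z\<^sup>2 - (complex_of_real m)\<^sup>2))"

definition kernel :: "real \<Rightarrow> complex ^ 2 \<Rightarrow> complex ^ 2" where
  "kernel t w = (\<i> / (2 * k) * exp (\<i> * k * of_real \<bar>t\<bar>)) *s
     (mat22 (z + m) (k * of_real (sgn t)) (k * of_real (sgn t)) (z - m) *v w)"

definition conv :: "(real \<Rightarrow> complex ^ 2) \<Rightarrow> real \<Rightarrow> complex ^ 2" where
  "conv h x = (LINT y|lborel. kernel (x - y) (h y))"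

abbreviation decay :: "real \<Rightarrow> real" where
  "decay t \<equiv> exp (- Im k * \<bar>t\<bar>)"

lemma k_nonzero: "k \<noteq> 0" using Im_k by auto

lemma eta_z_nonneg: "eta_z \<ge> 0" by (simp add: eta_z_def)

lemma bounded_linear_kernel: "bounded_linear (kernel t)"
  unfolding kernel_def[abs_def]
  by (intro bounded_linear_compose[OF bounded_linear_cvector_smult] bounded_linear_matrix_vector_mult)

lemma borel_measurable_kernel [measurable (raw)]:
  assumes [measurable]: "t \<in> borel_measurable M" "w \<in> borel_measurable M"
  shows "(\<lambda>x. kernel (t x) (w x)) \<in> borel_measurable M"
  unfolding kernel_def by measurable

text \<open>This is where \<eta> originates. By the parallelogram law the squared Frobenius norm of
  the matrix is at most \<open>2 ((cmod k)\<^sup>2 + (cmod z)\<^sup>2 + m\<^sup>2)\<close>; divided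
  by \<open>4 (cmod k)\<^sup>2\<close>, from the prefactor, this is
  \<open>eta_z\<^sup>2\<close>.\<close>

lemma norm_kernel_le: "norm (kernel t w) \<le> eta_z * decay t * norm w"
proof -
  define s where "s = complex_of_real (sgn t)"
  let ?F = "(cmod (z + m))\<^sup>2 + (cmod (k * s))\<^sup>2 + (cmod (k * s))\<^sup>2 + (cmod (z - m))\<^sup>2"
  \<comment> \<open>An inequality, since the sign is 0 at \<open>t = 0\<close>.\<close>
  have "cmod s \<le> 1" by (simp add: s_def sgn_if)
  then have "cmod (k * s) \<le> cmod k" by (simp add: norm_mult mult_left_le)
  then have *: "(cmod (k * s))\<^sup>2 \<le> (cmod k)\<^sup>2" by (rule power_mono) simp
  have sq: "(cmod (z + m))\<^sup>2 + (cmod (z - m))\<^sup>2 = 2 * ((cmod z)\<^sup>2 + m\<^sup>2)"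
    unfolding cmod_power2 by (simp add: power2_eq_square algebra_simps)
  have F: "?F \<le> 2 * ((cmod k)\<^sup>2 + ((cmod z)\<^sup>2 + m\<^sup>2))"
  proof -
    have "a + b + b + c \<le> 2 * (d + q)" if "b \<le> d" "a + c = 2 * q" for a b c d q :: real
      using that by simp
    then show ?thesis using * sq by blast
  qed
  have k2: "cmod (z\<^sup>2 - (complex_of_real m)\<^sup>2) = (cmod k)\<^sup>2"
    unfolding k_sq[symmetric] by (simp add: norm_power)
  have eta: "eta_z\<^sup>2 = ((cmod k)\<^sup>2 + ((cmod z)\<^sup>2 + m\<^sup>2)) / (2 * (cmod k)\<^sup>2)"
    using k_nonzero by (simp add: eta_z_def k2 power_mult_distrib power_divide field_simps)
  have "norm (mat22 (z + m) (k * s) (k * s) (z - m) *v w) \<le> 2 * cmod k * eta_z * norm w"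
  proof (rule power2_le_imp_le)
    have "(norm (mat22 (z + m) (k * s) (k * s) (z - m) *v w))\<^sup>2 \<le> ?F * (norm w)\<^sup>2"
      by (rule norm_mat22_vec_le)
    also have "\<dots> \<le> 2 * ((cmod k)\<^sup>2 + ((cmod z)\<^sup>2 + m\<^sup>2)) * (norm w)\<^sup>2"
      using F by (rule mult_right_mono) simp
    also have "\<dots> = (2 * cmod k * eta_z * norm w)\<^sup>2"
      using k_nonzero by (simp add: power_mult_distrib eta)
    finally show "(norm (mat22 (z + m) (k * s) (k * s) (z - m) *v w))\<^sup>2 \<le> (2 * cmod k * eta_z * norm w)\<^sup>2" .
  qed (simp add: eta_z_nonneg)
  then have "cmod (\<i> / (2 * k) * exp (\<i> * k * of_real \<bar>t\<bar>)) * norm (mat22 (z + m) (k * s) (k * s) (z - m) *v w)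
      \<le> cmod (\<i> / (2 * k) * exp (\<i> * k * of_real \<bar>t\<bar>)) * (2 * cmod k * eta_z * norm w)"
    by (rule mult_left_mono) simp
  also have "cmod (\<i> / (2 * k) * exp (\<i> * k * of_real \<bar>t\<bar>)) = decay t / (2 * cmod k)"
    by (simp add: norm_mult norm_divide)
  finally show ?thesis
    using k_nonzero by (simp add: kernel_def norm_cvector_smult norm_mult norm_divide s_def[symmetric] ac_simps)
qed

text \<open>
  Schur's test: the weight \<open>v\<close> is \<open>1\<close> for the free resolvent itself and \<open>\<parallel>V\<parallel>\<close> for the operator
  \<open>A R\<^sub>0(z) B\<close>.
\<close>

lemma
  assumes [measurable]: "h \<in> borel_measurable lborel" "v \<in> borel_measurable lborel"
    and v: "\<And>y. 0 \<le> v y" and C: "0 \<le> C"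
    and vC: "\<And>x. (\<integral>\<^sup>+y. ennreal (decay (x - y) * v y) \<partial>lborel) \<le> ennreal C"
    and h: "AE y in lborel. norm (h y) \<le> sqrt (v y) * norm (rep_L2 F y)"
  shows integrable_kernel: "integrable lborel (\<lambda>y. kernel (x - y) (h y))"
    and borel_measurable_conv: "conv h \<in> borel_measurable lborel"
    and conv_weighted_L2_le:
      "(\<integral>\<^sup>+x. ennreal (v x * (norm (conv h x))\<^sup>2) \<partial>lborel) \<le> ennreal ((eta_z * C * norm F)\<^sup>2)"
proof -
  let ?G = "\<lambda>x. \<integral>\<^sup>+y. ennreal (decay (x - y) * (norm (rep_L2 F y))\<^sup>2) \<partial>lborel"
  \<comment> \<open>Cauchy--Schwarz in \<open>y\<close>: \<open>decay\<close> is split evenly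
    between the two factors and \<open>sqrt (v y)\<close> joins the first, whose squared integral is
    then at most \<open>C\<close>.\<close>
  have le: "(\<integral>\<^sup>+y. ennreal (norm (kernel (x - y) (h y))) \<partial>lborel)\<^sup>2 \<le> ennreal (eta_z\<^sup>2 * C) * ?G x" for x
  proof -
    have "(\<integral>\<^sup>+y. ennreal (norm (kernel (x - y) (h y))) \<partial>lborel) \<le>
        (\<integral>\<^sup>+y. ennreal eta_z * (ennreal (sqrt (decay (x - y) * v y)) * ennreal (sqrt (decay (x - y)) * norm (rep_L2 F y))) \<partial>lborel)"
    proof (rule nn_integral_mono_AE, use h in eventually_elim)
      fix y assume hy: "norm (h y) \<le> sqrt (v y) * norm (rep_L2 F y)"
      have "norm (kernel (x - y) (h y)) \<le> eta_z * decay (x - y) * norm (h y)" by (rule norm_kernel_le)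
      also have "\<dots> \<le> eta_z * decay (x - y) * (sqrt (v y) * norm (rep_L2 F y))"
        using hy eta_z_nonneg by (intro mult_left_mono) auto
      also have "\<dots> = eta_z * (sqrt (decay (x - y) * v y) * (sqrt (decay (x - y)) * norm (rep_L2 F y)))"
        by (simp add: real_sqrt_mult)
      finally show "ennreal (norm (kernel (x - y) (h y))) \<le> ennreal eta_z * (ennreal (sqrt (decay (x - y) * v y)) * ennreal (sqrt (decay (x - y)) * norm (rep_L2 F y)))"
        using eta_z_nonneg v by (simp add: ennreal_leI flip: ennreal_mult)
    qed
    also have "\<dots> = ennreal eta_z * (\<integral>\<^sup>+y. ennreal (sqrt (decay (x - y) * v y)) * ennreal (sqrt (decay (x - y)) * norm (rep_L2 F y)) \<partial>lborel)"
      by (rule nn_integral_cmult) measurable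
    finally have "(\<integral>\<^sup>+y. ennreal (norm (kernel (x - y) (h y))) \<partial>lborel)\<^sup>2 \<le>
      (ennreal eta_z)\<^sup>2 * (\<integral>\<^sup>+y. ennreal (sqrt (decay (x - y) * v y)) * ennreal (sqrt (decay (x - y)) * norm (rep_L2 F y)) \<partial>lborel)\<^sup>2"
      unfolding power_mult_distrib[symmetric] by (rule power_mono) simp
    also have "\<dots> \<le> (ennreal eta_z)\<^sup>2 * ((\<integral>\<^sup>+y. (ennreal (sqrt (decay (x - y) * v y)))\<^sup>2 \<partial>lborel) * (\<integral>\<^sup>+y. (ennreal (sqrt (decay (x - y)) * norm (rep_L2 F y)))\<^sup>2 \<partial>lborel))"
      by (intro mult_left_mono Cauchy_Schwarz_nn_integral) auto
    also have "(\<integral>\<^sup>+y. (ennreal (sqrt (decay (x - y) * v y)))\<^sup>2 \<partial>lborel) = (\<integral>\<^sup>+y. ennreal (decay (x - y) * v y) \<partial>lborel)"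
      using v by (simp add: ennreal_power)
    also have "(\<integral>\<^sup>+y. (ennreal (sqrt (decay (x - y)) * norm (rep_L2 F y)))\<^sup>2 \<partial>lborel) = ?G x"
      by (simp add: ennreal_power power_mult_distrib)
    also have "(ennreal eta_z)\<^sup>2 * ((\<integral>\<^sup>+y. ennreal (decay (x - y) * v y) \<partial>lborel) * ?G x) \<le> (ennreal eta_z)\<^sup>2 * (ennreal C * ?G x)"
      by (intro mult_left_mono mult_right_mono vC) auto
    also have "\<dots> = ennreal (eta_z\<^sup>2 * C) * ?G x"
      using eta_z_nonneg C by (simp add: ennreal_power ennreal_mult mult.assoc)
    finally show ?thesis .
  qed
  \<comment> \<open>Because \<open>decay\<close> is at most 1, \<open>?G x\<close> is finite for
    every \<open>x\<close>. So the convolution integral converges everywhere, even when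
    \<open>h\<close> is not square-integrable.\<close>
  have "?G x \<le> (\<integral>\<^sup>+y. ennreal ((norm (rep_L2 F y))\<^sup>2) \<partial>lborel)" for x
    using Im_k by (intro nn_integral_mono ennreal_leI mult_left_le_one_le) auto
  then have G_fin: "?G x < \<infinity>" for x
    unfolding nn_integral_rep_L2 by (rule le_less_trans) simp
  show int: "integrable lborel (\<lambda>y. kernel (x - y) (h y))" for x
  proof (rule integrableI_bounded)
    have "(\<integral>\<^sup>+y. ennreal (norm (kernel (x - y) (h y))) \<partial>lborel)\<^sup>2 < \<infinity>"
      using le[of x] by (rule le_less_trans) (use G_fin[of x] in \<open>simp add: ennreal_mult_less_top\<close>)
    then show "(\<integral>\<^sup>+y. ennreal (norm (kernel (x - y) (h y))) \<partial>lborel) < \<infinity>"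
      by (simp add: power_less_top_ennreal)
  qed measurable
  show meas: "conv h \<in> borel_measurable lborel"
    unfolding conv_def[abs_def] by (rule lborel.borel_measurable_lebesgue_integral) measurable
  have conv_le: "ennreal ((norm (conv h x))\<^sup>2) \<le> ennreal (eta_z\<^sup>2 * C) * ?G x" for x
  proof -
    have "ennreal (norm (conv h x)) \<le> (\<integral>\<^sup>+y. ennreal (norm (kernel (x - y) (h y))) \<partial>lborel)"
      unfolding conv_def using int by (rule integral_norm_bound_ennreal)
    then have "(ennreal (norm (conv h x)))\<^sup>2 \<le> (\<integral>\<^sup>+y. ennreal (norm (kernel (x - y) (h y))) \<partial>lborel)\<^sup>2"
      by (rule power_mono) simp
    with le[of x] show ?thesis by (simp add: ennreal_power)
  qed
  \<comment> \<open>After Tonelli, the symmetry of \<open>decay\<close> allows \<open>vC\<close> to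
    be applied a second time, now to the integral in \<open>x\<close>; this gives the second factor
    \<open>C\<close>.\<close>
  have "(\<integral>\<^sup>+x. (\<integral>\<^sup>+y. ennreal (v x) * ennreal (decay (x - y) * (norm (rep_L2 F y))\<^sup>2) \<partial>lborel) \<partial>lborel)
      = (\<integral>\<^sup>+y. (\<integral>\<^sup>+x. ennreal (v x) * ennreal (decay (x - y) * (norm (rep_L2 F y))\<^sup>2) \<partial>lborel) \<partial>lborel)"
    by (rule lborel_pair.Fubini') measurable
  also have "\<dots> = (\<integral>\<^sup>+y. (\<integral>\<^sup>+x. ennreal (decay (y - x) * v x) \<partial>lborel) * ennreal ((norm (rep_L2 F y))\<^sup>2) \<partial>lborel)"
    using v by (subst nn_integral_multc[symmetric])
      (auto simp: abs_minus_commute ac_simps intro!: nn_integral_cong simp flip: ennreal_mult)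
  also have "\<dots> \<le> (\<integral>\<^sup>+y. ennreal C * ennreal ((norm (rep_L2 F y))\<^sup>2) \<partial>lborel)"
    by (intro nn_integral_mono mult_right_mono vC) simp
  also have "\<dots> = ennreal C * ennreal ((norm F)\<^sup>2)"
    by (subst nn_integral_cmult) (auto simp: nn_integral_rep_L2)
  finally have inner_le: "(\<integral>\<^sup>+x. (\<integral>\<^sup>+y. ennreal (v x) * ennreal (decay (x - y) * (norm (rep_L2 F y))\<^sup>2) \<partial>lborel) \<partial>lborel)
      \<le> ennreal C * ennreal ((norm F)\<^sup>2)" .
  have "(\<integral>\<^sup>+x. ennreal (v x * (norm (conv h x))\<^sup>2) \<partial>lborel)
      \<le> (\<integral>\<^sup>+x. ennreal (eta_z\<^sup>2 * C) * (\<integral>\<^sup>+y. ennreal (v x) * ennreal (decay (x - y) * (norm (rep_L2 F y))\<^sup>2) \<partial>lborel) \<partial>lborel)"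
  proof (rule nn_integral_mono)
    fix x :: real
    have "ennreal (v x * (norm (conv h x))\<^sup>2) \<le> ennreal (v x) * (ennreal (eta_z\<^sup>2 * C) * ?G x)"
      using v conv_le[of x] by (simp add: ennreal_mult mult_left_mono)
    also have "\<dots> = ennreal (eta_z\<^sup>2 * C) * (\<integral>\<^sup>+y. ennreal (v x) * ennreal (decay (x - y) * (norm (rep_L2 F y))\<^sup>2) \<partial>lborel)"
      by (subst nn_integral_cmult) (auto simp: mult.left_commute)
    finally show "ennreal (v x * (norm (conv h x))\<^sup>2) \<le> \<dots>" .
  qed
  also have "\<dots> = ennreal (eta_z\<^sup>2 * C) * (\<integral>\<^sup>+x. (\<integral>\<^sup>+y. ennreal (v x) * ennreal (decay (x - y) * (norm (rep_L2 F y))\<^sup>2) \<partial>lborel) \<partial>lborel)"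
    by (rule nn_integral_cmult) measurable
  also have "\<dots> \<le> ennreal (eta_z\<^sup>2 * C) * (ennreal C * ennreal ((norm F)\<^sup>2))"
    by (rule mult_left_mono[OF inner_le]) simp
  also have "\<dots> = ennreal ((eta_z * C * norm F)\<^sup>2)"
    using C by (simp add: power2_eq_square ac_simps flip: ennreal_mult)
  finally show "(\<integral>\<^sup>+x. ennreal (v x * (norm (conv h x))\<^sup>2) \<partial>lborel) \<le> ennreal ((eta_z * C * norm F)\<^sup>2)" .
qed

section \<open>The kernel as a fundamental solution in the weak sense\<close>

text \<open>The equation \<open>(H\<^sub>0 - z) u = 0\<close> reads \<open>u' = dirac_rhs u\<close>.\<close>

definition dirac_rhs :: "complex ^ 2 \<Rightarrow> complex ^ 2" where
  "dirac_rhs w = mat22 0 (\<i> * (z + m)) (\<i> * (z - m)) 0 *v w"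

lemma bounded_linear_dirac_rhs: "bounded_linear dirac_rhs"
  unfolding dirac_rhs_def[abs_def] by (rule bounded_linear_matrix_vector_mult)

text \<open>As \<open>sigma1\<close> is its own inverse, the inhomogeneous equation with right-hand
  side \<open>h\<close> says that the derivative of \<open>u\<close> is
  \<open>\<i> *s (sigma1 *v h) + dirac_rhs u\<close>; substituting this back recovers the operator
  form.\<close>

lemma dirac_rhs_equation:
  "h + z *s u = (- \<i>) *s (sigma1 *v (\<i> *s (sigma1 *v h) + dirac_rhs u)) + complex_of_real m *s (sigma3 *v u)"
  by (simp add: dirac_rhs_def sigma_mat22 mat22_vec vec_eq_iff forall_2 algebra_simps)

text \<open>In distributions, the \<open>x\<close>-derivative of the kernel is
  \<open>dirac_rhs\<close> of it plus a point mass at \<open>y\<close> with value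
  \<open>\<i> *s (sigma1 *v w)\<close>. Integration by parts on either side of \<open>y\<close>
  leaves exactly the jump there.\<close>

lemma integral_test_function_kernel:
  assumes \<phi>: "test_function \<phi>"
  shows "(LINT x|lborel. deriv \<phi> x *\<^sub>R kernel (x - y) w) =
    - dirac_rhs (LINT x|lborel. \<phi> x *\<^sub>R kernel (x - y) w) - \<phi> y *\<^sub>R (\<i> *s (sigma1 *v w))"
proof -
  obtain N where N: "0 < N" "\<And>x. N \<le> \<bar>x\<bar> \<Longrightarrow> \<phi> x = 0" "\<And>x. N \<le> \<bar>x\<bar> \<Longrightarrow> deriv \<phi> x = 0"
    and D: "\<And>x. (\<phi> has_real_derivative deriv \<phi> x) (at x)"
    and cont: "continuous_on UNIV \<phi>" "continuous_on UNIV (deriv \<phi>)"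
    using test_functionE[OF \<phi>] by blast
  interpret R: bounded_linear dirac_rhs by (rule bounded_linear_dirac_rhs)
  \<comment> \<open>Large enough that \<open>y\<close> lies between \<open>- M\<close> and
    \<open>M\<close> while \<open>\<phi>\<close> vanishes at both ends.\<close>
  define M where "M = N + \<bar>y\<bar>"
  \<comment> \<open>\<open>E 1\<close> and \<open>E (- 1)\<close> continue the branches of the
    kernel for \<open>x > y\<close> and \<open>x < y\<close> smoothly to the whole line; each solves
    the homogeneous equation.\<close>
  define E where "E s x = (\<i> / (2 * k) * exp (s * \<i> * k * of_real (x - y))) *s (mat22 (z + m) (k * s) (k * s) (z - m) *v w)"
    for s :: complex and x :: real
  have E_rhs: "(s * \<i> * k) *s E s x = dirac_rhs (E s x)" if "s\<^sup>2 = 1" for s x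
  proof -
    have "s * s = 1" "k * k = (z - m) * (z + m)" using that k_sq by (simp_all add: power2_eq_square algebra_simps)
    then have e: "s * k * (k * s) = (z - m) * (z + m)" by algebra
    have rows: "(s * \<i> * k) * ((z + m) * w1 + k * s * w2) = \<i> * (z + m) * (k * s * w1 + (z - m) * w2)"
      "(s * \<i> * k) * (k * s * w1 + (z - m) * w2) = \<i> * (z - m) * ((z + m) * w1 + k * s * w2)" for w1 w2
      using e by algebra+
    have "(s * \<i> * k) *s (mat22 (z + m) (k * s) (k * s) (z - m) *v w)
       = dirac_rhs (mat22 (z + m) (k * s) (k * s) (z - m) *v w)"
      by (simp only: dirac_rhs_def mat22_vec vec_eq_iff forall_2 vector_2 vector_smult_component
          mult_zero_left add_0_left add_0_right rows)
    moreover have "(s * \<i> * k) *s (c *s v) = c *s ((s * \<i> * k) *s v)" for c and v :: "complex ^ 2"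
      by (simp only: vector_smult_assoc mult.commute)
    moreover have "dirac_rhs (c *s v) = c *s dirac_rhs v" for c v
      by (simp add: dirac_rhs_def vector_scalar_commute)
    ultimately show ?thesis by (simp only: E_def)
  qed
  have E_deriv: "(E s has_vector_derivative dirac_rhs (E s x)) (at x within S)" if "s\<^sup>2 = 1" for s x S
  proof -
    have "((\<lambda>x. \<i> / (2 * k) * exp (s * \<i> * k * of_real (x - y))) has_vector_derivative
        (s * \<i> * k) * (\<i> / (2 * k) * exp (s * \<i> * k * of_real (x - y)))) (at x within S)"
      unfolding of_real_diff
      by (rule has_vector_derivative_real_field[where f = "\<lambda>u. \<i> / (2 * k) * exp (s * \<i> * k * (u - of_real y))"])
        (auto intro!: derivative_eq_intros)
    from bounded_linear.has_vector_derivative[OF bounded_linear_cvector_smult_left this]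
    show ?thesis
      using E_rhs[OF that, of x] unfolding E_def[abs_def] vector_smult_assoc by metis
  qed
  let ?f = "\<lambda>s x. deriv \<phi> x *\<^sub>R E s x + \<phi> x *\<^sub>R dirac_rhs (E s x)"
  have prod_deriv: "((\<lambda>x. \<phi> x *\<^sub>R E s x) has_vector_derivative ?f s x) (at x within S)" if "s\<^sup>2 = 1" for s x S
    using has_vector_derivative_scaleR[OF has_field_derivative_at_within[OF D] E_deriv[OF that]]
    by (simp add: add.commute)
  have cont_f: "continuous_on S (?f s)" if "s\<^sup>2 = 1" for s S
  proof -
    have "continuous_on S (E s)"
      using E_deriv[OF that] by (meson continuous_on_vector_derivative)
    then show ?thesis
      using cont by (intro continuous_intros R.continuous_on) (auto intro: continuous_on_subset)
  qed
  have "has_bochner_integral lborel (\<lambda>x. indicator {y..M} x *\<^sub>R ?f 1 x) (\<phi> M *\<^sub>R E 1 M - \<phi> y *\<^sub>R E 1 y)"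
    using N(1) by (intro has_bochner_integral_FTC_Icc prod_deriv cont_f) (auto simp: M_def)
  moreover have "has_bochner_integral lborel (\<lambda>x. indicator {- M..y} x *\<^sub>R ?f (- 1) x) (\<phi> y *\<^sub>R E (- 1) y - \<phi> (- M) *\<^sub>R E (- 1) (- M))"
    using N(1) by (intro has_bochner_integral_FTC_Icc prod_deriv cont_f) (auto simp: M_def)
  ultimately have "has_bochner_integral lborel
      (\<lambda>x. indicator {y..M} x *\<^sub>R ?f 1 x + indicator {- M..y} x *\<^sub>R ?f (- 1) x)
      (\<phi> M *\<^sub>R E 1 M - \<phi> y *\<^sub>R E 1 y + (\<phi> y *\<^sub>R E (- 1) y - \<phi> (- M) *\<^sub>R E (- 1) (- M)))"
    by (rule has_bochner_integral_add)
  moreover have "\<phi> M = 0" "\<phi> (- M) = 0" using N by (auto simp: M_def)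
  \<comment> \<open>The diagonal entries cancel at \<open>y\<close>; the off-diagonal ones change
    sign, and the prefactor turns \<open>2 * k\<close> into \<open>\<i>\<close>.\<close>
  moreover have "E (- 1) y - E 1 y = - (\<i> *s (sigma1 *v w))"
    using k_nonzero by (simp add: E_def mat22_vec sigma_mat22 vec_eq_iff forall_2 field_simps)
  ultimately have hbi: "has_bochner_integral lborel
      (\<lambda>x. indicator {y..M} x *\<^sub>R ?f 1 x + indicator {- M..y} x *\<^sub>R ?f (- 1) x) (- (\<phi> y *\<^sub>R (\<i> *s (sigma1 *v w))))"
    by (simp flip: scaleR_diff_right)
  have kernel_E: "kernel (x - y) w = E (if y < x then 1 else - 1) x" if "x \<noteq> y" for x
    using that by (simp add: kernel_def E_def sgn_if right_diff_distrib)
  have ae: "AE x in lborel. indicator {y..M} x *\<^sub>R ?f 1 x + indicator {- M..y} x *\<^sub>R ?f (- 1) x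
      = deriv \<phi> x *\<^sub>R kernel (x - y) w + dirac_rhs (\<phi> x *\<^sub>R kernel (x - y) w)"
    using AE_lborel_singleton[of y]
  proof eventually_elim
    case (elim x)
    consider "M < \<bar>x\<bar>" | "\<bar>x\<bar> \<le> M" "y < x" | "\<bar>x\<bar> \<le> M" "x < y" using elim by linarith
    then show ?case
    proof cases
      case 1
      then have "N \<le> \<bar>x\<bar>" by (simp add: M_def)
      then show ?thesis using N by (simp add: R.zero)
    qed (simp_all add: kernel_E R.scaleR abs_le_iff)
  qed
  have int: "integrable lborel (\<lambda>x. \<psi> x *\<^sub>R kernel (x - y) w)" if "integrable lborel \<psi>" for \<psi>
  proof (rule Bochner_Integration.integrable_bound)
    show "integrable lborel (\<lambda>x. (eta_z * norm w) * \<psi> x)" using that by simp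
    have [measurable]: "\<psi> \<in> borel_measurable lborel" using that by simp
    show "(\<lambda>x. \<psi> x *\<^sub>R kernel (x - y) w) \<in> borel_measurable lborel" by measurable
    show "AE x in lborel. norm (\<psi> x *\<^sub>R kernel (x - y) w) \<le> norm ((eta_z * norm w) * \<psi> x)"
    proof (rule AE_I2)
      fix x
      have "norm (kernel (x - y) w) \<le> eta_z * decay (x - y) * norm w" by (rule norm_kernel_le)
      also have "\<dots> \<le> eta_z * 1 * norm w"
        using Im_k eta_z_nonneg by (intro mult_right_mono mult_left_mono) auto
      finally have "\<bar>\<psi> x\<bar> * norm (kernel (x - y) w) \<le> \<bar>\<psi> x\<bar> * (eta_z * norm w)"
        by (intro mult_left_mono) auto
      then show "norm (\<psi> x *\<^sub>R kernel (x - y) w) \<le> norm ((eta_z * norm w) * \<psi> x)"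
        using eta_z_nonneg by (simp add: abs_mult mult.commute)
    qed
  qed
  note int1 = int[OF integrable_compact_support[OF cont(1) N(2)]]
    and int2 = int[OF integrable_compact_support[OF cont(2) N(3)]]
  have "(LINT x|lborel. deriv \<phi> x *\<^sub>R kernel (x - y) w) + dirac_rhs (LINT x|lborel. \<phi> x *\<^sub>R kernel (x - y) w)
      = (LINT x|lborel. deriv \<phi> x *\<^sub>R kernel (x - y) w + dirac_rhs (\<phi> x *\<^sub>R kernel (x - y) w))"
    using int1 int2 by (simp add: integral_bounded_linear[OF bounded_linear_dirac_rhs]
        integrable_bounded_linear[OF bounded_linear_dirac_rhs])
  also have "\<dots> = (LINT x|lborel. indicator {y..M} x *\<^sub>R ?f 1 x + indicator {- M..y} x *\<^sub>R ?f (- 1) x)"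
  proof (rule integral_cong_AE)
    show "(\<lambda>x. indicator {y..M} x *\<^sub>R ?f 1 x + indicator {- M..y} x *\<^sub>R ?f (- 1) x) \<in> borel_measurable lborel"
      using hbi by (rule borel_measurable_has_bochner_integral)
    show "(\<lambda>x. deriv \<phi> x *\<^sub>R kernel (x - y) w + dirac_rhs (\<phi> x *\<^sub>R kernel (x - y) w)) \<in> borel_measurable lborel"
      using int1 int2 by (intro borel_measurable_add borel_measurable_integrable integrable_bounded_linear[OF bounded_linear_dirac_rhs])
    show "AE x in lborel. deriv \<phi> x *\<^sub>R kernel (x - y) w + dirac_rhs (\<phi> x *\<^sub>R kernel (x - y) w) =
      indicator {y..M} x *\<^sub>R ?f 1 x + indicator {- M..y} x *\<^sub>R ?f (- 1) x"
      using ae by eventually_elim simp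
  qed
  also have "\<dots> = - (\<phi> y *\<^sub>R (\<i> *s (sigma1 *v w)))"
    using hbi by (rule has_bochner_integral_integral_eq)
  finally have "(LINT x|lborel. deriv \<phi> x *\<^sub>R kernel (x - y) w) = - (\<phi> y *\<^sub>R (\<i> *s (sigma1 *v w)))
      - dirac_rhs (LINT x|lborel. \<phi> x *\<^sub>R kernel (x - y) w)"
    by (simp only: eq_diff_eq)
  then show ?thesis by (simp only: minus_diff_commute)
qed

lemma nn_integral_decay: "(\<integral>\<^sup>+y. ennreal (decay (x - y)) \<partial>lborel) = ennreal (2 / Im k)"
  using nn_integral_lborel_reflect[of "\<lambda>t. ennreal (decay t)" x] nn_integral_exp_abs[OF Im_k] by simp

lemma nn_integral_decay': "(\<integral>\<^sup>+x. ennreal (decay (x - y)) \<partial>lborel) = ennreal (2 / Im k)"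
  using nn_integral_decay[of y] by (simp add: abs_minus_commute)

text \<open>The hypothesis of Fubini's theorem. As \<open>H\<close> is merely square-integrable, the
  product of \<open>\<psi> x\<close> and \<open>H y\<close> is bounded by the sum of their squares,
  and \<open>decay\<close> makes each square integrable over the other variable.\<close>

lemma integrable_pair_kernel:
  fixes \<psi> :: "real \<Rightarrow> real"
  assumes cont: "continuous_on UNIV \<psi>" and supp: "\<And>x. N \<le> \<bar>x\<bar> \<Longrightarrow> \<psi> x = 0"
  shows "integrable (lborel \<Otimes>\<^sub>M lborel) (\<lambda>(x, y). \<psi> x *\<^sub>R kernel (x - y) (rep_L2 H y))"
proof (rule integrableI_bounded)
  have [measurable]: "\<psi> \<in> borel_measurable borel"
    using cont by (rule borel_measurable_continuous_onI)
  show "(\<lambda>(x, y). \<psi> x *\<^sub>R kernel (x - y) (rep_L2 H y)) \<in> borel_measurable (lborel \<Otimes>\<^sub>M lborel)"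
    by measurable
  have int: "integrable lborel (\<lambda>x. (\<psi> x)\<^sup>2)"
    using supp by (intro integrable_compact_support[of _ N] continuous_intros cont) auto
  have le: "norm (\<psi> x *\<^sub>R kernel (x - y) (rep_L2 H y)) \<le>
      eta_z * (decay (x - y) * (\<psi> x)\<^sup>2 + decay (x - y) * (norm (rep_L2 H y))\<^sup>2)" for x y
  proof -
    have "norm (\<psi> x *\<^sub>R kernel (x - y) (rep_L2 H y)) \<le> \<bar>\<psi> x\<bar> * (eta_z * decay (x - y) * norm (rep_L2 H y))"
      using norm_kernel_le by (simp add: mult_left_mono)
    also have "\<dots> = eta_z * decay (x - y) * (\<bar>\<psi> x\<bar> * norm (rep_L2 H y))" by simp
    also have "\<dots> \<le> eta_z * decay (x - y) * ((\<psi> x)\<^sup>2 + (norm (rep_L2 H y))\<^sup>2)"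
    proof (rule mult_left_mono)
      have "\<bar>\<psi> x\<bar> * norm (rep_L2 H y) \<le> 2 * \<bar>\<psi> x\<bar> * norm (rep_L2 H y)" by simp
      also have "\<dots> \<le> \<bar>\<psi> x\<bar>\<^sup>2 + (norm (rep_L2 H y))\<^sup>2" by (rule sum_squares_bound)
      finally show "\<bar>\<psi> x\<bar> * norm (rep_L2 H y) \<le> (\<psi> x)\<^sup>2 + (norm (rep_L2 H y))\<^sup>2" by simp
    qed (simp add: eta_z_nonneg)
    finally show ?thesis by (simp add: algebra_simps)
  qed
  have "(\<integral>\<^sup>+p. ennreal (norm (case p of (x, y) \<Rightarrow> \<psi> x *\<^sub>R kernel (x - y) (rep_L2 H y))) \<partial>(lborel \<Otimes>\<^sub>M lborel))
      \<le> (\<integral>\<^sup>+p. ennreal eta_z * (ennreal (decay (fst p - snd p)) * ennreal ((\<psi> (fst p))\<^sup>2)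
           + ennreal (decay (fst p - snd p)) * ennreal ((norm (rep_L2 H (snd p)))\<^sup>2)) \<partial>(lborel \<Otimes>\<^sub>M lborel))"
    using le eta_z_nonneg
    by (intro nn_integral_mono) (auto simp: split_beta ennreal_leI simp flip: ennreal_mult ennreal_plus)
  also have "\<dots> = ennreal eta_z * ((\<integral>\<^sup>+p. ennreal (decay (fst p - snd p)) * ennreal ((\<psi> (fst p))\<^sup>2) \<partial>(lborel \<Otimes>\<^sub>M lborel))
      + (\<integral>\<^sup>+p. ennreal (decay (fst p - snd p)) * ennreal ((norm (rep_L2 H (snd p)))\<^sup>2) \<partial>(lborel \<Otimes>\<^sub>M lborel)))"
    by (subst nn_integral_cmult, measurable, subst nn_integral_add, measurable)
  also have "(\<integral>\<^sup>+p. ennreal (decay (fst p - snd p)) * ennreal ((\<psi> (fst p))\<^sup>2) \<partial>(lborel \<Otimes>\<^sub>M lborel))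
      = (\<integral>\<^sup>+x. (\<integral>\<^sup>+y. ennreal (decay (x - y)) * ennreal ((\<psi> x)\<^sup>2) \<partial>lborel) \<partial>lborel)"
    by (subst lborel.nn_integral_fst[symmetric]) auto
  also have "\<dots> = ennreal (2 / Im k) * (\<integral>\<^sup>+x. ennreal ((\<psi> x)\<^sup>2) \<partial>lborel)"
    by (simp add: nn_integral_multc nn_integral_decay[simplified] nn_integral_cmult)
  also have "(\<integral>\<^sup>+p. ennreal (decay (fst p - snd p)) * ennreal ((norm (rep_L2 H (snd p)))\<^sup>2) \<partial>(lborel \<Otimes>\<^sub>M lborel))
      = (\<integral>\<^sup>+y. (\<integral>\<^sup>+x. ennreal (decay (x - y)) * ennreal ((norm (rep_L2 H y))\<^sup>2) \<partial>lborel) \<partial>lborel)"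
    by (subst lborel_pair.nn_integral_snd[symmetric]) (auto simp: split_beta)
  also have "\<dots> = ennreal (2 / Im k) * ennreal ((norm H)\<^sup>2)"
    by (simp add: nn_integral_multc nn_integral_decay'[simplified] nn_integral_cmult nn_integral_rep_L2)
  also have "ennreal eta_z * (ennreal (2 / Im k) * (\<integral>\<^sup>+x. ennreal ((\<psi> x)\<^sup>2) \<partial>lborel) + ennreal (2 / Im k) * ennreal ((norm H)\<^sup>2)) < \<infinity>"
    using int by (simp add: nn_integral_eq_integral ennreal_mult_less_top)
  finally show "(\<integral>\<^sup>+p. ennreal (norm (case p of (x, y) \<Rightarrow> \<psi> x *\<^sub>R kernel (x - y) (rep_L2 H y))) \<partial>(lborel \<Otimes>\<^sub>M lborel)) < \<infinity>" .
qed

text \<open>Fubini moves the test function onto the kernel at fixed \<open>y\<close>, where the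
  fundamental-solution identity applies; a second use of Fubini restores the convolution.\<close>

lemma weak_derivative_conv:
  assumes U: "AE x in lborel. rep_L2 U x = conv (rep_L2 H) x"
    and U': "AE x in lborel. rep_L2 U' x = \<i> *s (sigma1 *v rep_L2 H x) + dirac_rhs (rep_L2 U x)"
  shows "weak_derivative U U'"
  unfolding weak_derivative_def
proof (intro allI impI)
  fix \<phi> assume \<phi>: "test_function \<phi>"
  obtain N where N: "\<And>x. N \<le> \<bar>x\<bar> \<Longrightarrow> \<phi> x = 0" "\<And>x. N \<le> \<bar>x\<bar> \<Longrightarrow> deriv \<phi> x = 0"
    and cont: "continuous_on UNIV \<phi>" "continuous_on UNIV (deriv \<phi>)"
    using test_functionE[OF \<phi>] by metis
  interpret R: bounded_linear dirac_rhs by (rule bounded_linear_dirac_rhs)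
  let ?h = "rep_L2 H"
  let ?g = "\<lambda>\<psi> y. LINT x|lborel. \<psi> x *\<^sub>R kernel (x - y) (?h y)"
  let ?b = "\<lambda>y. \<phi> y *\<^sub>R (\<i> *s (sigma1 *v ?h y))"
  have pair: "integrable (lborel \<Otimes>\<^sub>M lborel) (\<lambda>(x, y). \<phi> x *\<^sub>R kernel (x - y) (?h y))"
    "integrable (lborel \<Otimes>\<^sub>M lborel) (\<lambda>(x, y). deriv \<phi> x *\<^sub>R kernel (x - y) (?h y))"
    using N by (auto intro: integrable_pair_kernel[OF cont(1)] integrable_pair_kernel[OF cont(2)])
  have conv: "(LINT x|lborel. \<psi> x *\<^sub>R conv ?h x) = (LINT y|lborel. ?g \<psi> y)" "integrable lborel (?g \<psi>)"
    "integrable lborel (\<lambda>x. \<psi> x *\<^sub>R conv ?h x)"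
    if "integrable (lborel \<Otimes>\<^sub>M lborel) (\<lambda>(x, y). \<psi> x *\<^sub>R kernel (x - y) (?h y))" for \<psi>
    using lborel_pair.Fubini_integral[OF that] lborel_pair.integrable_snd[OF that] lborel_pair.integrable_fst[OF that]
    by (simp_all add: conv_def)
  have g: "?g (deriv \<phi>) y = - dirac_rhs (?g \<phi> y) - ?b y" for y
    by (rule integral_test_function_kernel[OF \<phi>])
  have int_g: "integrable lborel (\<lambda>y. dirac_rhs (?g \<phi> y))"
    by (rule integrable_bounded_linear[OF bounded_linear_dirac_rhs conv(2)[OF pair(1)]])
  \<comment> \<open>Solving \<open>g\<close> for \<open>?b\<close> exhibits it as a combination of
    two functions already known to be integrable.\<close>
  have int_b: "integrable lborel ?b"
  proof -
    have "?b = (\<lambda>y. - dirac_rhs (?g \<phi> y) - ?g (deriv \<phi>) y)" unfolding g by simp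
    then show ?thesis using int_g conv(2)[OF pair(2)] by simp
  qed
  have AE_U': "AE x in lborel. rep_L2 U' x = \<i> *s (sigma1 *v ?h x) + dirac_rhs (conv ?h x)"
    using U U' by eventually_elim simp
  have meas: "conv ?h \<in> borel_measurable lborel"
    unfolding conv_def[abs_def] by (rule lborel.borel_measurable_lebesgue_integral) measurable
  have [measurable]: "\<phi> \<in> borel_measurable borel" "deriv \<phi> \<in> borel_measurable borel"
    using cont by (auto intro: borel_measurable_continuous_onI)
  have "(LINT x|lborel. deriv \<phi> x *\<^sub>R rep_L2 U x) = (LINT x|lborel. deriv \<phi> x *\<^sub>R conv ?h x)"
    by (rule integral_cong_AE) (use meas in measurable, use U in eventually_elim, simp)
  also have "\<dots> = (LINT y|lborel. ?g (deriv \<phi>) y)"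
    by (rule conv(1)[OF pair(2)])
  also have "\<dots> = (LINT y|lborel. - dirac_rhs (?g \<phi> y) - ?b y)"
    by (simp only: g)
  also have "\<dots> = - (dirac_rhs (LINT y|lborel. ?g \<phi> y) + (LINT y|lborel. ?b y))"
    using int_g int_b by (simp add: integral_bounded_linear[OF bounded_linear_dirac_rhs conv(2)[OF pair(1)]])
  also have "dirac_rhs (LINT y|lborel. ?g \<phi> y) = (LINT x|lborel. dirac_rhs (\<phi> x *\<^sub>R conv ?h x))"
    unfolding conv(1)[OF pair(1), symmetric]
    by (rule integral_bounded_linear[OF bounded_linear_dirac_rhs conv(3)[OF pair(1)], symmetric])
  also have "\<dots> + (LINT y|lborel. ?b y) = (LINT x|lborel. \<phi> x *\<^sub>R rep_L2 U' x)"
  proof -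
    have int_c: "integrable lborel (\<lambda>x. dirac_rhs (\<phi> x *\<^sub>R conv ?h x))"
      by (rule integrable_bounded_linear[OF bounded_linear_dirac_rhs conv(3)[OF pair(1)]])
    then have "(LINT x|lborel. dirac_rhs (\<phi> x *\<^sub>R conv ?h x)) + (LINT y|lborel. ?b y)
        = (LINT x|lborel. dirac_rhs (\<phi> x *\<^sub>R conv ?h x) + ?b x)"
      using int_b by simp
    also have "\<dots> = (LINT x|lborel. \<phi> x *\<^sub>R rep_L2 U' x)"
      using int_c int_b
      by (intro integral_cong_AE borel_measurable_add borel_measurable_integrable[OF int_c] borel_measurable_integrable[OF int_b])
        (measurable, use AE_U' in eventually_elim, simp add: R.scaleR scaleR_add_right)
    finally show ?thesis .
  qed
  finally show "(LINT x|lborel. deriv \<phi> x *\<^sub>R rep_L2 U x) = - (LINT x|lborel. \<phi> x *\<^sub>R rep_L2 U' x)" .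
qed

text \<open>Schur's test with constant weight 1 and \<open>C = 2 / Im k\<close> puts the convolution
  into the space. Its derivative follows, being a bounded expression in \<open>H\<close> and
  \<open>U\<close>.\<close>

lemma free_dirac_conv:
  obtains U where "AE x in lborel. rep_L2 U x = conv (rep_L2 H) x" "(H, U) \<in> resolvent (free_dirac m) z"
proof -
  have C: "(\<integral>\<^sup>+y. ennreal (decay (x - y) * 1) \<partial>lborel) \<le> ennreal (2 / Im k)" for x
    using nn_integral_decay[of x] by simp
  have h: "AE y in lborel. norm (rep_L2 H y) \<le> sqrt 1 * norm (rep_L2 H y)" by simp
  have meas: "conv (rep_L2 H) \<in> borel_measurable lborel"
    by (rule borel_measurable_conv[where v = "\<lambda>_. 1", OF _ _ _ _ C h]) (use Im_k in auto)
  have le: "(\<integral>\<^sup>+x. ennreal ((norm (conv (rep_L2 H) x))\<^sup>2) \<partial>lborel) \<le> ennreal ((eta_z * (2 / Im k) * norm H)\<^sup>2)"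
    using conv_weighted_L2_le[where v = "\<lambda>_. 1", OF _ _ _ _ C h] Im_k by simp
  obtain U where U: "AE x in lborel. rep_L2 U x = conv (rep_L2 H) x"
    by (rule L2_ex_rep[OF meas le]) (use eta_z_nonneg Im_k in auto)
  have bl: "bounded_linear (\<lambda>v. \<i> *s (sigma1 *v v))"
    by (rule bounded_linear_compose[OF bounded_linear_cvector_smult bounded_linear_matrix_vector_mult])
  define U' where "U' = abs_L2 (\<lambda>x. \<i> *s (sigma1 *v rep_L2 H x) + dirac_rhs (rep_L2 U x))"
  have U': "AE x in lborel. rep_L2 U' x = \<i> *s (sigma1 *v rep_L2 H x) + dirac_rhs (rep_L2 U x)"
    unfolding U'_def
    by (intro AE_rep_abs_L2 square_integrable_add square_integrable_bounded_linear[OF bl]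
        square_integrable_bounded_linear[OF bounded_linear_dirac_rhs] rep_L2_square_integrable)
  have "weak_derivative U U'" using U U' by (rule weak_derivative_conv)
  moreover have "AE x in lborel. rep_L2 (H + z *\<^sub>C U) x =
      (- \<i>) *s (sigma1 *v rep_L2 U' x) + complex_of_real m *s (sigma3 *v rep_L2 U x)"
    using U' AE_rep_L2_add[of H "z *\<^sub>C U"] AE_rep_L2_scaleC[of z U]
    by eventually_elim (simp only: dirac_rhs_equation)
  ultimately have "(H, U) \<in> resolvent (free_dirac m) z"
    unfolding resolvent_mem_iff free_dirac_def by blast
  with U show ?thesis by (rule that)
qed

text \<open>The convolution is one solution. That there is no other follows from the resolvent being
  the graph of a function.\<close>

lemma resolvent_free_dirac_iff:
  assumes "z \<in> resolvent_set (free_dirac m)"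
  shows "(H, W) \<in> resolvent (free_dirac m) z \<longleftrightarrow> (AE x in lborel. rep_L2 W x = conv (rep_L2 H) x)"
proof -
  obtain R where R: "resolvent (free_dirac m) z = {(g, R g) | g. True}"
    using assms unfolding resolvent_set_def by blast
  obtain U where U: "AE x in lborel. rep_L2 U x = conv (rep_L2 H) x" "(H, U) \<in> resolvent (free_dirac m) z"
    by (rule free_dirac_conv)
  then have "(H, W) \<in> resolvent (free_dirac m) z \<longleftrightarrow> W = U"
    unfolding R by auto
  also have "\<dots> \<longleftrightarrow> (AE x in lborel. rep_L2 W x = conv (rep_L2 H) x)"
    unfolding L2_eq_iff
  proof
    assume "AE x in lborel. rep_L2 W x = rep_L2 U x"
    with U(1) show "AE x in lborel. rep_L2 W x = conv (rep_L2 H) x" by eventually_elim simp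
  next
    assume "AE x in lborel. rep_L2 W x = conv (rep_L2 H) x"
    with U(1) show "AE x in lborel. rep_L2 W x = rep_L2 U x" by eventually_elim simp
  qed
  finally show ?thesis .
qed

end

section \<open>The spectrum of the free operator\<close>

lemma norm_L2_le:
  assumes "AE x in lborel. norm (rep_L2 f x) \<le> c * norm (rep_L2 g x)" "0 \<le> c"
  shows "norm f \<le> c * norm g"
proof (rule power2_le_imp_le)
  have "(norm f)\<^sup>2 \<le> (LINT x|lborel. c\<^sup>2 * (norm (rep_L2 g x))\<^sup>2)"
    unfolding norm_L2_power2
  proof (rule integral_mono_AE)
    show "AE x in lborel. (norm (rep_L2 f x))\<^sup>2 \<le> c\<^sup>2 * (norm (rep_L2 g x))\<^sup>2"
      using assms(1) by eventually_elim (metis norm_ge_zero power_mono power_mult_distrib)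
  qed (use rep_L2_square_integrable in \<open>auto simp: square_integrable_def\<close>)
  then show "(norm f)\<^sup>2 \<le> (c * norm g)\<^sup>2"
    by (simp add: norm_L2_power2 power_mult_distrib)
qed (simp add: assms)

lemma weak_derivative_C1:
  fixes u u' :: "real \<Rightarrow> complex ^ 2"
  assumes D: "\<And>x. (u has_vector_derivative u' x) (at x)" and cont': "continuous_on UNIV u'"
    and U: "AE x in lborel. rep_L2 U x = u x" and U': "AE x in lborel. rep_L2 U' x = u' x"
  shows "weak_derivative U U'"
  unfolding weak_derivative_def
proof (intro allI impI)
  fix \<phi> assume \<phi>: "test_function \<phi>"
  obtain N where N: "0 < N" "\<And>x. N \<le> \<bar>x\<bar> \<Longrightarrow> \<phi> x = 0" "\<And>x. N \<le> \<bar>x\<bar> \<Longrightarrow> deriv \<phi> x = 0"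
    and d\<phi>: "\<And>x. (\<phi> has_real_derivative deriv \<phi> x) (at x)"
    and cont\<phi>: "continuous_on UNIV \<phi>" "continuous_on UNIV (deriv \<phi>)"
    using test_functionE[OF \<phi>] by blast
  have cont: "continuous_on UNIV u"
    using D by (meson continuous_on_vector_derivative has_vector_derivative_at_within)
  have [measurable]: "\<phi> \<in> borel_measurable borel" "deriv \<phi> \<in> borel_measurable borel"
      "u \<in> borel_measurable borel" "u' \<in> borel_measurable borel"
    using cont\<phi> cont cont' by (auto intro: borel_measurable_continuous_onI)
  let ?f = "\<lambda>x. deriv \<phi> x *\<^sub>R u x + \<phi> x *\<^sub>R u' x"
  have prod_deriv: "((\<lambda>x. \<phi> x *\<^sub>R u x) has_vector_derivative ?f x) (at x within S)" for x S
    using has_vector_derivative_scaleR[OF has_field_derivative_at_within[OF d\<phi>] has_vector_derivative_at_within[OF D]]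
    by (simp add: add.commute)
  have "has_bochner_integral lborel (\<lambda>x. indicator {- N..N} x *\<^sub>R ?f x) (\<phi> N *\<^sub>R u N - \<phi> (- N) *\<^sub>R u (- N))"
    using N(1) by (intro has_bochner_integral_FTC_Icc prod_deriv)
      (auto intro!: continuous_intros continuous_on_subset[OF cont] continuous_on_subset[OF cont']
        continuous_on_subset[OF cont\<phi>(1)] continuous_on_subset[OF cont\<phi>(2)])
  also have "(\<lambda>x. indicator {- N..N} x *\<^sub>R ?f x) = ?f"
    using N by (force simp: indicator_def fun_eq_iff abs_le_iff)
  also have "\<phi> N *\<^sub>R u N - \<phi> (- N) *\<^sub>R u (- N) = 0" using N by simp
  finally have hbi: "has_bochner_integral lborel ?f 0" .
  have int: "integrable lborel (\<lambda>x. deriv \<phi> x *\<^sub>R u x)" "integrable lborel (\<lambda>x. \<phi> x *\<^sub>R u' x)"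
    using N by (auto intro!: integrable_compact_support[where N = N] continuous_intros cont cont' cont\<phi>)
  have "(LINT x|lborel. deriv \<phi> x *\<^sub>R u x) + (LINT x|lborel. \<phi> x *\<^sub>R u' x) = 0"
    using has_bochner_integral_integral_eq[OF hbi] int by simp
  moreover have "(LINT x|lborel. deriv \<phi> x *\<^sub>R rep_L2 U x) = (LINT x|lborel. deriv \<phi> x *\<^sub>R u x)"
    by (rule integral_cong_AE, measurable) (use U in eventually_elim, simp)
  moreover have "(LINT x|lborel. \<phi> x *\<^sub>R rep_L2 U' x) = (LINT x|lborel. \<phi> x *\<^sub>R u' x)"
    by (rule integral_cong_AE, measurable) (use U' in eventually_elim, simp)
  ultimately show "(LINT x|lborel. deriv \<phi> x *\<^sub>R rep_L2 U x) = - (LINT x|lborel. \<phi> x *\<^sub>R rep_L2 U' x)"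
    by (simp add: eq_neg_iff_add_eq_0)
qed

lemma square_integrable_lorentzian_bound:
  fixes u :: "real \<Rightarrow> complex ^ 2"
  assumes "\<epsilon> > 0" and [measurable]: "u \<in> borel_measurable lborel"
    and le: "\<And>x. norm (u x) \<le> c / (1 + (\<epsilon> * x)\<^sup>2)"
  shows "square_integrable u"
proof -
  have "integrable lborel (\<lambda>x. 1 / (1 + (0 + \<epsilon> * x)\<^sup>2))"
    using assms(1) by (intro lborel_integrable_real_affine integrable_inverse_1_plus_x2) simp
  then have "integrable lborel (\<lambda>x. 1 / (1 + (\<epsilon> * x)\<^sup>2))" by simp
  then have int: "integrable lborel (\<lambda>x. c\<^sup>2 * (1 / (1 + (\<epsilon> * x)\<^sup>2)))" by (rule integrable_mult_right)
  have "integrable lborel (\<lambda>x. (norm (u x))\<^sup>2)"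
  proof (rule Bochner_Integration.integrable_bound[OF int])
    show "AE x in lborel. norm ((norm (u x))\<^sup>2) \<le> norm (c\<^sup>2 * (1 / (1 + (\<epsilon> * x)\<^sup>2)))"
    proof (rule AE_I2)
      fix x
      define t where "t = 1 / (1 + (\<epsilon> * x)\<^sup>2)"
      have t: "0 \<le> t" "t \<le> 1" by (simp_all add: t_def divide_le_eq_1 add_pos_nonneg)
      have "(norm (u x))\<^sup>2 \<le> (c * t)\<^sup>2" using le[of x] by (intro power_mono) (auto simp: t_def)
      also have "\<dots> = c\<^sup>2 * (t * t)" by (simp add: power2_eq_square)
      also have "\<dots> \<le> c\<^sup>2 * t" using t by (intro mult_left_mono mult_left_le) auto
      finally show "norm ((norm (u x))\<^sup>2) \<le> norm (c\<^sup>2 * (1 / (1 + (\<epsilon> * x)\<^sup>2)))"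
        using t by (simp add: t_def[symmetric] abs_mult)
    qed
  qed measurable
  then show ?thesis by (simp add: square_integrable_def)
qed

text \<open>
  Approximate eigenfunctions: a plane wave times a cutoff \<open>\<rho>\<close> with \<open>\<bar>\<rho>'\<bar> \<le> \<epsilon> \<rho>\<close> pointwise.
\<close>

lemma plane_wave_not_in_resolvent_set:
  fixes m k :: real and z :: complex
  assumes k: "(complex_of_real k)\<^sup>2 = z\<^sup>2 - (complex_of_real m)\<^sup>2"
  shows "z \<notin> resolvent_set (free_dirac m)"
proof
  assume "z \<in> resolvent_set (free_dirac m)"
  then obtain R where R: "bounded_linear R" "resolvent (free_dirac m) z = {(g, R g) | g. True}"
    unfolding resolvent_set_def by blast
  obtain K where K: "\<And>g. norm (R g) \<le> norm g * K" "K > 0"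
    using bounded_linear.pos_bounded[OF R(1)] by blast
  \<comment> \<open>An eigenvector of the symbol \<open>k sigma1 + m sigma3\<close>. The vector
    \<open>(z + m, k)\<close> vanishes exactly when \<open>z = - m\<close>; then
    \<open>k = 0\<close> and the second basis vector serves.\<close>
  obtain c :: "complex ^ 2" where c: "c \<noteq> 0"
    and eig: "complex_of_real k *s (sigma1 *v c) + complex_of_real m *s (sigma3 *v c) = z *s c"
  proof (cases "z + m = 0")
    case True
    then have "z = - m" by (simp add: eq_neg_iff_add_eq_0)
    then have "k = 0" using k by simp
    with \<open>z = - m\<close> show ?thesis
      by (intro that[of "vector [0, 1]"]) (simp_all add: vec_eq_iff forall_2 sigma_mat22 mat22_vec)
  next
    case False
    have "k * k = (z - m) * (z + m)" using k by (simp add: power2_eq_square algebra_simps)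
    with False show ?thesis
      by (intro that[of "vector [z + m, of_real k]"])
        (simp_all add: vec_eq_iff forall_2 sigma_mat22 mat22_vec algebra_simps)
  qed
  \<comment> \<open>Chosen so that the bound \<open>K\<close> on the resolvent yields
    \<open>norm U \<le> norm U / 2\<close>.\<close>
  define \<epsilon> where "\<epsilon> = 1 / (2 * K)"
  have \<epsilon>: "\<epsilon> > 0" using K by (simp add: \<epsilon>_def)
  \<comment> \<open>By Gronwall's inequality no nonzero cutoff of compact support has
    \<open>\<bar>\<rho>'\<bar> \<le> \<epsilon> \<rho>\<close>. This profile does, because \<open>2
    * \<bar>\<epsilon> * x\<bar> \<le> 1 + (\<epsilon> * x)\<^sup>2\<close>.\<close>
  define \<rho> where "\<rho> x = 1 / (1 + (\<epsilon> * x)\<^sup>2)" for x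
  define \<rho>' where "\<rho>' x = - (2 * \<epsilon>\<^sup>2 * x) / (1 + (\<epsilon> * x)\<^sup>2)\<^sup>2" for x
  have pos: "1 + (\<epsilon> * x)\<^sup>2 > 0" for x by (simp add: add_pos_nonneg)
  have \<rho>_pos: "\<rho> x > 0" for x using pos by (simp add: \<rho>_def)
  have D\<rho>: "(\<rho> has_real_derivative \<rho>' x) (at x)" for x
    unfolding \<rho>_def[abs_def] \<rho>'_def using pos[of x]
    by (auto intro!: derivative_eq_intros simp: power2_eq_square)
  have \<rho>'_le: "\<bar>\<rho>' x\<bar> \<le> \<epsilon> * \<rho> x" for x
  proof -
    have "2 * \<bar>\<epsilon> * x\<bar> \<le> 1 + (\<epsilon> * x)\<^sup>2"
      using sum_squares_bound[of 1 "\<bar>\<epsilon> * x\<bar>"] by simp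
    then have "\<epsilon> * (2 * \<bar>\<epsilon> * x\<bar>) / (1 + (\<epsilon> * x)\<^sup>2)\<^sup>2 \<le> \<epsilon> * (1 + (\<epsilon> * x)\<^sup>2) / (1 + (\<epsilon> * x)\<^sup>2)\<^sup>2"
      using \<epsilon> by (intro divide_right_mono mult_left_mono) auto
    also have "\<dots> = \<epsilon> * \<rho> x" using pos[of x] by (simp add: \<rho>_def power2_eq_square)
    also have "\<epsilon> * (2 * \<bar>\<epsilon> * x\<bar>) / (1 + (\<epsilon> * x)\<^sup>2)\<^sup>2 = \<bar>\<rho>' x\<bar>"
      using \<epsilon> pos[of x] by (simp add: \<rho>'_def abs_mult power2_eq_square)
    finally show ?thesis .
  qed
  have cont: "continuous_on S \<rho>" "continuous_on S \<rho>'" for S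
    unfolding \<rho>_def[abs_def] \<rho>'_def[abs_def] using pos
    by (intro continuous_intros; metis less_irrefl power_eq_0_iff)+
  define e where "e x = exp (\<i> * of_real k * of_real x) *s c" for x :: real
  have De: "(e has_vector_derivative (\<i> * of_real k) *s e x) (at x within S)" for x S
  proof -
    have "((\<lambda>x. exp (\<i> * of_real k * of_real x)) has_vector_derivative
        (\<i> * of_real k) * exp (\<i> * of_real k * of_real x)) (at x within S)"
      by (rule has_vector_derivative_real_field[where f = "\<lambda>u. exp (\<i> * of_real k * u)"])
        (auto intro!: derivative_eq_intros)
    from bounded_linear.has_vector_derivative[OF bounded_linear_cvector_smult_left this, of c]
    show ?thesis by (simp add: e_def[abs_def] vector_smult_assoc)
  qed
  have norm_e: "norm (e x) = norm c" for x by (simp add: e_def norm_cvector_smult)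
  have cont_e: "continuous_on S e" for S
    using De by (meson continuous_on_vector_derivative)
  define u where "u x = \<rho> x *\<^sub>R e x" for x
  define u' where "u' x = \<rho>' x *\<^sub>R e x + \<rho> x *\<^sub>R ((\<i> * of_real k) *s e x)" for x
  have Du: "(u has_vector_derivative u' x) (at x)" for x
    using has_vector_derivative_scaleR[OF D\<rho>[of x] De[of x UNIV]]
    by (simp add: u_def[abs_def] u'_def add.commute)
  have cont_u: "continuous_on UNIV u" "continuous_on UNIV u'"
    unfolding u_def[abs_def] u'_def[abs_def]
    by (intro continuous_intros cont cont_e bounded_linear.continuous_on[OF bounded_linear_cvector_smult])+
  \<comment> \<open>The value of the free operator minus \<open>z\<close> at \<open>u\<close>: by
    \<open>eig\<close> the plane wave is annihilated, so only the derivative of the cutoff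
    survives.\<close>
  define g where "g x = (- \<i>) *s (sigma1 *v (\<rho>' x *\<^sub>R e x))" for x
  have cont_g: "continuous_on UNIV g"
    unfolding g_def[abs_def]
    by (intro continuous_intros cont cont_e bounded_linear.continuous_on[OF bounded_linear_cvector_smult]
        bounded_linear.continuous_on[OF bounded_linear_matrix_vector_mult])
  have norm_sigma1: "norm (sigma1 *v v) = norm v" for v
    by (rule power2_eq_imp_eq) (simp_all add: norm_cvec2 sigma_mat22 mat22_vec add.commute)
  have norm_u: "norm (u x) = \<rho> x * norm c" for x
    using \<rho>_pos[of x] by (simp add: u_def norm_e less_imp_le)
  have norm_g: "norm (g x) \<le> \<epsilon> * norm (u x)" for x
    using \<rho>'_le[of x] by (simp add: g_def norm_cvector_smult norm_sigma1 norm_u norm_e mult_right_mono flip: mult.assoc)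
  have norm_u': "norm (u' x) \<le> (\<epsilon> + \<bar>k\<bar>) * norm (u x)" for x
  proof -
    have "norm (u' x) \<le> \<bar>\<rho>' x\<bar> * norm c + \<bar>k\<bar> * (\<rho> x * norm c)"
      using norm_triangle_ineq[of "\<rho>' x *\<^sub>R e x" "\<rho> x *\<^sub>R ((\<i> * of_real k) *s e x)"] \<rho>_pos[of x]
      by (simp add: u'_def norm_e norm_cvector_smult norm_mult less_imp_le mult.left_commute)
    also have "\<dots> \<le> \<epsilon> * \<rho> x * norm c + \<bar>k\<bar> * (\<rho> x * norm c)"
      using \<rho>'_le[of x] by (intro add_right_mono mult_right_mono) auto
    finally show ?thesis by (simp add: norm_u algebra_simps)
  qed
  have sq: "square_integrable f" if "continuous_on UNIV f" "\<And>x. norm (f x) \<le> C * norm (u x)" for f C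
  proof (rule square_integrable_lorentzian_bound[OF \<epsilon>])
    show "f \<in> borel_measurable lborel" using borel_measurable_continuous_onI[OF that(1)] by simp
    show "norm (f x) \<le> (C * norm c) / (1 + (\<epsilon> * x)\<^sup>2)" for x
      using that(2)[of x] by (simp add: norm_u \<rho>_def mult.commute)
  qed
  define U U' G where "U = abs_L2 u" and "U' = abs_L2 u'" and "G = abs_L2 g"
  have U: "AE x in lborel. rep_L2 U x = u x"
    unfolding U_def by (rule AE_rep_abs_L2, rule sq[where C = 1]) (use cont_u in auto)
  have U': "AE x in lborel. rep_L2 U' x = u' x"
    unfolding U'_def by (rule AE_rep_abs_L2, rule sq[OF _ norm_u']) (rule cont_u)
  have G: "AE x in lborel. rep_L2 G x = g x"
    unfolding G_def by (rule AE_rep_abs_L2, rule sq[OF _ norm_g]) (rule cont_g)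
  have "weak_derivative U U'" using Du cont_u(2) U U' by (rule weak_derivative_C1)
  moreover have "AE x in lborel. rep_L2 (G + z *\<^sub>C U) x =
      (- \<i>) *s (sigma1 *v rep_L2 U' x) + complex_of_real m *s (sigma3 *v rep_L2 U x)"
    using U U' G AE_rep_L2_add[of G "z *\<^sub>C U"] AE_rep_L2_scaleC[of z U]
  proof eventually_elim
    case (elim x)
    have k1: "k * c $ 2 + m * c $ 1 = z * c $ 1" "k * c $ 1 - m * c $ 2 = z * c $ 2"
      using eig by (simp_all add: vec_eq_iff forall_2 sigma_mat22 mat22_vec)
    define E where "E = exp (\<i> * of_real k * of_real x)"
    have e: "e x = E *s c" by (simp add: e_def E_def)
    have "g x + z *s u x = (- \<i>) *s (sigma1 *v u' x) + complex_of_real m *s (sigma3 *v u x)"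
    proof -
      have "\<i> * \<i> = -1" by simp
      with k1 have rows:
        "(- \<i>) * (r' * (E * c $ 2)) + z * (r * (E * c $ 1)) =
          (- \<i>) * (r' * (E * c $ 2) + r * ((\<i> * of_real k) * (E * c $ 2))) + of_real m * (r * (E * c $ 1))"
        "(- \<i>) * (r' * (E * c $ 1)) + z * (r * (E * c $ 2)) =
          (- \<i>) * (r' * (E * c $ 1) + r * ((\<i> * of_real k) * (E * c $ 1))) - of_real m * (r * (E * c $ 2))"
        for r r' by algebra+
      have scale: "a *\<^sub>R v = complex_of_real a *s v" for a and v :: "complex ^ 2"
        by (simp add: vec_eq_iff) (simp add: scaleR_conv_of_real)
      show ?thesis
        unfolding g_def u_def u'_def e sigma_mat22 mat22_vec vec_eq_iff forall_2 scale
        using rows[of "of_real (\<rho>' x)" "of_real (\<rho> x)"] by (simp add: mult.assoc)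
    qed
    then show ?case using elim by simp
  qed
  ultimately have "(G, U) \<in> resolvent (free_dirac m) z"
    unfolding resolvent_mem_iff free_dirac_def by blast
  then have "U = R G" unfolding R(2) by blast
  have "norm G \<le> \<epsilon> * norm U"
    by (rule norm_L2_le[OF _ less_imp_le[OF \<epsilon>]]) (use U G in eventually_elim, simp add: norm_g)
  then have "K * norm G \<le> K * (\<epsilon> * norm U)" using K by simp
  also have "\<dots> = norm U / 2" using K by (simp add: \<epsilon>_def)
  finally have "norm G * K \<le> norm U / 2" by (simp only: mult.commute)
  then have "norm U \<le> norm U / 2" using K(1)[of G] unfolding \<open>U = R G\<close> by linarith
  then have "norm U = 0" using norm_ge_zero[of U] by linarith
  then have "U = 0" by simp
  have "AE x in lborel. u x = 0"
    using U AE_rep_L2_zero unfolding \<open>U = 0\<close> by eventually_elim simp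
  then have "AE x :: real in lborel. False"
    by eventually_elim (use norm_u \<rho>_pos c in \<open>metis less_irrefl mult_pos_pos norm_zero zero_less_norm_iff\<close>)
  then show False using ae_filter_eq_bot_iff[of "lborel :: real measure"] by (simp add: trivial_limit_def)
qed

text \<open>A real root would give plane waves and exclude \<open>z\<close> from the resolvent set.
  The two roots are therefore non-real and opposite, so exactly one lies in the upper half-plane and
  the description in \<open>sqrt_upper\<close> is meaningful.\<close>

lemma free_resolvent_kernel_sqrt_upper:
  assumes "z \<in> resolvent_set (free_dirac m)"
  shows "free_resolvent_kernel m z (sqrt_upper m z)"
proof -
  let ?P = "\<lambda>w. w\<^sup>2 = z\<^sup>2 - (complex_of_real m)\<^sup>2 \<and> Im w > 0"
  define w where "w = csqrt (z\<^sup>2 - (complex_of_real m)\<^sup>2)"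
  have w: "w\<^sup>2 = z\<^sup>2 - (complex_of_real m)\<^sup>2" by (simp add: w_def)
  have "Im w \<noteq> 0"
  proof
    assume "Im w = 0"
    then have "w = complex_of_real (Re w)" by (simp add: complex_eq_iff)
    then show False using plane_wave_not_in_resolvent_set w assms by metis
  qed
  then have "?P (if Im w > 0 then w else - w)" using w by simp
  then obtain v where v: "?P v" by blast
  moreover have "v' = v" if "?P v'" for v'
  proof -
    have "v' = v \<or> v' = - v" using that v by (metis power2_eq_iff)
    then show ?thesis using that v by auto
  qed
  ultimately have "?P (sqrt_upper m z)" unfolding sqrt_upper_def by (rule theI)
  then show ?thesis by (simp add: free_resolvent_kernel_def)
qed

section \<open>The Birman--Schwinger operator\<close>

lemma mult_op_cong_AE:
  assumes "AE x in lborel. M x = N x"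
  shows "mult_op M = mult_op N"
proof -
  have "(AE x in lborel. rep_L2 g x = M x *v rep_L2 f x) \<longleftrightarrow> (AE x in lborel. rep_L2 g x = N x *v rep_L2 f x)" for f g
    by (rule eventually_cong[OF assms]) simp
  then show ?thesis by (simp add: mult_op_def)
qed

text \<open>Allows the Lebesgue measurable potential to be replaced by a Borel measurable
  one.\<close>

lemma Q_op_cong_AE:
  assumes "AE x in lborel. V x = V' x"
  shows "Q_op m V z = Q_op m V' z"
proof -
  have "A_op V = A_op V'" "B_op V = B_op V'"
    unfolding A_op_def B_op_def
    by (rule mult_op_cong_AE, use assms in eventually_elim, simp)+
  then show ?thesis by (simp add: Q_op_def)
qed

text \<open>\<open>v\<close> is real-valued, so the sets \<open>{x. v x \<le> real n}\<close>
  exhaust the line and dominated convergence removes the tail. With \<open>v\<close> the norm of the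
  potential, the truncations lie in the domain of \<open>B\<close>.\<close>

lemma L2_truncate_tendsto:
  fixes v :: "real \<Rightarrow> real"
  assumes [measurable]: "v \<in> borel_measurable lborel"
    and g: "\<And>n. AE x in lborel. rep_L2 (g n) x = (if v x \<le> real n then rep_L2 f x else 0)"
  shows "g \<longlonglongrightarrow> f"
proof -
  have int: "integrable lborel (\<lambda>x. (norm (rep_L2 f x))\<^sup>2)"
    using rep_L2_square_integrable[of f] by (simp add: square_integrable_def)
  have "(\<lambda>n. LINT x|lborel. (if v x \<le> real n then 0 else (norm (rep_L2 f x))\<^sup>2)) \<longlonglongrightarrow> (LINT x|(lborel :: real measure). 0)"
  proof (rule integral_dominated_convergence[OF _ _ int])
    have "(\<lambda>n. if v x \<le> real n then 0 else (norm (rep_L2 f x))\<^sup>2) \<longlonglongrightarrow> 0" for x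
    proof (rule tendsto_eventually)
      obtain N where "v x \<le> real N" using real_arch_simple by blast
      then show "\<forall>\<^sub>F n in sequentially. (if v x \<le> real n then 0 else (norm (rep_L2 f x))\<^sup>2) = 0"
        by (auto simp: eventually_sequentially intro!: exI[of _ N])
    qed
    then show "AE x in lborel. (\<lambda>n. if v x \<le> real n then 0 else (norm (rep_L2 f x))\<^sup>2) \<longlonglongrightarrow> 0" by simp
  qed auto
  moreover have "(norm (g n - f))\<^sup>2 = (LINT x|lborel. (if v x \<le> real n then 0 else (norm (rep_L2 f x))\<^sup>2))" for n
    unfolding norm_L2_power2
    by (rule integral_cong_AE, measurable)
      (use g[of n] AE_rep_L2_diff[of "g n" f] in eventually_elim, simp)
  ultimately have "(\<lambda>n. (norm (g n - f))\<^sup>2) \<longlonglongrightarrow> 0" by simp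
  then have "(\<lambda>n. sqrt ((norm (g n - f))\<^sup>2)) \<longlonglongrightarrow> sqrt 0" by (rule tendsto_real_sqrt)
  then show ?thesis
    by (simp add: LIM_zero_iff tendsto_norm_zero_iff)
qed

context free_resolvent_kernel begin

lemma conv_cong_AE:
  assumes [measurable]: "h \<in> borel_measurable lborel" "h' \<in> borel_measurable lborel"
    and "AE y in lborel. h y = h' y"
  shows "conv h x = conv h' x"
  unfolding conv_def by (rule integral_cong_AE, measurable) (use assms(3) in eventually_elim, simp)

text \<open>\<open>Q\<close> is defined directly by \<open>A x *v conv (h F) x\<close>, which
  Schur's test controls for every \<open>F\<close>. The composition in \<open>Q_op\<close> is
  contained in the graph of \<open>Q\<close>, which is closed by continuity, and contains the pairs
  belonging to truncated functions; hence its closure is the whole graph.\<close>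

lemma Q_op_eq_graph:
  assumes z: "z \<in> resolvent_set (free_dirac m)"
    and V [measurable]: "V \<in> borel_measurable lborel"
    and C: "0 \<le> C" "\<And>x. (\<integral>\<^sup>+y. ennreal (decay (x - y) * onorm ((*v) (V y))) \<partial>lborel) \<le> ennreal C"
  obtains Q where "bounded_linear Q" "\<And>F. norm (Q F) \<le> eta_z * C * norm F"
    "Q_op m V z = {(F, Q F) | F. True}"
proof -
  define A where "A x = matrix_sqrt (matrix_abs (V x))" for x
  define B where "B x = matrix_phase (V x) ** matrix_sqrt (matrix_abs (V x))" for x
  define v where "v x = onorm ((*v) (V x))" for x
  have [measurable]: "A \<in> borel_measurable lborel" "B \<in> borel_measurable lborel" "v \<in> borel_measurable lborel"
    unfolding A_def[abs_def] B_def[abs_def] v_def[abs_def] by measurable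
  have v0: "0 \<le> v x" for x
    by (simp add: v_def onorm_pos_le bounded_linear_matrix_vector_mult)
  have A_le: "norm (A x *v w) \<le> sqrt (v x) * norm w" and B_le: "norm (B x *v w) \<le> sqrt (v x) * norm w" for x w
    unfolding A_def B_def v_def by (rule norm_sqrt_abs_vec_le norm_phase_sqrt_abs_vec_le)+
  define h where "h F y = B y *v rep_L2 F y" for F y
  have h_meas [measurable]: "h F \<in> borel_measurable lborel" for F
    unfolding h_def[abs_def] by measurable
  have h_le: "AE y in lborel. norm (h F y) \<le> sqrt (v y) * norm (rep_L2 F y)" for F
    by (simp add: h_def B_le)
  have vC: "(\<integral>\<^sup>+y. ennreal (decay (x - y) * v y) \<partial>lborel) \<le> ennreal C" for x
    using C(2)[of x] by (simp add: v_def)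
  have int_h: "integrable lborel (\<lambda>y. kernel (x - y) (h F y))" for x F
    by (rule integrable_kernel[where v = v, OF _ _ v0 C(1) vC h_le]) measurable
  have conv_meas [measurable]: "conv (h F) \<in> borel_measurable lborel" for F
    by (rule borel_measurable_conv[where v = v, OF _ _ v0 C(1) vC h_le]) measurable
  have "\<exists>G. (AE x in lborel. rep_L2 G x = A x *v conv (h F) x) \<and> norm G \<le> eta_z * C * norm F" for F
  proof -
    have meas: "(\<lambda>x. A x *v conv (h F) x) \<in> borel_measurable lborel" by measurable
    have "(\<integral>\<^sup>+x. ennreal ((norm (A x *v conv (h F) x))\<^sup>2) \<partial>lborel) \<le> (\<integral>\<^sup>+x. ennreal (v x * (norm (conv (h F) x))\<^sup>2) \<partial>lborel)"
    proof (intro nn_integral_mono ennreal_leI)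
      fix x
      have "(norm (A x *v conv (h F) x))\<^sup>2 \<le> (sqrt (v x) * norm (conv (h F) x))\<^sup>2"
        by (intro power_mono A_le) simp
      then show "(norm (A x *v conv (h F) x))\<^sup>2 \<le> v x * (norm (conv (h F) x))\<^sup>2"
        using v0 by (simp add: power_mult_distrib)
    qed
    also have "\<dots> \<le> ennreal ((eta_z * C * norm F)\<^sup>2)"
      by (rule conv_weighted_L2_le[where v = v, OF _ _ v0 C(1) vC h_le]) measurable
    finally have le: "(\<integral>\<^sup>+x. ennreal ((norm (A x *v conv (h F) x))\<^sup>2) \<partial>lborel) \<le> ennreal ((eta_z * C * norm F)\<^sup>2)" .
    obtain G where "AE x in lborel. rep_L2 G x = A x *v conv (h F) x" "norm G \<le> eta_z * C * norm F"
      by (rule L2_ex_rep[OF meas le]) (use eta_z_nonneg C in auto)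
    then show ?thesis by blast
  qed
  then obtain Q where Q: "\<And>F. AE x in lborel. rep_L2 (Q F) x = A x *v conv (h F) x"
    and norm_Q: "\<And>F. norm (Q F) \<le> eta_z * C * norm F"
    by metis
  have bl: "bounded_linear Q"
  proof (rule bounded_linear_intro[where K = "eta_z * C"])
    show "Q (F + G) = Q F + Q G" for F G
    proof -
      have "AE y in lborel. h (F + G) y = h F y + h G y"
        using AE_rep_L2_add[of F G] by eventually_elim (simp add: h_def matrix_vector_right_distrib)
      then have "conv (h (F + G)) x = conv (\<lambda>y. h F y + h G y) x" for x
        by (intro conv_cong_AE) measurable
      then have *: "conv (h (F + G)) x = conv (h F) x + conv (h G) x" for x
        using int_h by (simp add: conv_def linear_add[OF bounded_linear.linear[OF bounded_linear_kernel]])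
      show ?thesis
        unfolding L2_eq_iff
        using Q[of "F + G"] Q[of F] Q[of G] AE_rep_L2_add[of "Q F" "Q G"]
        by eventually_elim (simp add: * matrix_vector_right_distrib)
    qed
    show "Q (r *\<^sub>R F) = r *\<^sub>R Q F" for r F
    proof -
      note lin = linear_scale[OF bounded_linear.linear[OF bounded_linear_matrix_vector_mult]]
      have "AE y in lborel. h (r *\<^sub>R F) y = r *\<^sub>R h F y"
        using AE_rep_L2_scaleR[of r F] by eventually_elim (simp add: h_def lin)
      then have "conv (h (r *\<^sub>R F)) x = conv (\<lambda>y. r *\<^sub>R h F y) x" for x
        by (intro conv_cong_AE) measurable
      then have *: "conv (h (r *\<^sub>R F)) x = r *\<^sub>R conv (h F) x" for x
        by (simp add: conv_def linear_scale[OF bounded_linear.linear[OF bounded_linear_kernel]])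
      show ?thesis
        unfolding L2_eq_iff
        using Q[of "r *\<^sub>R F"] Q[of F] AE_rep_L2_scaleR[of r "Q F"]
        by eventually_elim (simp add: * lin)
    qed
    show "norm (Q F) \<le> norm F * (eta_z * C)" for F
      using norm_Q[of F] by (simp add: mult.commute)
  qed
  define T where "T = op_comp (A_op V) (op_comp (resolvent (free_dirac m) z) (B_op V))"
  have T_iff: "(F, G) \<in> T \<longleftrightarrow> (\<exists>H W. (AE x in lborel. rep_L2 H x = h F x) \<and>
      (AE x in lborel. rep_L2 W x = conv (rep_L2 H) x) \<and> (AE x in lborel. rep_L2 G x = A x *v rep_L2 W x))" for F G
    unfolding T_def op_comp_def A_op_def B_op_def mult_op_def relcomp_unfold h_def A_def B_def
    using resolvent_free_dirac_iff[OF z] by blast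
  have T_Q: "G = Q F" if FG: "(F, G) \<in> T" for F G
  proof -
    obtain H W where HW: "AE x in lborel. rep_L2 H x = h F x"
      "AE x in lborel. rep_L2 W x = conv (rep_L2 H) x" "AE x in lborel. rep_L2 G x = A x *v rep_L2 W x"
      using FG unfolding T_iff by blast
    have conv_eq: "conv (rep_L2 H) x = conv (h F) x" for x
      using HW(1) by (intro conv_cong_AE) auto
    show ?thesis
      unfolding L2_eq_iff using HW(2,3) Q[of F] by eventually_elim (simp add: conv_eq)
  qed
  have closed: "closed {(F, Q F) | F. True}"
  proof -
    have "closed {p. snd p = Q (fst p)}"
      by (intro closed_Collect_eq continuous_intros bounded_linear.continuous_on[OF bl])
    also have "{p. snd p = Q (fst p)} = {(F, Q F) | F. True}" by auto
    finally show ?thesis .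
  qed
  have dense: "(F, Q F) \<in> closure T" for F
  proof -
    \<comment> \<open>On the set where \<open>v x \<le> real n\<close>, multiplication by
      \<open>B\<close> is bounded by \<open>sqrt (real n)\<close>; so the truncation is mapped into
      the space and every factor of the composition applies to it.\<close>
    have "\<exists>G. (AE x in lborel. rep_L2 G x = (if v x \<le> real n then rep_L2 F x else 0)) \<and> (G, Q G) \<in> T" for n
    proof -
      have "(\<integral>\<^sup>+x. ennreal ((norm (if v x \<le> real n then rep_L2 F x else 0))\<^sup>2) \<partial>lborel) \<le> (\<integral>\<^sup>+x. ennreal ((norm (rep_L2 F x))\<^sup>2) \<partial>lborel)"
        by (rule nn_integral_mono) auto
      also have "\<dots> = ennreal ((norm F)\<^sup>2)" by (rule nn_integral_rep_L2)
      finally obtain G where G: "AE x in lborel. rep_L2 G x = (if v x \<le> real n then rep_L2 F x else 0)"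
        by (rule L2_ex_rep[rotated]) auto
      have "(\<integral>\<^sup>+x. ennreal ((norm (h G x))\<^sup>2) \<partial>lborel) \<le> (\<integral>\<^sup>+x. ennreal (real n) * ennreal ((norm (rep_L2 F x))\<^sup>2) \<partial>lborel)"
      proof (rule nn_integral_mono_AE, use G in eventually_elim)
        fix x assume Gx: "rep_L2 G x = (if v x \<le> real n then rep_L2 F x else 0)"
        have "(norm (h G x))\<^sup>2 \<le> (sqrt (v x) * norm (rep_L2 G x))\<^sup>2"
          unfolding h_def by (intro power_mono B_le) simp
        also have "\<dots> = v x * (norm (rep_L2 G x))\<^sup>2" using v0 by (simp add: power_mult_distrib)
        also have "\<dots> \<le> real n * (norm (rep_L2 F x))\<^sup>2"
          using Gx v0 by (auto intro: mult_right_mono)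
        finally show "ennreal ((norm (h G x))\<^sup>2) \<le> ennreal (real n) * ennreal ((norm (rep_L2 F x))\<^sup>2)"
          by (simp add: ennreal_leI flip: ennreal_mult)
      qed
      also have "\<dots> = ennreal ((sqrt (real n) * norm F)\<^sup>2)"
        by (simp add: nn_integral_cmult nn_integral_rep_L2 power_mult_distrib ennreal_mult)
      finally obtain H where H: "AE x in lborel. rep_L2 H x = h G x"
        by (rule L2_ex_rep[rotated]) auto
      obtain W where W: "AE x in lborel. rep_L2 W x = conv (rep_L2 H) x"
        by (rule free_dirac_conv)
      have conv_eq: "conv (rep_L2 H) x = conv (h G) x" for x
        using H by (intro conv_cong_AE) auto
      have "AE x in lborel. rep_L2 (Q G) x = A x *v rep_L2 W x"
        using Q[of G] W by eventually_elim (simp add: conv_eq)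
      then have "(G, Q G) \<in> T" unfolding T_iff using H W by blast
      with G show ?thesis by blast
    qed
    from choice[OF allI[OF this]] obtain G where G: "\<forall>n. (AE x in lborel. rep_L2 (G n) x =
        (if v x \<le> real n then rep_L2 F x else 0)) \<and> (G n, Q (G n)) \<in> T" ..
    have "G \<longlonglongrightarrow> F" by (rule L2_truncate_tendsto[of v]) (use G in auto)
    then have "(\<lambda>n. (G n, Q (G n))) \<longlonglongrightarrow> (F, Q F)"
      by (intro tendsto_Pair bounded_linear.tendsto[OF bl])
    with G show ?thesis
      unfolding closure_sequential by (intro exI[where x = "\<lambda>n. (G n, Q (G n))"]) simp
  qed
  have "Q_op m V z = {(F, Q F) | F. True}"
  proof
    have "T \<subseteq> {(F, Q F) | F. True}" using T_Q by auto
    then show "Q_op m V z \<subseteq> {(F, Q F) | F. True}"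
      unfolding Q_op_def T_def[symmetric] using closed by (rule closure_minimal)
    show "{(F, Q F) | F. True} \<subseteq> Q_op m V z"
      unfolding Q_op_def T_def[symmetric] using dense by auto
  qed
  with bl norm_Q show ?thesis by (rule that)
qed

end

text \<open>\<open>Lp_fun\<close> speaks of single entries, so integrability of the operator norm
  has to be derived. It is essential here: the integral in \<open>potential_norm\<close> would be
  the default value 0 for a function that is not integrable, and would bound nothing.\<close>

lemma borel_potential:
  fixes V :: "real \<Rightarrow> complex ^ 2 ^ 2"
  assumes p: "1 < p" and V: "\<And>i j. Lp_fun p (\<lambda>x. V x $ i $ j)"
  obtains V' where "V' \<in> borel_measurable lborel" "AE x in lborel. V x = V' x"
    "(\<integral>\<^sup>+x. ennreal (onorm ((*v) (V' x)) powr p) \<partial>lborel) = ennreal (LINT x|lebesgue. onorm ((*v) (V x)) powr p)"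
proof -
  have V_nth: "(\<lambda>x. V x $ i $ j) \<in> borel_measurable lebesgue" for i j
    using V by (simp add: Lp_fun_def)
  have V_meas [measurable]: "V \<in> borel_measurable lebesgue"
    unfolding borel_measurable_vec_iff[of V] borel_measurable_vec_iff[where f = "\<lambda>x. V x $ i" for i]
    using V_nth by blast
  have "\<exists>g \<in> borel_measurable lborel. AE x in lborel. V x $ i $ j = g x" for i j :: 2
  proof -
    obtain r s where rs [measurable]: "r \<in> borel_measurable lborel" "s \<in> borel_measurable lborel"
      and ae: "AE x in lborel. Re (V x $ i $ j) = r x" "AE x in lborel. Im (V x $ i $ j) = s x"
      using completion_ex_borel_measurable_real[of "\<lambda>x. Re (V x $ i $ j)" lborel]
        completion_ex_borel_measurable_real[of "\<lambda>x. Im (V x $ i $ j)" lborel] V_nth[of i j]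
      unfolding borel_measurable_complex_iff by blast
    have "(\<lambda>x. Complex (r x) (s x)) \<in> borel_measurable lborel"
      by (simp add: borel_measurable_complex_iff)
    moreover have "AE x in lborel. V x $ i $ j = Complex (r x) (s x)"
      using ae by eventually_elim (simp add: complex_eq_iff)
    ultimately show ?thesis by (intro bexI[where x = "\<lambda>x. Complex (r x) (s x)"])
  qed
  then obtain g where g [measurable]: "\<And>i j. g i j \<in> borel_measurable lborel"
    and g_eq: "\<And>i j. AE x in lborel. V x $ i $ j = g i j x"
    by metis
  define V' where "V' x = mat22 (g 1 1 x) (g 1 2 x) (g 2 1 x) (g 2 2 x)" for x
  have V' [measurable]: "V' \<in> borel_measurable lborel" unfolding V'_def[abs_def] by measurable
  have eq: "AE x in lborel. V x = V' x"
    using g_eq[of 1 1] g_eq[of 1 2] g_eq[of 2 1] g_eq[of 2 2]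
    by eventually_elim (simp add: V'_def vec_eq_iff forall_2)
  have int_g: "integrable lborel (\<lambda>x. cmod (g i j x) powr p)" for i j
  proof -
    have "AE x in lebesgue. cmod (V x $ i $ j) powr p = cmod (g i j x) powr p"
      unfolding AE_completion_iff using g_eq[of i j] by eventually_elim simp
    moreover have "integrable lebesgue (\<lambda>x. cmod (V x $ i $ j) powr p)" using V by (simp add: Lp_fun_def)
    moreover have "(\<lambda>x. cmod (g i j x) powr p) \<in> borel_measurable lborel" by measurable
    ultimately have "integrable lebesgue (\<lambda>x. cmod (g i j x) powr p)"
      by (subst (asm) integrable_cong_AE) (auto intro: measurable_completion dest: borel_measurable_integrable)
    then show ?thesis by (subst (asm) integrable_completion) auto
  qed
  let ?v = "\<lambda>x. onorm ((*v) (V' x)) powr p"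
  have int: "integrable lborel ?v"
  proof (rule Bochner_Integration.integrable_bound)
    show "integrable lborel (\<lambda>x. 4 powr p * (cmod (g 1 1 x) powr p + cmod (g 1 2 x) powr p + cmod (g 2 1 x) powr p + cmod (g 2 2 x) powr p))"
      using int_g by simp
    show "AE x in lborel. norm (?v x) \<le> norm (4 powr p * (cmod (g 1 1 x) powr p + cmod (g 1 2 x) powr p + cmod (g 2 1 x) powr p + cmod (g 2 2 x) powr p))"
    proof (rule AE_I2)
      fix x
      \<comment> \<open>The operator norm is at most the sum of the four moduli, hence
        \<open>4 * M\<close>. Passing through the maximum makes the power easy to bound, since
        \<open>M powr p\<close> is one of the four summands.\<close>
      define M where "M = Max {cmod (g 1 1 x), cmod (g 1 2 x), cmod (g 2 1 x), cmod (g 2 2 x)}"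
      have M: "cmod (g 1 1 x) \<le> M" "cmod (g 1 2 x) \<le> M" "cmod (g 2 1 x) \<le> M" "cmod (g 2 2 x) \<le> M"
        by (simp_all add: M_def)
      have "onorm ((*v) (V' x)) \<le> norm (V' x)" by (rule onorm_matrix_le_norm)
      also have "\<dots> \<le> norm (V' x $ 1) + norm (V' x $ 2)"
        unfolding norm_vec_def[of "V' x"] using L2_set_le_sum[of UNIV "\<lambda>i. norm (V' x $ i)"] by (simp add: sum_2)
      also have "\<dots> \<le> (cmod (V' x $ 1 $ 1) + cmod (V' x $ 1 $ 2)) + (cmod (V' x $ 2 $ 1) + cmod (V' x $ 2 $ 2))"
        unfolding norm_vec_def[of "V' x $ _"]
        using L2_set_le_sum[of UNIV "\<lambda>j. cmod (V' x $ i $ j)" for i] by (intro add_mono) (simp_all add: sum_2)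
      also have "\<dots> \<le> 4 * M" using M by (simp add: V'_def)
      finally have "?v x \<le> (4 * M) powr p"
        using p by (intro powr_mono2) (auto simp: onorm_pos_le bounded_linear_matrix_vector_mult)
      also have "\<dots> = 4 powr p * M powr p"
        by (rule powr_mult)
      also have "M powr p \<le> cmod (g 1 1 x) powr p + cmod (g 1 2 x) powr p + cmod (g 2 1 x) powr p + cmod (g 2 2 x) powr p"
      proof -
        have "M \<in> {cmod (g 1 1 x), cmod (g 1 2 x), cmod (g 2 1 x), cmod (g 2 2 x)}"
          unfolding M_def by (rule Max_in) auto
        then show ?thesis by (auto simp: add_increasing add_increasing2)
      qed
      finally show "norm (?v x) \<le> norm (4 powr p * (cmod (g 1 1 x) powr p + cmod (g 1 2 x) powr p + cmod (g 2 1 x) powr p + cmod (g 2 2 x) powr p))"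
        by (simp add: mult_left_mono)
    qed
  qed measurable
  have "(LINT x|lebesgue. onorm ((*v) (V x)) powr p) = (LINT x|lebesgue. ?v x)"
  proof (rule Bochner_Integration.integral_cong_AE)
    show "AE x in lebesgue. onorm ((*v) (V x)) powr p = ?v x"
      unfolding AE_completion_iff using eq by eventually_elim simp
    show meas: "?v \<in> borel_measurable lebesgue" by (rule measurable_completion) measurable
    show "(\<lambda>x. onorm ((*v) (V x)) powr p) \<in> borel_measurable lebesgue"
      by measurable
  qed
  also have "\<dots> = (LINT x|lborel. ?v x)" by (rule integral_completion) measurable
  finally have "(\<integral>\<^sup>+x. ennreal (?v x) \<partial>lborel) = ennreal (LINT x|lebesgue. onorm ((*v) (V x)) powr p)"
    using int by (simp add: nn_integral_eq_integral)
  with V' eq show ?thesis by (rule that)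
qed

theorem corollary4p6:
  fixes m p :: real and V :: "real \<Rightarrow> complex ^ 2 ^ 2" and H :: L2_op and z :: complex
  assumes "0 \<le> m"
    and "1 < p"
    and "\<And>i j. Lp_fun p (\<lambda>x. V x $ i $ j)"
    and "dirac_operator m V H"
    and "z \<in> resolvent_set (free_dirac m)"
    and "1 / sqrt 2 * sqrt (1 + ((cmod z)\<^sup>2 + m\<^sup>2) / cmod (z\<^sup>2 - (complex_of_real m)\<^sup>2))
        * (2 * (p - 1) / p) powr ((p - 1) / p)
        * Im (sqrt_upper m z) powr (- ((p - 1) / p))
        * potential_norm p V < 1"
  shows "z \<notin> op_spectrum H"
proof -
  interpret free_resolvent_kernel m z "sqrt_upper m z" by (rule free_resolvent_kernel_sqrt_upper[OF assms(5)])
  define \<kappa> where "\<kappa> = Im (sqrt_upper m z)"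
  have \<kappa>: "\<kappa> > 0" using Im_k by (simp add: \<kappa>_def)
  \<comment> \<open>The conjugate exponent; \<open>1 / q\<close> is the exponent
    \<open>(p - 1) / p\<close> of the hypothesis.\<close>
  define q where "q = p / (p - 1)"
  have q: "1 < q" "1 / q = (p - 1) / p" using assms(2) by (simp_all add: q_def field_simps)
  have pq: "1 / p + 1 / q = 1" unfolding q(2) using assms(2) by (simp add: diff_divide_distrib)
  obtain V' where V' [measurable]: "V' \<in> borel_measurable lborel" and eq: "AE x in lborel. V x = V' x"
    and norm_V': "(\<integral>\<^sup>+x. ennreal (onorm ((*v) (V' x)) powr p) \<partial>lborel) = ennreal (LINT x|lebesgue. onorm ((*v) (V x)) powr p)"
    by (rule borel_potential[OF assms(2,3)])
  \<comment> \<open>Hoelder's bound: the second factor is the \<open>L^q\<close> norm of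
    \<open>decay\<close>, as the integral of \<open>exp (- \<kappa> * q * \<bar>t\<bar>)\<close> is
    \<open>2 / (\<kappa> * q)\<close>.\<close>
  define C where "C = potential_norm p V * (2 / (\<kappa> * q)) powr (1 / q)"
  have C0: "0 \<le> C" by (simp add: C_def potential_norm_def)
  have C: "(\<integral>\<^sup>+y. ennreal (decay (x - y) * onorm ((*v) (V' y))) \<partial>lborel) \<le> ennreal C" for x
  proof -
    have "(\<integral>\<^sup>+y. ennreal (onorm ((*v) (V' y)) * decay (x - y)) \<partial>lborel) \<le>
      ennreal ((LINT x|lebesgue. onorm ((*v) (V x)) powr p) powr (1 / p) * (2 / (\<kappa> * q)) powr (1 / q))"
    proof (rule Hoelder_nn_integral[OF assms(2) q(1) pq])
      show "(\<integral>\<^sup>+y. ennreal (decay (x - y) powr q) \<partial>lborel) \<le> ennreal (2 / (\<kappa> * q))"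
      proof -
        have "decay (x - y) powr q = exp (- (\<kappa> * q) * \<bar>x - y\<bar>)" for y
          by (simp add: exp_powr_real \<kappa>_def mult_ac)
        then have "(\<integral>\<^sup>+y. ennreal (decay (x - y) powr q) \<partial>lborel) = (\<integral>\<^sup>+t. ennreal (exp (- (\<kappa> * q) * \<bar>t\<bar>)) \<partial>lborel)"
          using nn_integral_lborel_reflect[of "\<lambda>t. ennreal (exp (- (\<kappa> * q) * \<bar>t\<bar>))" x] by simp
        also have "\<dots> = ennreal (2 / (\<kappa> * q))" using \<kappa> q(1) by (intro nn_integral_exp_abs) simp
        finally show ?thesis by simp
      qed
      show "0 \<le> (LINT x|lebesgue. onorm ((*v) (V x)) powr p)" by (rule integral_nonneg_AE) simp
      show "0 \<le> 2 / (\<kappa> * q)" using \<kappa> q(1) by simp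
      show "0 \<le> onorm ((*v) (V' y))" for y
        by (rule onorm_pos_le[OF bounded_linear_matrix_vector_mult])
      show "(\<integral>\<^sup>+y. ennreal (onorm ((*v) (V' y)) powr p) \<partial>lborel)
          \<le> ennreal (LINT x|lebesgue. onorm ((*v) (V x)) powr p)"
        by (simp only: norm_V')
    qed auto
    then show ?thesis by (simp add: C_def potential_norm_def mult.commute)
  qed
  let ?r = "(p - 1) / p"
  have "2 / (\<kappa> * q) = (2 * (p - 1) / p) / \<kappa>" using assms(2) by (simp add: q_def)
  then have "(2 / (\<kappa> * q)) powr (1 / q) = ((2 * (p - 1) / p) / \<kappa>) powr ?r"
    by (simp only: q(2))
  also have "\<dots> = (2 * (p - 1) / p) powr ?r / \<kappa> powr ?r"
    by (rule powr_divide)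
  also have "\<dots> = (2 * (p - 1) / p) powr ?r * \<kappa> powr (- ?r)"
    by (simp only: powr_minus divide_inverse)
  finally have "eta_z * C = eta_z * (2 * (p - 1) / p) powr ?r * \<kappa> powr (- ?r) * potential_norm p V"
    by (simp only: C_def mult_ac)
  then have lt: "eta_z * C < 1" using assms(6) by (simp only: eta_z_def \<kappa>_def)
  obtain Q where Q: "bounded_linear Q" "\<And>F. norm (Q F) \<le> eta_z * C * norm F"
    "Q_op m V' z = {(F, Q F) | F. True}"
    using Q_op_eq_graph[OF assms(5) V' C0 C] by metis
  have "- 1 \<in> resolvent_set (Q_op m V z)"
    unfolding Q_op_cong_AE[OF eq] Q(3)
    using minus_one_in_resolvent_set[OF Q(1,2) _ lt] eta_z_nonneg C0 by simp
  \<comment> \<open>Within the resolvent set of the free operator, membership in that of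
    \<open>H\<close> is by definition the invertibility of \<open>I + Q(z)\<close>.\<close>
  then have "z \<in> resolvent_set H"
    using assms(4,5) unfolding dirac_operator_def by blast
  then show ?thesis by (simp add: op_spectrum_def)
qed

end
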